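(* Let $p\in\{2,3,5,7,13\}$. There is an algebraic function $I_p(x,y)$ such that the matrix $(M_{ij})_{i,j\ge1}$ of $U_{(0)}$ with respect to the basis $\{d_p^n\}_{n\ge1}$ satisfies the formal power series identity $$\sum_{i=1}^\infty\sum_{j=1}^\infty M_{ij}x^iy^j=\frac{y}{p}\,\frac{\partial}{\partial y}\log I_p(x,y).$$
   Context: $\Delta(q)=q\prod_{n\ge1}(1-q^n)^{24}$ and $d_p=\sqrt[p-1]{\Delta(q^p)/\Delta(q)}\in q+q^2\mathbb Z[[q]]$, a uniformizer of the genus zero curve $X_0(p)$. $U_{(0)}$ is Atkin's operator $U(\sum a_nq^n)=\sum a_{pn}q^n$ acting on $p$-adic overconvergent cusp forms of tame level $1$ and weight $0$; $M_{ij}$ is defined by $U(d_p^j)=\sum_{i\ge1}M_{ij}d_p^i$. *)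

theory Defs
  imports "HOL-Computational_Algebra.Computational_Algebra"
begin

text \<open>The infinite product prod_{n>=1} (1 - q^n), defined coefficientwise
 (the coefficient of q^k only depends on the factors with n <= k).\<close>
definition eta_prod :: "rat fps" where
  "eta_prod = Abs_fps (\<lambda>k. (\<Prod>n\<in>{1..k}. (1 - fps_X ^ n :: rat fps)) $ k)"

definition Delta :: "rat fps" where
  "Delta = fps_X * eta_prod ^ 24"

definition dp :: "nat \<Rightarrow> rat fps" where
  "dp p = (THE d. d $ 0 = 0 \<and> d $ 1 = 1 \<and> (\<forall>n. d $ n \<in> \<int>) \<and>
              d ^ (p - 1) * Delta = fps_compose Delta (fps_X ^ p))"

definition Uop :: "nat \<Rightarrow> rat fps \<Rightarrow> rat fps" where
  "Uop p f = Abs_fps (\<lambda>n. f $ (p * n))"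

text \<open>M_ij defined by U(d_p^j) = sum_{i>=1} M_ij d_p^i, i.e. U(d_p^j) = g(d_p) with g(0)=0,
 and M_ij = coefficient of g at i.\<close>
definition Mmat :: "nat \<Rightarrow> nat \<Rightarrow> nat \<Rightarrow> rat" where
  "Mmat p i j = (THE g. g $ 0 = 0 \<and> fps_compose g (dp p) = Uop p (dp p ^ j)) $ i"

text \<open>Bivariate series sum_{i,j>=1} M_ij x^i y^j as an element of Q[[x]][[y]]
 (outer variable y, inner variable x).\<close>
definition Mgen :: "nat \<Rightarrow> rat fps fps" where
  "Mgen p = Abs_fps (\<lambda>j. Abs_fps (\<lambda>i. if 1 \<le> i \<and> 1 \<le> j then Mmat p i j else 0))"

definition eval_xy :: "rat poly poly \<Rightarrow> rat fps fps" where
  "eval_xy c = poly (map_poly (\<lambda>a. fps_const (fps_of_poly a)) c) fps_X"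

definition algebraic_xy :: "rat fps fps \<Rightarrow> bool" where
  "algebraic_xy I \<longleftrightarrow> (\<exists>P :: rat poly poly poly. P \<noteq> 0 \<and> poly (map_poly eval_xy P) I = 0)"

end

(* Write d for d_p and t_0, ..., t_(p-1) for the p conjugates d(zeta^k q^(1/p)).  Since
   sum_k t_k^j = p U(d^j), the generating series is p^(-1) y d/dy log I with
   I = 1 / prod_k (1 - t_k y), so I is algebraic over Q(x, y), x = d(q), as soon as every t_k is
   algebraic over Q(d(q)).  That amounts to a modular equation: Delta(q^p)/Delta(q) and
   Delta(q^(p^2))/Delta(q^p) are algebraically dependent.

   The modular equation is obtained without modular transformations.  Jacobi's triple product
   and the theta relations hold for formal series in the nome, with the elliptic variable
   specialised to a p-th root of unity u.  There the squares sn^2(u) satisfy the duplication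
   formula over Q(lambda), and u^(2^m) = u for some m > 0 makes sn^2(u) a root of a nonzero
   polynomial over Q(lambda).  Hence all theta values at p-th roots of unity, normalised by eta,
   are algebraic over Q(lambda); their products over all u give Delta(q^(2p))/Delta(q^2) and
   lambda(q^p), and lambda is eliminated by the exchange property. *)
theory Submission
  imports Defs "HOL-Algebra.Algebraic_Closure_Type" "HOL-Number_Theory.Residues"
begin

section \<open>Relative algebraic closure\<close>

text \<open>The elliptic variable is never a second formal variable: u is a complex constant, so all
  series have the single variable X. Multiplying over all p-th roots of unity then replaces X by
  X^p, because the factors 1 - u a multiply to 1 - a^p.

  The values of sn^2 control only quotients of theta functions. To reach a single theta function
  over eta, these quotients are inserted in theta_1(2z) = theta_1 theta_2 theta_3 theta_4 / eta^3.
  This makes the value at u^2 a known multiple of the fourth power of the value at u, and one turn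
  around the squaring cycle gives h = C h^(4^m) with C already algebraic. Two cases escape: at u =
  1, where theta_1 vanishes, theta_2 theta_3 theta_4 = 2 eta^3 takes over; and for p = 2, where -1
  never returns under squaring, theta constants are enough.

  Dependence is always measured over the prime ring, and roots of unity enter as algebraic elements.
  Hence relations found with complex coefficients descend along injective homomorphisms to rational
  ones.\<close>

definition acl :: "'a::comm_ring_1 set \<Rightarrow> 'a set" where
  "acl A = {x. \<exists>P. P \<noteq> 0 \<and> (\<forall>i. Polynomial.coeff P i \<in> A) \<and> poly P x = 0}"

definition base_ring :: "'a::comm_ring_1 set \<Rightarrow> bool" where
  "base_ring A \<longleftrightarrow> 1 \<in> A \<and> (\<forall>x\<in>A. \<forall>y\<in>A. x - y \<in> A \<and> x * y \<in> A)"

lemma base_ring_0: "base_ring A \<Longrightarrow> 0 \<in> A"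
  unfolding base_ring_def by (metis diff_self)

lemma base_ring_add: "base_ring A \<Longrightarrow> x \<in> A \<Longrightarrow> y \<in> A \<Longrightarrow> x + y \<in> A"
  using base_ring_0[of A] unfolding base_ring_def
  by (metis diff_0 diff_minus_eq_add)

lemma base_ring_mult: "base_ring A \<Longrightarrow> x \<in> A \<Longrightarrow> y \<in> A \<Longrightarrow> x * y \<in> A"
  unfolding base_ring_def by blast

definition quot_set :: "'a::field set \<Rightarrow> 'a set" where
  "quot_set A = {a / b | a b. a \<in> A \<and> b \<in> A \<and> b \<noteq> 0}"

abbreviation type_ring :: "'a::field ring" where
  "type_ring \<equiv> ring_of_type_algebra"

lemma quot_setI: "a \<in> A \<Longrightarrow> b \<in> A \<Longrightarrow> b \<noteq> 0 \<Longrightarrow> a / b \<in> quot_set A"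
  unfolding quot_set_def by blast

lemma subfield_type_ringI:
  fixes K :: "'a::field set"
  assumes "1 \<in> K" "\<And>x y. x \<in> K \<Longrightarrow> y \<in> K \<Longrightarrow> x - y \<in> K"
    and "\<And>x y. x \<in> K \<Longrightarrow> y \<in> K \<Longrightarrow> x * y \<in> K" and "\<And>x. x \<in> K \<Longrightarrow> x \<noteq> 0 \<Longrightarrow> inverse x \<in> K"
  shows "subfield K type_ring"
proof -
  interpret R: field "type_ring :: 'a ring" by rule
  have R: "\<one>\<^bsub>type_ring\<^esub> = (1::'a)" "\<zero>\<^bsub>type_ring\<^esub> = (0::'a)" "carrier type_ring = (UNIV::'a set)"
    "\<And>x y::'a. x \<oplus>\<^bsub>type_ring\<^esub> y = x + y" "\<And>x y::'a. x \<otimes>\<^bsub>type_ring\<^esub> y = x * y"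
    by (auto simp: ring_of_type_algebra_def)
  have m: "\<ominus>\<^bsub>type_ring\<^esub> x = - x" for x :: 'a
    by (rule R.minus_equality) (auto simp: R)
  have i: "inv\<^bsub>type_ring\<^esub> x = inverse x" if "x \<noteq> 0" for x :: 'a
    by (rule R.inv_unique'[symmetric]) (use that in \<open>auto simp: R\<close>)
  have z: "0 \<in> K" using assms(2)[OF assms(1) assms(1)] by simp
  have u: "- x \<in> K" if "x \<in> K" for x using assms(2)[OF z that] by simp
  have s: "x + y \<in> K" if "x \<in> K" "y \<in> K" for x y using assms(2)[OF that(1) u[OF that(2)]] by simp
  have "subring K type_ring"
    by (rule R.subringI) (use assms s u in \<open>auto simp: R m\<close>)
  then show ?thesis
    by (rule R.subfieldI') (use assms i in \<open>auto simp: R\<close>)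
qed

lemma base_ring_quot_set:
  assumes "base_ring A"
  shows "subfield (quot_set A) type_ring"
proof (rule subfield_type_ringI)
  show "1 \<in> quot_set A" using quot_setI[of 1 A 1] assms by (auto simp: base_ring_def)
next
  fix x y assume "x \<in> quot_set A" "y \<in> quot_set A"
  then obtain a b c d where *: "x = a/b" "y = c/d" "a \<in> A" "b \<in> A" "c \<in> A" "d \<in> A" "b \<noteq> 0" "d \<noteq> 0"
    unfolding quot_set_def by blast
  have "(a*d - c*b)/(b*d) \<in> quot_set A"
    by (rule quot_setI) (use * assms in \<open>auto simp: base_ring_def\<close>)
  then show "x - y \<in> quot_set A" using * by (simp add: diff_frac_eq)
  have "(a*c)/(b*d) \<in> quot_set A"
    by (rule quot_setI) (use * assms in \<open>auto simp: base_ring_def\<close>)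
  then show "x * y \<in> quot_set A" using * by simp
next
  fix x assume "x \<in> quot_set A" "x \<noteq> 0"
  then obtain a b where *: "x = a/b" "a \<in> A" "b \<in> A" "b \<noteq> 0" unfolding quot_set_def by blast
  then have "a \<noteq> 0" using \<open>x \<noteq> 0\<close> by auto
  then have "b/a \<in> quot_set A" using * by (intro quot_setI)
  then show "inverse x \<in> quot_set A" using * by simp
qed

text \<open>Bridge to the algebraic closure theory for carrier-based rings, from which closure under
  field operations and transitivity are taken. Polynomials there are coefficient lists with the
  leading coefficient first, hence the reversals.\<close>

lemma algebraic_over_iff_acl:
  fixes K :: "'a::field set"
  assumes "subfield K type_ring"
  shows "(ring.algebraic type_ring over K) x \<longleftrightarrow> x \<in> acl K"
proof -
  interpret R: field "type_ring :: 'a ring" by rule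
  have R: "\<one>\<^bsub>type_ring\<^esub> = (1::'a)" "\<zero>\<^bsub>type_ring\<^esub> = (0::'a)" "carrier type_ring = (UNIV::'a set)"
    "\<And>x y::'a. x \<oplus>\<^bsub>type_ring\<^esub> y = x + y" "\<And>x y::'a. x \<otimes>\<^bsub>type_ring\<^esub> y = x * y"
    by (auto simp: ring_of_type_algebra_def)
  have pw: "x [^]\<^bsub>type_ring\<^esub> n = x ^ n" for n :: nat
    by (induction n) (auto simp: R R.nat_pow_Suc)
  have sr: "subring K type_ring" using assms by (rule subfieldE(1))
  have z: "0 \<in> K" using subringE(2)[OF sr] by (simp add: R)
  have ev: "R.eval p x = poly (Poly (rev p)) x" for p
    by (induction p) (auto simp: R pw Poly_append poly_monom mult.commute)
  show ?thesis
  proof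
    assume "(ring.algebraic type_ring over K) x"
    then obtain p where p: "p \<in> carrier (K[X]\<^bsub>type_ring\<^esub>)" "p \<noteq> []" "R.eval p x = \<zero>\<^bsub>type_ring\<^esub>"
      using R.algebraicE[OF sr, of x] by (auto simp: R)
    have sK: "set p \<subseteq> K" and hd: "hd p \<noteq> 0"
      using p by (auto simp: univ_poly_def polynomial_def R)
    have "Poly (rev p) \<noteq> 0"
    proof
      assume "Poly (rev p) = 0"
      then obtain n where "rev p = replicate n 0" by (auto simp: Poly_eq_0)
      then have "p = replicate n 0" by (metis rev_replicate rev_rev_ident)
      then show False using hd p(2) by (cases n) auto
    qed
    moreover have "Polynomial.coeff (Poly (rev p)) i \<in> K" for i
      using sK z by (cases "i < length p") (auto simp: coeff_Poly_eq nth_default_def rev_nth)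
    ultimately show "x \<in> acl K" using p(3) by (auto simp: acl_def ev R)
  next
    assume "x \<in> acl K"
    then obtain P where P: "P \<noteq> 0" "\<forall>i. Polynomial.coeff P i \<in> K" "poly P x = 0"
      unfolding acl_def by blast
    let ?p = "rev (coeffs P)"
    have "set ?p \<subseteq> K" using P(2) by (auto simp: in_set_conv_nth coeffs_nth length_coeffs_degree P(1))
    moreover have "hd ?p \<noteq> 0" using P(1) by (simp add: hd_rev last_coeffs_eq_coeff_degree)
    ultimately have "?p \<in> carrier (K[X]\<^bsub>type_ring\<^esub>)"
      by (simp add: univ_poly_def polynomial_def R)
    moreover have "?p \<noteq> []" using P by simp
    moreover have "R.eval ?p x = \<zero>\<^bsub>type_ring\<^esub>" using P by (simp add: ev R)
    ultimately show "(ring.algebraic type_ring over K) x" by (rule R.algebraicI)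
  qed
qed

text \<open>Denominators of the finitely many coefficients are multiplied up. This makes
  algebraicity over a subring the same as over its field of fractions, so the field theory applies
  to \<open>acl A\<close>.\<close>

lemma common_denominator:
  assumes A: "base_ring A" and P: "\<And>i. Polynomial.coeff P i \<in> quot_set A"
  shows "\<exists>d\<in>A. d \<noteq> 0 \<and> (\<forall>i. d * Polynomial.coeff P i \<in> A)"
  using P
proof (induction P)
  case 0
  then show ?case using A by (auto simp: base_ring_def base_ring_0 intro!: bexI[of _ 1])
next
  case (pCons a P)
  have "Polynomial.coeff P i \<in> quot_set A" for i using pCons.prems[of "Suc i"] by simp
  then obtain d where d: "d \<in> A" "d \<noteq> 0" "\<And>i. d * Polynomial.coeff P i \<in> A"
    using pCons.IH by blast
  obtain b c where bc: "a = b / c" "b \<in> A" "c \<in> A" "c \<noteq> 0"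
    using pCons.prems[of 0] unfolding quot_set_def by auto
  have "d * c * Polynomial.coeff (pCons a P) i \<in> A" for i
  proof (cases i)
    case 0
    then show ?thesis using bc d base_ring_mult[OF A] by (auto simp: base_ring_def)
  next
    case (Suc j)
    have "d * c * Polynomial.coeff P j = c * (d * Polynomial.coeff P j)" by simp
    moreover have "c * (d * Polynomial.coeff P j) \<in> A" using bc d base_ring_mult[OF A] by blast
    ultimately show ?thesis using Suc by (simp add: mult_ac)
  qed
  then show ?case using bc d base_ring_mult[OF A] by (intro bexI[of _ "d*c"]) auto
qed

lemma acl_mono: "A \<subseteq> B \<Longrightarrow> acl A \<subseteq> acl B"
  unfolding acl_def by blast

lemma base_subset_quot_set: "base_ring A \<Longrightarrow> A \<subseteq> quot_set A"
  using quot_setI[of _ A 1] by (auto simp: base_ring_def)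

lemma acl_quot_set:
  assumes "base_ring A"
  shows "acl (quot_set A) = acl A"
proof
  show "acl A \<subseteq> acl (quot_set A)" by (rule acl_mono[OF base_subset_quot_set[OF assms]])
  show "acl (quot_set A) \<subseteq> acl A"
  proof
    fix x assume "x \<in> acl (quot_set A)"
    then obtain P where P: "P \<noteq> 0" "\<forall>i. Polynomial.coeff P i \<in> quot_set A" "poly P x = 0"
      unfolding acl_def by blast
    then obtain d where "d \<noteq> 0" "\<forall>i. d * Polynomial.coeff P i \<in> A"
      using common_denominator[OF assms] by blast
    then show "x \<in> acl A" using P unfolding acl_def by (auto intro!: exI[of _ "Polynomial.smult d P"])
  qed
qed

lemma acl_eq_algebraics:
  assumes "base_ring A"
  shows "acl A = {x \<in> carrier type_ring. (ring.algebraic type_ring over (quot_set A)) x}"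
  using algebraic_over_iff_acl[OF base_ring_quot_set[OF assms]] acl_quot_set[OF assms]
  by (auto simp: ring_of_type_algebra_def)

lemma subfield_acl: "base_ring A \<Longrightarrow> subfield (acl A) type_ring"
  using field.subfield_of_algebraics[OF field_from_type_algebra base_ring_quot_set, of A]
  by (simp add: acl_eq_algebraics)

lemma base_subset_acl: "base_ring A \<Longrightarrow> x \<in> A \<Longrightarrow> x \<in> acl A"
  unfolding acl_def
  by (auto intro!: exI[of _ "[:-x, 1:]"] simp: coeff_pCons base_ring_0 split: nat.splits)
     (metis base_ring_0 base_ring_def diff_0)+

context
  fixes A :: "'a::field set"
  assumes A: "base_ring A"
begin

lemma acl_closed:
  shows acl_add: "x \<in> acl A \<Longrightarrow> y \<in> acl A \<Longrightarrow> x + y \<in> acl A"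
    and acl_mult: "x \<in> acl A \<Longrightarrow> y \<in> acl A \<Longrightarrow> x * y \<in> acl A"
    and acl_uminus: "x \<in> acl A \<Longrightarrow> - x \<in> acl A"
    and acl_inverse: "x \<in> acl A \<Longrightarrow> inverse x \<in> acl A"
proof -
  interpret R: field "type_ring :: 'a ring" by rule
  have R: "\<one>\<^bsub>type_ring\<^esub> = (1::'a)" "\<zero>\<^bsub>type_ring\<^esub> = (0::'a)" "carrier type_ring = (UNIV::'a set)"
    "\<And>x y::'a. x \<oplus>\<^bsub>type_ring\<^esub> y = x + y" "\<And>x y::'a. x \<otimes>\<^bsub>type_ring\<^esub> y = x * y"
    by (auto simp: ring_of_type_algebra_def)
  have m: "\<ominus>\<^bsub>type_ring\<^esub> x = - x" for x :: 'a
    by (rule R.minus_equality) (auto simp: R)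
  have i: "inv\<^bsub>type_ring\<^esub> x = inverse x" if "x \<noteq> 0" for x :: 'a
    by (rule R.inv_unique'[symmetric]) (use that in \<open>auto simp: R\<close>)
  note sf = subfield_acl[OF A]
  note sr = subfieldE(1)[OF sf]
  show "x \<in> acl A \<Longrightarrow> y \<in> acl A \<Longrightarrow> x + y \<in> acl A" using subringE(7)[OF sr] by (simp add: R)
  show "x \<in> acl A \<Longrightarrow> y \<in> acl A \<Longrightarrow> x * y \<in> acl A" using subringE(6)[OF sr] by (simp add: R)
  show "x \<in> acl A \<Longrightarrow> - x \<in> acl A" using subringE(5)[OF sr] by (simp add: m)
  show "x \<in> acl A \<Longrightarrow> inverse x \<in> acl A"
    using R.subfield_m_inv(1)[OF sf, of x] i[of x] by (cases "x = 0") (auto simp: R)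
qed

lemma acl_diff: "x \<in> acl A \<Longrightarrow> y \<in> acl A \<Longrightarrow> x - y \<in> acl A"
  using acl_add[of x "- y"] acl_uminus[of y] by simp

lemma acl_divide: "x \<in> acl A \<Longrightarrow> y \<in> acl A \<Longrightarrow> x / y \<in> acl A"
  using acl_mult[of x "inverse y"] acl_inverse[of y] by (simp add: divide_inverse)

lemma acl_1: "1 \<in> acl A"
  using base_subset_acl[OF A] A by (simp add: base_ring_def)

lemma acl_0: "0 \<in> acl A"
  using base_subset_acl[OF A] base_ring_0[OF A] by simp

lemma acl_power: "x \<in> acl A \<Longrightarrow> x ^ n \<in> acl A"
  by (induction n) (auto intro: acl_1 acl_mult)

lemma acl_of_nat: "of_nat n \<in> acl A"
  by (induction n) (auto intro: acl_0 acl_1 acl_add)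

lemma acl_numeral: "numeral n \<in> acl A"
  using acl_of_nat[of "numeral n"] by simp

lemma acl_prod: "(\<And>i. i \<in> S \<Longrightarrow> f i \<in> acl A) \<Longrightarrow> prod f S \<in> acl A"
  by (induction S rule: infinite_finite_induct) (auto intro: acl_1 acl_mult)

text \<open>Tower argument: the coefficients of an equation for x generate a finite extension F of
  the field of fractions of A, and x is finite over F, so x lies in a finite-dimensional extension
  of the base.\<close>

lemma acl_acl:
  assumes "x \<in> acl (acl A)"
  shows "x \<in> acl A"
proof -
  interpret R: field "type_ring :: 'a ring" by rule
  have R: "carrier type_ring = (UNIV::'a set)" "\<zero>\<^bsub>type_ring\<^esub> = (0::'a)"
    by (auto simp: ring_of_type_algebra_def)
  note K = base_ring_quot_set[OF A]
  obtain P where P: "P \<noteq> 0" "\<forall>i. Polynomial.coeff P i \<in> acl A" "poly P x = 0"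
    using assms unfolding acl_def[of "acl A"] by blast
  let ?F = "R.finite_extension (quot_set A) (coeffs P)"
  have alg: "(R.algebraic over (quot_set A)) c" if "c \<in> set (coeffs P)" for c
    using P that algebraic_over_iff_acl[OF K] acl_quot_set[OF A] by (metis in_set_conv_nth coeffs_nth length_coeffs_degree less_Suc_eq_le)
  have sf: "subfield ?F type_ring"
    by (rule R.finite_extension_is_subfield[OF K]) (auto simp: R alg)
  have cF: "c \<in> ?F" if "c \<in> set (coeffs P)" for c
    using R.finite_extension_mem[OF subfieldE(1)[OF K], of "coeffs P"] that by (auto simp: R)
  have "0 \<in> ?F" using subringE(2)[OF subfieldE(1)[OF sf]] by (simp add: R)
  then have "Polynomial.coeff P i \<in> ?F" for i
    using cF[of "Polynomial.coeff P i"] range_coeff[of P] by (cases "Polynomial.coeff P i = 0") auto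
  then have "x \<in> acl ?F" using P unfolding acl_def by blast
  then have "(R.algebraic over ?F) x" using algebraic_over_iff_acl[OF sf] by blast
  then have fd2: "ring.finite_dimension type_ring ?F (R.simple_extension ?F x)"
    using R.finite_dimension_simple_extension[OF sf] by (simp add: R)
  have "ring.finite_dimension type_ring (quot_set A) ?F"
    by (rule R.finite_extension_finite_dimension(1)[OF K]) (auto simp: R alg)
  then have fd: "ring.finite_dimension type_ring (quot_set A) (R.simple_extension ?F x)"
    using R.telescopic_base_dim(1)[OF K sf _ fd2] by blast
  have "(R.algebraic over (quot_set A)) x"
    using R.finite_dimension_imp_algebraic[OF K _ fd]
      R.simple_extension_is_subring[OF subfieldE(1)[OF sf]] R.simple_extension_mem[OF subfieldE(1)[OF sf]]
    by (simp add: R del: R.finite_extension.simps)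
  then show ?thesis using algebraic_over_iff_acl[OF K] acl_quot_set[OF A] by blast
qed

lemma acl_root_of:
  assumes "Q \<noteq> 0" "\<And>i. Polynomial.coeff Q i \<in> acl A" "poly Q x = 0"
  shows "x \<in> acl A"
  by (rule acl_acl) (use assms in \<open>auto simp: acl_def[of "acl A"]\<close>)

text \<open>Theta and eta functions have fractional leading exponents, so only powers of them are
  handled directly; this lemma removes the powers afterwards.\<close>

lemma acl_nth_root:
  assumes "x ^ n \<in> acl A" "n > 0"
  shows "x \<in> acl A"
proof (rule acl_root_of)
  let ?Q = "Polynomial.monom 1 n - [:x ^ n:]"
  have c: "Polynomial.coeff ?Q n = 1" using assms(2) by (simp add: coeff_pCons split: nat.splits)
  then show "?Q \<noteq> 0" by (metis coeff_0 zero_neq_one)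
  show "poly ?Q x = 0" by (simp add: poly_monom)
  show "Polynomial.coeff ?Q i \<in> acl A" for i
    using assms acl_0 acl_1 acl_uminus[OF assms(1)]
    by (auto simp: coeff_pCons split: nat.splits)
qed

end

section \<open>Formal infinite products and lattice sums\<close>

definition fconv :: "(nat \<Rightarrow> 'a::comm_ring_1 fps) \<Rightarrow> 'a fps \<Rightarrow> bool" where
  "fconv s f \<longleftrightarrow> (\<forall>k. \<forall>\<^sub>F m in sequentially. s m $ k = f $ k)"

text \<open>Identities between infinite products and lattice sums are obtained by exhibiting both
  sides as limits of the same finite expressions.\<close>

lemma fconv_unique: "fconv s f \<Longrightarrow> fconv s g \<Longrightarrow> f = g"
proof (rule fps_ext)
  fix k assume "fconv s f" "fconv s g"
  then have "\<forall>\<^sub>F m in sequentially. s m $ k = f $ k" "\<forall>\<^sub>F m in sequentially. s m $ k = g $ k"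
    by (auto simp: fconv_def)
  then have "\<forall>\<^sub>F m in sequentially. f $ k = g $ k" by eventually_elim simp
  then show "f $ k = g $ k" by simp
qed

lemma fconv_const: "fconv (\<lambda>_. f) f"
  by (simp add: fconv_def)

lemma fconv_upto:
  assumes "fconv s f"
  shows "\<forall>\<^sub>F m in sequentially. \<forall>i\<le>k. s m $ i = f $ i"
proof -
  have "\<forall>\<^sub>F m in sequentially. \<forall>i\<in>{..k}. s m $ i = f $ i"
    using assms by (intro eventually_ball_finite) (auto simp: fconv_def)
  then show ?thesis by (simp add: Ball_def)
qed

lemma fconv_mult:
  assumes "fconv s f" "fconv t g"
  shows "fconv (\<lambda>m. s m * t m) (f * g)"
  unfolding fconv_def
proof
  fix k
  show "\<forall>\<^sub>F m in sequentially. (s m * t m) $ k = (f * g) $ k"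
    using fconv_upto[OF assms(1), of k] fconv_upto[OF assms(2), of k]
    by eventually_elim (auto simp: fps_mult_nth intro!: sum.cong)
qed

lemma fconv_subseq: "fconv s f \<Longrightarrow> filterlim g at_top sequentially \<Longrightarrow> fconv (\<lambda>m. s (g m)) f"
  unfolding fconv_def by (auto intro: eventually_compose_filterlim)

lemma compose_X_power_nth:
  fixes f :: "'a::comm_ring_1 fps"
  assumes "p > 0"
  shows "(f oo fps_X ^ p) $ k = (if p dvd k then f $ (k div p) else 0)"
proof -
  have "(f oo fps_X ^ p) $ k = (\<Sum>i=0..k. if k = p * i then f $ i else 0)"
    by (simp add: fps_compose_nth flip: power_mult) (auto intro!: sum.cong)
  also have "\<dots> = (\<Sum>i\<in>(if p dvd k then {k div p} else {}). f $ i)"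
    using assms by (intro sum.mono_neutral_cong_right) (auto split: if_splits)
  finally show ?thesis by simp
qed

lemma fconv_compose_X_power:
  assumes "fconv s f" "p > 0"
  shows "fconv (\<lambda>m. s m oo fps_X ^ p) (f oo fps_X ^ p)"
  using assms by (auto simp: fconv_def compose_X_power_nth)

text \<open>The recursion for the k-th coefficient of an inverse involves only the coefficients up
  to k, which are eventually stationary.\<close>

lemma fconv_inverse:
  fixes s :: "nat \<Rightarrow> 'a::field fps"
  assumes "fconv s f" "\<And>m. s m $ 0 \<noteq> 0"
  shows "fconv (\<lambda>m. inverse (s m)) (inverse f)"
  unfolding fconv_def
proof
  fix k
  show "\<forall>\<^sub>F m in sequentially. inverse (s m) $ k = inverse f $ k"
    using fconv_upto[OF assms(1), of k]
  proof eventually_elim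
    case (elim m)
    have "f $ 0 \<noteq> 0" using elim assms(2)[of m] by auto
    have "i \<le> k \<Longrightarrow> natfun_inverse (s m) i = natfun_inverse f i" for i
    proof (induction i rule: less_induct)
      case (less i)
      then show ?case using elim
        by (cases i) (auto intro!: sum.cong arg_cong2[of _ _ _ _ "(*)"])
    qed
    then show ?case by (simp add: fps_inverse_def fps_inv_def)
  qed
qed

text \<open>The factors are assumed to satisfy \<open>F n = 1 + O(X\<^sup>n)\<close>, so that the partial products
  become stationary in each coefficient.\<close>
definition iprod :: "(nat \<Rightarrow> 'a::comm_ring_1 fps) \<Rightarrow> 'a fps" where
  "iprod F = Abs_fps (\<lambda>k. (\<Prod>n\<in>{1..k}. F n) $ k)"

definition near1 :: "(nat \<Rightarrow> 'a::comm_ring_1 fps) \<Rightarrow> bool" where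
  "near1 F \<longleftrightarrow> (\<forall>n\<ge>1. \<exists>g. F n = 1 + fps_X ^ n * g)"

lemma fconv_iprod:
  assumes "near1 F"
  shows "fconv (\<lambda>m. \<Prod>n\<in>{1..m}. F n) (iprod F)"
proof -
  have "(\<Prod>n\<in>{1..k+j}. F n) $ k = (\<Prod>n\<in>{1..k}. F n) $ k" for k j
  proof (induction j)
    case (Suc j)
    obtain g where "F (k + Suc j) = 1 + fps_X ^ (k + Suc j) * g"
      using assms unfolding near1_def by (metis One_nat_def Suc_le_eq add_Suc_right zero_less_Suc)
    then have "(\<Prod>n\<in>{1..k+Suc j}. F n) = (\<Prod>n\<in>{1..k+j}. F n) + fps_X ^ (k + Suc j) * (g * (\<Prod>n\<in>{1..k+j}. F n))"
      by (simp add: algebra_simps del: power_Suc)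
    then have "(\<Prod>n\<in>{1..k+Suc j}. F n) $ k = (\<Prod>n\<in>{1..k+j}. F n) $ k"
      by (simp add: fps_X_power_mult_nth del: power_Suc)
    then show ?case using Suc by simp
  qed simp
  then have "(\<Prod>n\<in>{1..m}. F n) $ k = iprod F $ k" if "k \<le> m" for k m
    using le_Suc_ex[OF that] by (auto simp: iprod_def)
  then show ?thesis
    unfolding fconv_def eventually_sequentially by blast
qed

lemma near1_mult: "near1 F \<Longrightarrow> near1 G \<Longrightarrow> near1 (\<lambda>n. F n * G n)"
  unfolding near1_def
proof safe
  fix n :: nat assume a: "\<forall>n\<ge>1. \<exists>g. F n = 1 + fps_X ^ n * g" "\<forall>n\<ge>1. \<exists>g. G n = 1 + fps_X ^ n * g" "1 \<le> n"
  then obtain g h where "F n = 1 + fps_X ^ n * g" "G n = 1 + fps_X ^ n * h" by metis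
  then have "F n * G n = 1 + fps_X ^ n * (g + h + fps_X ^ n * g * h)"
    by (simp add: algebra_simps)
  then show "\<exists>g. F n * G n = 1 + fps_X ^ n * g" by blast
qed

lemma iprod_mult: "near1 F \<Longrightarrow> near1 G \<Longrightarrow> iprod F * iprod G = iprod (\<lambda>n. F n * G n)"
  using fconv_unique[OF fconv_mult[OF fconv_iprod fconv_iprod], of F G] 
    fconv_iprod[OF near1_mult, of F G] by (simp add: prod.distrib)

lemma near1_1: "near1 (\<lambda>n. 1)"
  unfolding near1_def by (auto intro!: exI[of _ 0])

lemma iprod_1: "iprod (\<lambda>n. 1) = 1"
  by (auto simp: iprod_def fps_eq_iff)

lemma near1_prod: "(\<And>i. i \<in> S \<Longrightarrow> near1 (F i)) \<Longrightarrow> near1 (\<lambda>n. \<Prod>i\<in>S. F i n)"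
  by (induction S rule: infinite_finite_induct) (auto intro: near1_1 near1_mult)

lemma iprod_prod:
  assumes "\<And>i. i \<in> S \<Longrightarrow> near1 (F i)"
  shows "(\<Prod>i\<in>S. iprod (F i)) = iprod (\<lambda>n. \<Prod>i\<in>S. F i n)"
  using assms
proof (induction S rule: infinite_finite_induct)
  case (insert x S)
  then show ?case using iprod_mult[of "F x" "\<lambda>n. \<Prod>i\<in>S. F i n"] near1_prod[of S F] by auto
qed (auto simp: iprod_1)

lemma near1_compose:
  fixes F :: "nat \<Rightarrow> 'a::idom fps"
  assumes "near1 F" "p > 0"
  shows "near1 (\<lambda>n. F n oo fps_X ^ p)"
  unfolding near1_def
proof safe
  fix n :: nat assume "n \<ge> 1"
  then obtain g where "F n = 1 + fps_X ^ n * g" using assms by (auto simp: near1_def)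
  then have "F n oo fps_X ^ p = 1 + fps_X ^ (p * n) * (g oo fps_X ^ p)"
    using assms by (simp add: fps_compose_add_distrib fps_compose_mult_distrib fps_X_power_compose power_mult)
  also have "p * n = n + (p - 1) * n" using assms(2) by (cases p) auto
  finally show "\<exists>h. F n oo fps_X ^ p = 1 + fps_X ^ n * h" by (auto simp: power_add mult.assoc)
qed

lemma iprod_compose:
  fixes F :: "nat \<Rightarrow> 'a::idom fps"
  assumes "near1 F" "p > 0"
  shows "iprod F oo fps_X ^ p = iprod (\<lambda>n. F n oo fps_X ^ p)"
  using fconv_unique[OF fconv_compose_X_power[OF fconv_iprod[OF assms(1)] assms(2)]]
    fconv_iprod[OF near1_compose[OF assms]] assms(2)
  by (simp add: fps_compose_prod_distrib)

text \<open>Pairing consecutive factors only passes to the partial products of even length, a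
  subsequence with the same limit.\<close>

lemma iprod_even_odd:
  assumes "near1 F" "near1 (\<lambda>n. F (2*n - 1) * F (2*n))"
  shows "iprod F = iprod (\<lambda>n. F (2*n - 1) * F (2*n))"
proof -
  have *: "(\<Prod>n\<in>{1..2*m}. F n) = (\<Prod>n\<in>{1..m}. F (2*n - 1) * F (2*n))" for m
    by (induction m) (auto simp: mult_ac)
  have "fconv (\<lambda>m. \<Prod>n\<in>{1..2*m}. F n) (iprod F)"
    by (rule fconv_subseq[OF fconv_iprod[OF assms(1)]]) (auto intro: filterlim_subseq simp: strict_mono_def)
  then show ?thesis
    unfolding * by (rule fconv_unique[OF _ fconv_iprod[OF assms(2)]])
qed

lemma iprod_nth_0 [simp]: "iprod F $ 0 = 1"
  by (simp add: iprod_def)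

text \<open>The series with terms \<open>c i * X^(h i)\<close> over an arbitrary index type. A sum
  over an infinite fibre is 0 by convention, so \<open>fin_fibres h\<close> is what gives the
  definition its intended meaning.\<close>

definition gsum :: "('i \<Rightarrow> nat) \<Rightarrow> ('i \<Rightarrow> 'a::comm_ring_1) \<Rightarrow> 'a fps" where
  "gsum h c = Abs_fps (\<lambda>N. \<Sum>i\<in>h -` {N}. c i)"

definition fin_fibres :: "('i \<Rightarrow> nat) \<Rightarrow> bool" where
  "fin_fibres h \<longleftrightarrow> (\<forall>N. finite (h -` {N}))"

lemma fin_fibres_add:
  assumes "fin_fibres h" "fin_fibres h'"
  shows "fin_fibres (\<lambda>(i, j). h i + h' j)"
  unfolding fin_fibres_def
proof
  fix N
  have "(\<lambda>(i, j). h i + h' j) -` {N} \<subseteq> (\<Union>k\<in>{0..N}. h -` {k} \<times> h' -` {N - k})"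
    by auto
  then show "finite ((\<lambda>(i, j). h i + h' j) -` {N})"
    by (rule finite_subset) (use assms in \<open>auto simp: fin_fibres_def\<close>)
qed

lemma gsum_mult:
  assumes "fin_fibres h" "fin_fibres h'"
  shows "gsum h c * gsum h' c' = gsum (\<lambda>(i, j). h i + h' j) (\<lambda>(i, j). c i * c' j)"
proof (rule fps_ext)
  fix N
  have eq: "(\<lambda>(i, j). h i + h' j) -` {N} = (\<Union>k\<in>{0..N}. h -` {k} \<times> h' -` {N - k})"
    by auto
  have "(gsum h c * gsum h' c') $ N = (\<Sum>k=0..N. \<Sum>(i,j)\<in>h -` {k} \<times> h' -` {N - k}. c i * c' j)"
    by (simp add: fps_mult_nth gsum_def sum_product sum.cartesian_product)
  also have "\<dots> = (\<Sum>(i,j)\<in>(\<Union>k\<in>{0..N}. h -` {k} \<times> h' -` {N - k}). c i * c' j)"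
    using assms by (intro sum.UNION_disjoint[symmetric]) (auto simp: fin_fibres_def)
  finally show "(gsum h c * gsum h' c') $ N = gsum (\<lambda>(i, j). h i + h' j) (\<lambda>(i, j). c i * c' j) $ N"
    by (simp add: gsum_def eq)
qed

lemma gsum_X_power: "fps_X ^ k * gsum h c = gsum (\<lambda>i. h i + k) c"
proof (rule fps_ext)
  fix N
  have "(\<lambda>i. h i + k) -` {N} = (if N < k then {} else h -` {N - k})" by auto
  then show "(fps_X ^ k * gsum h c) $ N = gsum (\<lambda>i. h i + k) c $ N"
    by (simp add: fps_X_power_mult_nth gsum_def)
qed

lemma gsum_const: "fps_const a * gsum h c = gsum h (\<lambda>i. a * c i)"
  by (auto simp: fps_eq_iff gsum_def sum_distrib_left)

lemma gsum_compose: "p > 0 \<Longrightarrow> gsum h c oo fps_X ^ p = gsum (\<lambda>i. p * h i) c"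
proof (rule fps_ext)
  fix N assume "p > 0"
  then have "(\<lambda>i. p * h i) -` {N} = (if p dvd N then h -` {N div p} else {})" by auto
  then show "(gsum h c oo fps_X ^ p) $ N = gsum (\<lambda>i. p * h i) c $ N"
    using \<open>p > 0\<close> by (simp add: compose_X_power_nth gsum_def)
qed

lemma gsum_reindex: "bij f \<Longrightarrow> gsum h c = gsum (h \<circ> f) (c \<circ> f)"
  unfolding gsum_def fps_eq_iff
proof safe
  fix N assume "bij f"
  then have "bij_betw f ((h \<circ> f) -` {N}) (h -` {N})"
    unfolding vimage_comp[symmetric]
    by (intro bij_betw_imageI) (auto intro: inj_on_subset dest: bij_is_inj simp: bij_is_surj surj_image_vimage_eq)
  then show "Abs_fps (\<lambda>N. sum c (h -` {N})) $ N = Abs_fps (\<lambda>N. sum (c \<circ> f) ((h \<circ> f) -` {N})) $ N"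
    by (simp add: sum.reindex_bij_betw[symmetric])
qed

lemma gsum_split:
  fixes f :: "'j \<Rightarrow> 'i" and g :: "'k \<Rightarrow> 'i"
  assumes "fin_fibres h" "inj f" "inj g" "range f \<inter> range g = {}" "range f \<union> range g = UNIV"
  shows "gsum h c = gsum (h \<circ> f) (c \<circ> f) + gsum (h \<circ> g) (c \<circ> g)"
proof (rule fps_ext)
  fix N
  have eq: "h -` {N} = f ` ((h \<circ> f) -` {N}) \<union> g ` ((h \<circ> g) -` {N})"
  proof
    show "h -` {N} \<subseteq> f ` ((h \<circ> f) -` {N}) \<union> g ` ((h \<circ> g) -` {N})"
    proof
      fix x assume "x \<in> h -` {N}"
      moreover have "x \<in> range f \<union> range g" using assms(5) by auto
      ultimately show "x \<in> f ` ((h \<circ> f) -` {N}) \<union> g ` ((h \<circ> g) -` {N})" by auto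
    qed
  qed auto
  have fin: "finite (f ` ((h \<circ> f) -` {N}))" "finite (g ` ((h \<circ> g) -` {N}))"
    using assms(1) eq unfolding fin_fibres_def by (metis finite_Un)+
  have "sum c (h -` {N}) = sum c (f ` ((h \<circ> f) -` {N})) + sum c (g ` ((h \<circ> g) -` {N}))"
    unfolding eq using fin assms(4) by (intro sum.union_disjoint) auto
  then show "gsum h c $ N = (gsum (h \<circ> f) (c \<circ> f) + gsum (h \<circ> g) (c \<circ> g)) $ N"
    using assms(2,3) by (simp add: gsum_def sum.reindex inj_on_subset[OF _ subset_UNIV])
qed

section \<open>Theta series\<close>

abbreviation cc :: "complex \<Rightarrow> complex fps" where "cc \<equiv> fps_const"

text \<open>With \<open>u = exp (2iz)\<close> and \<open>X\<close> the nome, \<open>theta3 u\<close> is \<open>\<theta>\<^sub>3(z)\<close> and \<open>theta2 u\<close> is \<open>\<theta>\<^sub>2(z)\<close> without the factor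
  \<open>X\<close>^(1/4) \<open>u\<close>^(1/2); \<open>theta3 (- u)\<close> and \<open>theta2 (- u)\<close> play the roles of \<open>\<theta>\<^sub>4\<close> and \<open>\<theta>\<^sub>1\<close>.\<close>
definition theta3 :: "complex \<Rightarrow> complex fps" where
  "theta3 u = gsum (\<lambda>n::int. nat (n * n)) (\<lambda>n. u powi n)"

definition theta2 :: "complex \<Rightarrow> complex fps" where
  "theta2 u = gsum (\<lambda>n::int. nat (n * n + n)) (\<lambda>n. u powi n)"

lemma nn_plus_n_nonneg: "0 \<le> n * n + (n::int)"
proof (cases "n \<ge> 0")
  case False
  then have "0 \<le> (- n) * (- n - 1)" by (intro mult_nonneg_nonneg) auto
  then show ?thesis by (simp add: algebra_simps)
qed auto

lemma finite_quadratic_le: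
  assumes "t \<in> {0, 1::int}"
  shows "finite {n. nat (n * n + t * n) \<le> N}"
proof (rule finite_subset)
  show "{n. nat (n * n + t * n) \<le> N} \<subseteq> {- int N - 1 .. int N + 1}"
  proof
    fix n assume "n \<in> {n. nat (n * n + t * n) \<le> N}"
    then have n: "n * n + t * n \<le> int N" by auto
    have "n \<le> int N + 1"
    proof (rule ccontr)
      assume "\<not> n \<le> int N + 1"
      then have "n > int N + 1" "n > 0" by auto
      then have "n * 1 \<le> n * n" by (intro mult_left_mono) auto
      moreover have "0 \<le> t * n" using assms \<open>n > 0\<close> by auto
      ultimately have "n \<le> n * n" "0 \<le> t * n" by simp_all
      then show False using n \<open>n > int N + 1\<close> by linarith
    qed
    moreover have "- int N - 1 \<le> n"
    proof (rule ccontr)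
      assume "\<not> - int N - 1 \<le> n"
      then have m: "- n > int N + 1" "- n > 0" by auto
      then have "(- n) * 1 \<le> (-n) * (- n - t)" using assms by (intro mult_left_mono) auto
      then have "- n \<le> n * n + t * n" by (simp add: algebra_simps)
      then show False using n m by linarith
    qed
    ultimately show "n \<in> {- int N - 1 .. int N + 1}" by simp
  qed
qed auto

lemma fin_fibres_quadratic: "t \<in> {0, 1::int} \<Longrightarrow> fin_fibres (\<lambda>n. nat (n * n + t * n))"
  unfolding fin_fibres_def by (auto intro: finite_subset[OF _ finite_quadratic_le])

lemmas fin_fibres_theta3 = fin_fibres_quadratic[of 0, simplified]
lemmas fin_fibres_theta2 = fin_fibres_quadratic[of 1, simplified]

lemma fin_fibres_scale:
  assumes "fin_fibres h" "p > 0"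
  shows "fin_fibres (\<lambda>i. p * h i)"
  unfolding fin_fibres_def
proof
  fix N
  show "finite ((\<lambda>i. p * h i) -` {N})"
    by (rule finite_subset[of _ "h -` {N div p}"]) (use assms in \<open>auto simp: fin_fibres_def\<close>)
qed

text \<open>Pairs (m, n) are separated by the parity of m + n: the even sublattice has coordinates
  (a + b, a - b), and its coset is reached by adding (1, 0).\<close>

lemma int_lattice_split:
  assumes "fin_fibres (h :: int \<times> int \<Rightarrow> nat)"
  shows "gsum h c = gsum (\<lambda>(a, b). h (a + b, a - b)) (\<lambda>(a, b). c (a + b, a - b)) +
    gsum (\<lambda>(a, b). h (a + b + 1, a - b)) (\<lambda>(a, b). c (a + b + 1, a - b))"
proof -
  let ?f = "\<lambda>(a, b). (a + b, a - b :: int)" and ?g = "\<lambda>(a, b). (a + b + 1, a - b :: int)"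
  have inj: "inj ?f" "inj ?g" by (auto simp: inj_def)
  have "range ?f \<inter> range ?g = {}"
  proof -
    have False if "a + b = a' + b' + 1" "a - b = a' - b'" for a b a' b' :: int
      using that by presburger
    then show ?thesis by auto
  qed
  moreover have "range ?f \<union> range ?g = UNIV"
  proof -
    have "(m, n) \<in> range ?f \<union> range ?g" for m n :: int
    proof (cases "even (m + n)")
      case True
      then have "(m, n) = ?f ((m + n) div 2, (m - n) div 2)" by auto presburger+
      then show ?thesis by blast
    next
      case False
      then have "(m, n) = ?g ((m + n - 1) div 2, (m - n - 1) div 2)" by auto presburger+
      then show ?thesis by blast
    qed
    then show ?thesis by auto
  qed
  ultimately show ?thesis
    using gsum_split[OF assms inj, of c] by (simp add: o_def case_prod_unfold)
qed

lemma nat_eqI: "int a = int b \<Longrightarrow> a = b"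
  by simp

lemma int_nat_sq: "int (nat (x * x)) = x * x" "int (nat (x * x + x)) = x * x + x"
  by (auto simp: nn_plus_n_nonneg)

text \<open>The product is a sum over the square lattice. Rotating by m = a + b, n = a - b turns m^2
  + n^2 into 2 (a^2 + b^2), so the sum over each coset factors into two theta series in X^2.\<close>

lemma theta3_theta3:
  assumes "u \<noteq> 0" "v \<noteq> 0"
  shows "theta3 u * theta3 v = (theta3 (u * v) oo fps_X ^ 2) * (theta3 (u / v) oo fps_X ^ 2) +
     fps_X * cc u * (theta2 (u * v) oo fps_X ^ 2) * (theta2 (u / v) oo fps_X ^ 2)"
proof -
  note ff = fin_fibres_add[OF fin_fibres_theta3 fin_fibres_theta3]
  have fc: "fin_fibres (\<lambda>n::int. 2 * nat (n * n))" "fin_fibres (\<lambda>n::int. 2 * nat (n * n + n))"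
    by (auto intro: fin_fibres_scale fin_fibres_theta3 fin_fibres_theta2)
  have e1: "nat ((a + b) * (a + b)) + nat ((a - b) * (a - b)) = 2 * nat (a * a) + 2 * nat (b * b)" for a b :: int
    by (rule nat_eqI) (simp only: of_nat_add of_nat_mult of_nat_numeral of_nat_1 int_nat_sq, simp add: algebra_simps)
  have e2: "nat ((a + b + 1) * (a + b + 1)) + nat ((a - b) * (a - b)) =
      2 * nat (a * a + a) + 2 * nat (b * b + b) + 1" for a b :: int
    by (rule nat_eqI) (simp only: of_nat_add of_nat_mult of_nat_numeral of_nat_1 int_nat_sq, simp add: algebra_simps)
  have p1: "u powi (a + b) * v powi (a - b) = (u * v) powi a * (u / v) powi b" for a b
    using assms by (simp add: power_int_add power_int_diff power_int_mult_distrib power_int_divide_distrib)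
  have p2: "u powi (a + b + 1) * v powi (a - b) = u * ((u * v) powi a * (u / v) powi b)" for a b
    using assms by (simp add: power_int_add power_int_diff power_int_mult_distrib power_int_divide_distrib)
  have "theta3 u * theta3 v = gsum (\<lambda>(i, j). nat (i * i) + nat (j * j)) (\<lambda>(i, j). u powi i * v powi j)"
    unfolding theta3_def by (rule gsum_mult[OF fin_fibres_theta3 fin_fibres_theta3])
  also have "\<dots> = gsum (\<lambda>(a, b). 2 * nat (a * a) + 2 * nat (b * b)) (\<lambda>(a, b). (u * v) powi a * (u / v) powi b)
     + gsum (\<lambda>(a, b). 2 * nat (a * a + a) + 2 * nat (b * b + b) + 1) (\<lambda>(a, b). u * ((u * v) powi a * (u / v) powi b))"
    by (subst int_lattice_split[OF ff]) (simp only: case_prod_unfold fst_conv snd_conv e1 e2 p1 p2)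
  also have "gsum (\<lambda>(a, b). 2 * nat (a * a) + 2 * nat (b * b)) (\<lambda>(a, b). (u * v) powi a * (u / v) powi b)
    = (theta3 (u * v) oo fps_X ^ 2) * (theta3 (u / v) oo fps_X ^ 2)"
    unfolding theta3_def by (simp add: gsum_compose gsum_mult fc)
  also have "gsum (\<lambda>(a, b). 2 * nat (a * a + a) + 2 * nat (b * b + b) + 1) (\<lambda>(a, b). u * ((u * v) powi a * (u / v) powi b))
    = fps_X ^ 1 * (cc u * ((theta2 (u * v) oo fps_X ^ 2) * (theta2 (u / v) oo fps_X ^ 2)))"
    unfolding theta2_def by (simp only: gsum_compose gsum_mult fc gsum_const gsum_X_power zero_less_numeral)
       (simp add: case_prod_unfold)
  finally show ?thesis by (simp add: mult.assoc)
qed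

lemma theta2_theta2:
  assumes "u \<noteq> 0" "v \<noteq> 0"
  shows "theta2 u * theta2 v = (theta2 (u * v) oo fps_X ^ 2) * (theta3 (u / v) oo fps_X ^ 2) +
     cc (1 / v) * (theta3 (u * v) oo fps_X ^ 2) * (theta2 (u / v) oo fps_X ^ 2)"
proof -
  note ff = fin_fibres_add[OF fin_fibres_theta2 fin_fibres_theta2]
  have fc: "fin_fibres (\<lambda>n::int. 2 * nat (n * n))" "fin_fibres (\<lambda>n::int. 2 * nat (n * n + n))"
    by (auto intro: fin_fibres_scale fin_fibres_theta3 fin_fibres_theta2)
  have e1: "nat ((a + b) * (a + b) + (a + b)) + nat ((a - b) * (a - b) + (a - b)) = 2 * nat (a * a + a) + 2 * nat (b * b)" for a b :: int
    by (rule nat_eqI) (simp only: of_nat_add of_nat_mult of_nat_numeral of_nat_1 int_nat_sq, simp add: algebra_simps)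
  have e2: "nat ((a - 1 + b + 1) * (a - 1 + b + 1) + (a - 1 + b + 1)) + nat ((a - 1 - b) * (a - 1 - b) + (a - 1 - b)) =
      2 * nat (a * a) + 2 * nat (b * b + b)" for a b :: int
    by (rule nat_eqI) (simp only: of_nat_add of_nat_mult of_nat_numeral of_nat_1 int_nat_sq, simp add: algebra_simps)
  have p1: "u powi (a + b) * v powi (a - b) = (u * v) powi a * (u / v) powi b" for a b
    using assms by (simp add: power_int_add power_int_diff power_int_mult_distrib power_int_divide_distrib)
  have p2: "u powi (a - 1 + b + 1) * v powi (a - 1 - b) = (1 / v) * ((u * v) powi a * (u / v) powi b)" for a b
    using assms by (simp add: power_int_add power_int_diff power_int_mult_distrib power_int_divide_distrib)
  \<comment> \<open>On the odd coset the exponent is symmetric only after shifting a by one; the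
    shift makes it 2 a^2 + 2 (b^2 + b) and leaves the factor 1/v.\<close>
  have bij: "bij (\<lambda>(a, b). (a - 1, b :: int) :: int \<times> int)"
    by (rule o_bij[of "\<lambda>(a, b). (a + 1, b)"]) auto
  have "theta2 u * theta2 v = gsum (\<lambda>(i, j). nat (i * i + i) + nat (j * j + j)) (\<lambda>(i, j). u powi i * v powi j)"
    unfolding theta2_def by (rule gsum_mult[OF fin_fibres_theta2 fin_fibres_theta2])
  also have "\<dots> = gsum (\<lambda>(a, b). 2 * nat (a * a + a) + 2 * nat (b * b)) (\<lambda>(a, b). (u * v) powi a * (u / v) powi b)
     + gsum (\<lambda>(a, b). 2 * nat (a * a) + 2 * nat (b * b + b)) (\<lambda>(a, b). (1 / v) * ((u * v) powi a * (u / v) powi b))"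
    apply (subst int_lattice_split[OF ff])
    apply (subst gsum_reindex[OF bij, of "\<lambda>(a, b). case (a + b + 1, a - b) of (i, j) \<Rightarrow> nat (i * i + i) + nat (j * j + j)"])
    apply (simp only: o_def case_prod_unfold fst_conv snd_conv e1 e2 p1 p2)
    done
  also have "gsum (\<lambda>(a, b). 2 * nat (a * a + a) + 2 * nat (b * b)) (\<lambda>(a, b). (u * v) powi a * (u / v) powi b)
    = (theta2 (u * v) oo fps_X ^ 2) * (theta3 (u / v) oo fps_X ^ 2)"
    unfolding theta3_def theta2_def by (simp add: gsum_compose gsum_mult fc)
  also have "gsum (\<lambda>(a, b). 2 * nat (a * a) + 2 * nat (b * b + b)) (\<lambda>(a, b). (1 / v) * ((u * v) powi a * (u / v) powi b))
    = cc (1 / v) * ((theta3 (u * v) oo fps_X ^ 2) * (theta2 (u / v) oo fps_X ^ 2))"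
    unfolding theta2_def theta3_def by (simp only: gsum_compose gsum_mult fc gsum_const zero_less_numeral)
       (simp add: case_prod_unfold)
  finally show ?thesis by (simp add: mult.assoc)
qed

section \<open>Jacobi's triple product\<close>

lemma fconv_cong_ev:
  assumes "fconv s f" "\<forall>\<^sub>F m in sequentially. s m = t m"
  shows "fconv t f"
  unfolding fconv_def
proof
  fix k
  have "\<forall>\<^sub>F m in sequentially. s m $ k = f $ k" using assms(1) by (simp add: fconv_def)
  then show "\<forall>\<^sub>F m in sequentially. t m $ k = f $ k" using assms(2) by eventually_elim simp
qed

definition qfac :: "nat \<Rightarrow> complex fps" where
  "qfac m = (\<Prod>n\<in>{1..m}. 1 - fps_X ^ (2 * n))"

text \<open>The value 0 at negative arguments plays the part of 1/(j)! at negative j and makes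
  \<open>gbin N k\<close> vanish for k outside [-N, N], so index shifts need no boundary
  terms.\<close>

definition rqfac :: "int \<Rightarrow> complex fps" where
  "rqfac j = (if j < 0 then 0 else inverse (qfac (nat j)))"

text \<open>The Gaussian binomial coefficient \<open>[2N; N+k]\<close> with base \<open>X\<^sup>2\<close>.\<close>
definition gbin :: "nat \<Rightarrow> int \<Rightarrow> complex fps" where
  "gbin N k = qfac (2 * N) * rqfac (int N + k) * rqfac (int N - k)"

lemma qfac_0 [simp]: "qfac 0 = 1"
  by (simp add: qfac_def)

lemma qfac_Suc: "qfac (Suc m) = (1 - fps_X ^ (2 * m + 2)) * qfac m"
  by (simp add: qfac_def mult.commute)

lemma qfac_nth_0 [simp]: "qfac m $ 0 = 1"
  by (induction m) (auto simp: qfac_Suc)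

lemma rqfac_0 [simp]: "rqfac 0 = 1"
  by (simp add: rqfac_def)

lemma rqfac_neg: "j < 0 \<Longrightarrow> rqfac j = 0"
  by (simp add: rqfac_def)

lemma rqfac_nat: "rqfac (int m) = inverse (qfac m)"
  by (simp add: rqfac_def)

lemma rqfac_step: "rqfac (int m) = (1 - fps_X ^ (2 * m + 2)) * rqfac (int m + 1)"
proof -
  have "rqfac (int m + 1) = inverse (qfac (Suc m))"
    using rqfac_nat[of "Suc m"] by (simp add: add.commute)
  then have "rqfac (int m + 1) = inverse (1 - fps_X ^ (2 * m + 2)) * inverse (qfac m)"
    by (simp add: qfac_Suc fps_inverse_mult)
  moreover have "(1 - fps_X ^ (2 * m + 2)) * inverse (1 - fps_X ^ (2 * m + 2)) = (1 :: complex fps)"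
    by (rule inverse_mult_eq_1') simp
  ultimately show ?thesis by (simp add: rqfac_nat mult.assoc[symmetric])
qed

text \<open>At m = 0 both sides vanish: the factor 1 - X^0 agrees with the convention that
  \<open>rqfac\<close> is 0 at -1.\<close>

lemma rqfac_step2:
  "rqfac (int m - 1) = (1 - fps_X ^ (2 * m)) * ((1 - fps_X ^ (2 * m + 2)) * rqfac (int m + 1))"
proof (cases m)
  case 0
  then show ?thesis by (simp add: rqfac_neg)
next
  case (Suc n)
  then have "rqfac (int m - 1) = (1 - fps_X ^ (2 * n + 2)) * rqfac (int m)"
    using rqfac_step[of n] by (simp add: add.commute)
  then show ?thesis using Suc rqfac_step[of m] by simp
qed

lemma qfac_rqfac: "qfac m * rqfac (int m) = 1"
  by (simp add: rqfac_nat inverse_mult_eq_1')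

lemma gbin_0: "gbin 0 k = (if k = 0 then 1 else 0)"
  by (auto simp: gbin_def rqfac_neg) (metis linorder_neqE_linordered_idom neg_less_0_iff_less rqfac_neg)

lemma gbin_eq_0: "\<bar>k\<bar> > int N \<Longrightarrow> gbin N k = 0"
  by (cases "k > 0") (auto simp: gbin_def rqfac_neg)

lemma gbin_uminus: "gbin N (- k) = gbin N k"
  by (simp add: gbin_def mult_ac)

lemma gbin_top: "gbin N (int N) = 1"
  using qfac_rqfac[of "2 * N"] by (simp add: gbin_def)

text \<open>Two Pascal rules at once, since the upper index grows by two. The three terms mirror the
  expansion of the next pair of factors in the triple product. For k = N + 1 or k = -N - 1 only one
  term survives; otherwise, in terms of A = X^(2(N+k)) and B = X^(2(N-k)), it is a polynomial
  identity.\<close>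

lemma gbin_Suc:
  assumes "\<bar>k\<bar> \<le> int N + 1"
  shows "gbin (Suc N) k = (1 + fps_X ^ (4 * N + 2)) * gbin N k +
    fps_X ^ nat (2 * int N + 2 - 2 * k) * gbin N (k - 1) +
    fps_X ^ nat (2 * int N + 2 + 2 * k) * gbin N (k + 1)"
proof -
  consider "k = int N + 1" | "k = - (int N + 1)" | "\<bar>k\<bar> \<le> int N" using assms by linarith
  then show ?thesis
  proof cases
    case 1
    then show ?thesis using gbin_top[of N] gbin_top[of "Suc N"]
      by (simp add: gbin_eq_0 add.commute)
  next
    case 2
    then have k: "k = - int (Suc N)" "k + 1 = - int N" by auto
    have "gbin (Suc N) k = 1"
      unfolding k(1) by (simp only: gbin_uminus gbin_top)
    moreover have "gbin N (k + 1) = 1"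
      unfolding k(2) by (simp only: gbin_uminus gbin_top)
    moreover have "gbin N k = 0" "gbin N (k - 1) = 0" using 2 by (auto intro!: gbin_eq_0)
    ultimately show ?thesis using 2 by simp
  next
    case 3
    define a b where "a = nat (int N + k)" and "b = nat (int N - k)"
    have ab: "int N + k = int a" "int N - k = int b" "2 * N = a + b"
      using 3 by (auto simp: a_def b_def)
    define A B :: "complex fps" where "A = fps_X ^ (2 * a)" and "B = fps_X ^ (2 * b)"
    define Q :: "complex fps" where "Q = fps_X ^ 2"
    define x y where "x = rqfac (int a + 1)" and "y = rqfac (int b + 1)"
    have qq: "fps_X ^ (2 * a + 2) = Q * A" "fps_X ^ (2 * b + 2) = Q * B"
      by (simp_all only: A_def B_def Q_def power_add mult.commute)
    have ra: "rqfac (int a) = (1 - Q * A) * x" "rqfac (int a - 1) = (1 - A) * ((1 - Q * A) * x)"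
      using rqfac_step[of a] rqfac_step2[of a] unfolding qq A_def[symmetric] x_def[symmetric] by blast+
    have rb: "rqfac (int b) = (1 - Q * B) * y" "rqfac (int b - 1) = (1 - B) * ((1 - Q * B) * y)"
      using rqfac_step[of b] rqfac_step2[of b] unfolding qq B_def[symmetric] y_def[symmetric] by blast+
    have e1: "fps_X ^ (4 * N + 2) = Q * A * B"
    proof -
      have "4 * N + 2 = 2 + 2 * a + 2 * b" using ab(3) by simp
      then show ?thesis by (simp only: A_def B_def Q_def power_add)
    qed
    have e2: "fps_X ^ nat (2 * int N + 2 - 2 * k) = Q * B"
    proof -
      have "nat (2 * int N + 2 - 2 * k) = 2 + 2 * b" using ab(2) by linarith
      then show ?thesis by (simp only: B_def Q_def power_add)
    qed
    have e3: "fps_X ^ nat (2 * int N + 2 + 2 * k) = Q * A"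
    proof -
      have "nat (2 * int N + 2 + 2 * k) = 2 + 2 * a" using ab(1) by linarith
      then show ?thesis by (simp only: A_def Q_def power_add)
    qed
    have D: "qfac (2 * Suc N) = (1 - Q * (Q * A * B)) * ((1 - Q * A * B) * qfac (2 * N))"
    proof -
      have "2 * (2 * N) + 2 = 4 * N + 2" "2 * Suc (2 * N) + 2 = 2 + (4 * N + 2)" by auto
      then have "qfac (2 * Suc N) = (1 - fps_X ^ (2 + (4 * N + 2))) * ((1 - fps_X ^ (4 * N + 2)) * qfac (2 * N))"
        using qfac_Suc[of "2 * N"] qfac_Suc[of "Suc (2 * N)"] by simp
      then show ?thesis by (simp only: power_add[of _ 2] e1 Q_def)
    qed
    have g: "gbin (Suc N) k = qfac (2 * Suc N) * x * y"
      "gbin N k = qfac (2 * N) * rqfac (int a) * rqfac (int b)"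
      "gbin N (k - 1) = qfac (2 * N) * rqfac (int a - 1) * rqfac (int b + 1)"
      "gbin N (k + 1) = qfac (2 * N) * rqfac (int a + 1) * rqfac (int b - 1)"
      using ab(1,2) by (auto simp: gbin_def x_def y_def algebra_simps)
    show ?thesis
      unfolding g e1 e2 e3 D ra rb x_def[symmetric] y_def[symmetric]
      by (simp add: algebra_simps)
  qed
qed

definition jexp :: "int \<Rightarrow> int \<Rightarrow> nat" where
  "jexp t k = nat (k * k + t * k)"

lemma int_jexp: "t \<in> {0, 1} \<Longrightarrow> int (jexp t k) = k * k + t * k"
  using nn_plus_n_nonneg[of k] by (auto simp: jexp_def)

text \<open>The parameter t covers both series: t = 0 leads to \<open>theta3\<close>, t = 1 to
  \<open>theta2\<close>. The range of summation is fixed by M instead of N so that it does not move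
  during the induction; the surplus terms are zero.\<close>

lemma finite_jacobi_triple_product:
  fixes t :: nat
  assumes u: "u \<noteq> 0" and t: "t \<in> {0, 1}" and M: "N \<le> M"
  shows "(\<Prod>n<N. (1 + cc u * fps_X ^ (2 * n + 1 + t)) * (1 + cc (1 / u) * fps_X ^ (2 * n + 1 - t))) =
    (\<Sum>k\<in>{- int M..int M}. fps_X ^ jexp t k * cc (u powi k) * gbin N k)"
  using M
proof (induction N)
  case 0
  have "(\<Sum>k\<in>{- int M..int M}. fps_X ^ jexp t k * cc (u powi k) * gbin 0 k) =
    (\<Sum>k\<in>{0::int}. fps_X ^ jexp t k * cc (u powi k) * gbin 0 k)"
    by (intro sum.mono_neutral_right) (auto simp: gbin_0)
  then show ?case by (simp add: gbin_0 jexp_def)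
next
  case (Suc N)
  let ?T = "\<lambda>k. fps_X ^ jexp t k * cc (u powi k) * gbin N k"
  define f where "f k = fps_X ^ (jexp t (k - 1) + 2 * N + 1 + t) * cc (u powi k) * gbin N (k - 1)" for k
  define g where "g k = fps_X ^ (jexp t (k + 1) + 2 * N + 1 - t) * cc (u powi k) * gbin N (k + 1)" for k
  have t': "int t \<in> {0, 1}" using t by auto
  have fT: "?T k * (cc u * fps_X ^ (2 * N + 1 + t)) = f (k + 1)" for k
    using u by (simp add: f_def power_add power_int_add mult_ac flip: fps_const_mult)
  have gT: "?T k * (cc (1 / u) * fps_X ^ (2 * N + 1 - t)) = g (k - 1)" for k
  proof -
    have "jexp t k + 2 * N + 1 - t = jexp t k + (2 * N + 1 - t)" using t by auto
    moreover have "u powi (k - 1) = u powi k * (1 / u)" using u by (simp add: power_int_diff)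
    ultimately show ?thesis
      by (simp add: g_def power_add mult_ac flip: fps_const_mult)
  qed
  \<comment> \<open>Shifting the index costs nothing: N < M, so \<open>gbin N\<close> vanishes at
    the terms that enter and leave the range.\<close>
  have sf: "(\<Sum>k\<in>{- int M..int M}. f (k + 1)) = (\<Sum>k\<in>{- int M..int M}. f k)"
  proof -
    have "(\<Sum>k\<in>{- int M..int M}. f (k + 1)) = (\<Sum>k\<in>{- int M + 1..int M + 1}. f k)"
      by (rule sum.reindex_bij_witness[of _ "\<lambda>k. k - 1" "\<lambda>k. k + 1"]) auto
    also have "\<dots> = (\<Sum>k\<in>{- int M..int M + 1}. f k)"
      using Suc.prems by (intro sum.mono_neutral_left) (auto simp: f_def intro!: gbin_eq_0)
    also have "\<dots> = (\<Sum>k\<in>{- int M..int M}. f k)"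
      using Suc.prems by (intro sum.mono_neutral_right) (auto simp: f_def intro!: gbin_eq_0)
    finally show ?thesis .
  qed
  have sg: "(\<Sum>k\<in>{- int M..int M}. g (k - 1)) = (\<Sum>k\<in>{- int M..int M}. g k)"
  proof -
    have "(\<Sum>k\<in>{- int M..int M}. g (k - 1)) = (\<Sum>k\<in>{- int M - 1..int M - 1}. g k)"
      by (rule sum.reindex_bij_witness[of _ "\<lambda>k. k + 1" "\<lambda>k. k - 1"]) auto
    also have "\<dots> = (\<Sum>k\<in>{- int M - 1..int M}. g k)"
      using Suc.prems by (intro sum.mono_neutral_left) (auto simp: g_def intro!: gbin_eq_0)
    also have "\<dots> = (\<Sum>k\<in>{- int M..int M}. g k)"
      using Suc.prems by (intro sum.mono_neutral_right) (auto simp: g_def intro!: gbin_eq_0)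
    finally show ?thesis .
  qed
  have step: "?T k * (1 + fps_X ^ (4 * N + 2)) + f k + g k =
    fps_X ^ jexp t k * cc (u powi k) * gbin (Suc N) k" for k
  proof (cases "\<bar>k\<bar> \<le> int N + 1")
    case True
    have ef: "fps_X ^ (jexp t (k - 1) + 2 * N + 1 + t) = fps_X ^ jexp t k * (fps_X :: complex fps) ^ nat (2 * int N + 2 - 2 * k)"
    proof -
      have "jexp t (k - 1) + 2 * N + 1 + t = jexp t k + nat (2 * int N + 2 - 2 * k)"
        using True int_jexp[OF t', of k] int_jexp[OF t', of "k - 1"]
        by (intro nat_eqI) (simp add: algebra_simps)
      then show ?thesis by (simp only: power_add)
    qed
    have eg: "fps_X ^ (jexp t (k + 1) + 2 * N + 1 - t) = fps_X ^ jexp t k * (fps_X :: complex fps) ^ nat (2 * int N + 2 + 2 * k)"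
    proof -
      have "jexp t (k + 1) + 2 * N + 1 - t = jexp t k + nat (2 * int N + 2 + 2 * k)"
        using True t int_jexp[OF t', of k] int_jexp[OF t', of "k + 1"]
        by (intro nat_eqI) (auto simp: algebra_simps of_nat_diff)
      then show ?thesis by (simp only: power_add)
    qed
    show ?thesis
      unfolding f_def g_def ef eg gbin_Suc[OF True] by (simp add: algebra_simps)
  next
    case False
    then show ?thesis by (simp add: f_def g_def gbin_eq_0)
  qed
  have "(\<Prod>n<Suc N. (1 + cc u * fps_X ^ (2 * n + 1 + t)) * (1 + cc (1 / u) * fps_X ^ (2 * n + 1 - t))) =
    (\<Sum>k\<in>{- int M..int M}. ?T k) * ((1 + cc u * fps_X ^ (2 * N + 1 + t)) * (1 + cc (1 / u) * fps_X ^ (2 * N + 1 - t)))"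
    using Suc by simp
  also have "(1 + cc u * fps_X ^ (2 * N + 1 + t)) * (1 + cc (1 / u) * fps_X ^ (2 * N + 1 - t)) =
    (1 + fps_X ^ (4 * N + 2)) + cc u * fps_X ^ (2 * N + 1 + t) + cc (1 / u) * fps_X ^ (2 * N + 1 - t)"
  proof -
    have "4 * N + 2 = (2 * N + 1 + t) + (2 * N + 1 - t)" using t by auto
    then have "fps_X ^ (4 * N + 2) = fps_X ^ (2 * N + 1 + t) * (fps_X :: complex fps) ^ (2 * N + 1 - t)"
      by (simp only: power_add)
    moreover have "cc u * cc (1 / u) = 1" using u by simp
    ultimately show ?thesis by (simp add: algebra_simps)
  qed
  also have "(\<Sum>k\<in>{- int M..int M}. ?T k) * \<dots> =
    (\<Sum>k\<in>{- int M..int M}. ?T k * (1 + fps_X ^ (4 * N + 2))) + (\<Sum>k\<in>{- int M..int M}. f (k + 1)) + (\<Sum>k\<in>{- int M..int M}. g (k - 1))"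
    by (simp only: distrib_left sum_distrib_right fT gT sum.distrib)
  also have "\<dots> = (\<Sum>k\<in>{- int M..int M}. fps_X ^ jexp t k * cc (u powi k) * gbin (Suc N) k)"
    unfolding sf sg by (simp only: step sum.distrib[symmetric])
  finally show ?case .
qed

text \<open>In Pochhammer notation these are the infinite products (aX; X), (aX; X^2) and (aX^2;
  X^2). In particular \<open>qprod_even 1\<close> is eta at q = X^2 without its factor
  X^(1/12).\<close>

definition qprod :: "complex \<Rightarrow> complex fps" where "qprod a = iprod (\<lambda>n. 1 - cc a * fps_X ^ n)"
definition qprod_odd :: "complex \<Rightarrow> complex fps" where "qprod_odd a = iprod (\<lambda>n. 1 - cc a * fps_X ^ (2 * n - 1))"
definition qprod_even :: "complex \<Rightarrow> complex fps" where "qprod_even a = iprod (\<lambda>n. 1 - cc a * fps_X ^ (2 * n))"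

lemma near1_monom:
  assumes "\<And>n. n \<ge> 1 \<Longrightarrow> e n \<ge> n"
  shows "near1 (\<lambda>n. 1 - fps_const a * fps_X ^ e n :: 'a::comm_ring_1 fps)"
  unfolding near1_def
proof safe
  fix n :: nat assume "n \<ge> 1"
  then have "fps_X ^ e n = fps_X ^ n * (fps_X :: 'a fps) ^ (e n - n)"
    using assms[of n] by (simp flip: power_add)
  then have "1 - fps_const a * fps_X ^ e n = 1 + fps_X ^ n * (- (fps_const a * fps_X ^ (e n - n)))"
    by (simp add: algebra_simps)
  then show "\<exists>g. 1 - fps_const a * fps_X ^ e n = 1 + fps_X ^ n * g" by blast
qed

lemma near1_L: "near1 (\<lambda>n. 1 - cc a * fps_X ^ n)"
  and near1_M: "near1 (\<lambda>n. 1 - cc a * fps_X ^ (2 * n - 1))"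
  and near1_qprod_even: "near1 (\<lambda>n. 1 - cc a * fps_X ^ (2 * n))"
  by (rule near1_monom; simp)+

lemma fconv_qprod_even: "fconv (\<lambda>m. \<Prod>n\<in>{1..m}. 1 - cc a * fps_X ^ (2 * n)) (qprod_even a)"
  unfolding qprod_even_def by (rule fconv_iprod[OF near1_qprod_even])

lemma fconv_qprod_odd: "fconv (\<lambda>m. \<Prod>n\<in>{1..m}. 1 - cc a * fps_X ^ (2 * n - 1)) (qprod_odd a)"
  unfolding qprod_odd_def by (rule fconv_iprod[OF near1_M])

lemma fconv_qfac: "fconv qfac (qprod_even 1)"
  using fconv_qprod_even[of 1] by (simp add: qfac_def[abs_def])

lemma qprod_even_nth_0 [simp]: "qprod_even a $ 0 = 1" and qprod_nth_0 [simp]: "qprod a $ 0 = 1" and qprod_odd_nth_0 [simp]: "qprod_odd a $ 0 = 1"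
  by (simp_all add: qprod_even_def qprod_def qprod_odd_def)

lemma fconv_rqfac: "fconv (\<lambda>N. rqfac (int N + k)) (inverse (qprod_even 1))"
proof (rule fconv_cong_ev)
  have "filterlim (\<lambda>N. nat (int N + k)) at_top sequentially"
    unfolding filterlim_at_top eventually_sequentially
  proof
    fix Z :: nat
    show "\<exists>M. \<forall>N\<ge>M. Z \<le> nat (int N + k)"
      by (rule exI[of _ "Z + nat \<bar>k\<bar>"]) linarith
  qed
  then have "fconv (\<lambda>N. qfac (nat (int N + k))) (qprod_even 1)" by (rule fconv_subseq[OF fconv_qfac])
  then show "fconv (\<lambda>N. inverse (qfac (nat (int N + k)))) (inverse (qprod_even 1))"
    by (rule fconv_inverse) simp
  show "\<forall>\<^sub>F N in sequentially. inverse (qfac (nat (int N + k))) = rqfac (int N + k)"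
    unfolding eventually_sequentially
  proof (intro exI allI impI)
    fix N assume "N \<ge> nat \<bar>k\<bar>"
    then show "inverse (qfac (nat (int N + k))) = rqfac (int N + k)" by (simp add: rqfac_def)
  qed
qed

text \<open>All q-factorials tend to the same product E, and E E / (E E) = 1. This is why the
  weights of the finite identity disappear in the limit.\<close>

lemma fconv_qfac_gbin: "fconv (\<lambda>N. qfac N * gbin N k) 1"
proof -
  have "fconv (\<lambda>N. qfac (2 * N)) (qprod_even 1)"
    by (rule fconv_subseq[OF fconv_qfac]) (auto intro: filterlim_subseq simp: strict_mono_def)
  then have "fconv (\<lambda>N. qfac N * (qfac (2 * N) * rqfac (int N + k) * rqfac (int N + (- k))))
     (qprod_even 1 * (qprod_even 1 * inverse (qprod_even 1) * inverse (qprod_even 1)))"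
    by (intro fconv_mult fconv_qfac fconv_rqfac)
  moreover have "qprod_even 1 * inverse (qprod_even 1) = 1" by (rule inverse_mult_eq_1') simp
  ultimately show ?thesis by (simp add: gbin_def mult.left_commute)
qed

lemma jacobi_triple_product:
  fixes t :: nat
  assumes u: "u \<noteq> 0" and t: "t \<in> {0, 1}"
  shows "fconv (\<lambda>N. qfac N * (\<Prod>n<N. (1 + cc u * fps_X ^ (2 * n + 1 + t)) * (1 + cc (1 / u) * fps_X ^ (2 * n + 1 - t))))
    (gsum (jexp t) (\<lambda>k. u powi k))"
  unfolding fconv_def
proof
  fix j
  let ?P = "\<lambda>N. qfac N * (\<Prod>n<N. (1 + cc u * fps_X ^ (2 * n + 1 + t)) * (1 + cc (1 / u) * fps_X ^ (2 * n + 1 - t)))"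
  \<comment> \<open>Only the finitely many k in K have exponent at most j, so the j-th coefficient
    needs the convergence of just these weights; this justifies exchanging limit and sum.\<close>
  define K where "K = {k. jexp t k \<le> j}"
  have t': "int t \<in> {0, 1}" using t by auto
  have fin: "finite K" using finite_quadratic_le[OF t', of j] by (simp add: K_def jexp_def)
  obtain B where B: "\<And>k. k \<in> K \<Longrightarrow> \<bar>k\<bar> \<le> int B"
  proof -
    obtain B where "\<forall>m\<in>(\<lambda>k. nat \<bar>k\<bar>) ` K. m \<le> B"
      using fin finite_nat_set_iff_bounded_le by (metis finite_imageI)
    then have "\<bar>k\<bar> \<le> int B" if "k \<in> K" for k using that by fastforce
    then show ?thesis using that by blast
  qed
  have "\<forall>\<^sub>F N in sequentially. \<forall>k\<in>K. \<forall>i\<le>j. (qfac N * gbin N k) $ i = 1 $ i"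
    using fin fconv_upto[OF fconv_qfac_gbin] by (intro eventually_ball_finite) auto
  moreover have "\<forall>\<^sub>F N in sequentially. N \<ge> B" by (rule eventually_ge_at_top)
  ultimately show "\<forall>\<^sub>F N in sequentially. ?P N $ j = gsum (jexp t) (\<lambda>k. u powi k) $ j"
  proof eventually_elim
    case (elim N)
    have "?P N = (\<Sum>k\<in>{- int N..int N}. fps_X ^ jexp t k * (cc (u powi k) * (qfac N * gbin N k)))"
      by (subst finite_jacobi_triple_product[OF u t order.refl]) (simp add: sum_distrib_left mult_ac)
    then have "?P N $ j = (\<Sum>k\<in>{- int N..int N}. if j < jexp t k then 0 else u powi k * (qfac N * gbin N k) $ (j - jexp t k))"
      by (simp add: fps_sum_nth fps_X_power_mult_nth cong: if_cong)
    also have "\<dots> = (\<Sum>k\<in>K. if jexp t k = j then u powi k else 0)"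
    proof (rule sum.mono_neutral_cong_right)
      show "K \<subseteq> {- int N..int N}" using B elim(2) by fastforce
      show "\<And>k. k \<in> K \<Longrightarrow> (if j < jexp t k then 0 else u powi k * (qfac N * gbin N k) $ (j - jexp t k)) =
        (if jexp t k = j then u powi k else 0)"
        using elim(1) by (auto simp: K_def)
    qed (auto simp: K_def)
    also have "\<dots> = (\<Sum>k\<in>jexp t -` {j}. u powi k)"
      using fin by (intro sum.mono_neutral_cong_right) (auto simp: K_def)
    finally show ?case by (simp add: gsum_def)
  qed
qed

lemma prod_lessThan_shift: "(\<Prod>n<N. f (Suc n)) = (\<Prod>n\<in>{1..N}. f n)" for f :: "nat \<Rightarrow> 'a::comm_monoid_mult"
  by (induction N) (auto simp: mult_ac)

lemma theta3_product: "u \<noteq> 0 \<Longrightarrow> theta3 u = qprod_even 1 * qprod_odd (- u) * qprod_odd (- (1 / u))"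
proof -
  assume u: "u \<noteq> 0"
  have eq: "qfac N * (\<Prod>n<N. (1 + cc u * fps_X ^ (2 * n + 1 + 0)) * (1 + cc (1 / u) * fps_X ^ (2 * n + 1 - 0))) =
    qfac N * (\<Prod>n\<in>{1..N}. 1 - cc (- u) * fps_X ^ (2 * n - 1)) * (\<Prod>n\<in>{1..N}. 1 - cc (- (1 / u)) * fps_X ^ (2 * n - 1))" for N
    unfolding prod_lessThan_shift[symmetric] by (simp add: prod.distrib mult_ac flip: fps_const_neg)
  have "fconv (\<lambda>N. qfac N * (\<Prod>n\<in>{1..N}. 1 - cc (- u) * fps_X ^ (2 * n - 1)) * (\<Prod>n\<in>{1..N}. 1 - cc (- (1 / u)) * fps_X ^ (2 * n - 1)))
    (qprod_even 1 * qprod_odd (- u) * qprod_odd (- (1 / u)))"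
    by (intro fconv_mult fconv_qfac fconv_qprod_odd)
  moreover have "gsum (jexp (int 0)) (\<lambda>k. u powi k) = theta3 u"
    by (simp add: theta3_def jexp_def[abs_def])
  ultimately show ?thesis
    using jacobi_triple_product[OF u, of 0] fconv_unique unfolding eq by fastforce
qed

lemma theta2_product: "u \<noteq> 0 \<Longrightarrow> theta2 u = cc (1 + 1 / u) * (qprod_even 1 * qprod_even (- u) * qprod_even (- (1 / u)))"
proof -
  assume u: "u \<noteq> 0"
  let ?P = "\<lambda>N. qfac N * (\<Prod>n<N. (1 + cc u * fps_X ^ (2 * n + 1 + 1)) * (1 + cc (1 / u) * fps_X ^ (2 * n + 1 - 1)))"
  \<comment> \<open>For t = 1 the factors in 1/u run over n = 0, ..., N - 1. One more factor, which
    tends to 1, completes the range; the factor at n = 0 then comes out as the constant 1 +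
    1/u.\<close>
  have sh: "(\<Prod>n<N. 1 + cc (1 / u) * fps_X ^ (2 * n)) * (1 + cc (1 / u) * fps_X ^ (2 * N)) =
    cc (1 + 1 / u) * (\<Prod>n\<in>{1..N}. 1 - cc (- (1 / u)) * fps_X ^ (2 * n))" for N
  proof (induction N)
    case 0
    show ?case by (simp flip: fps_const_add fps_const_1_eq_1)
  next
    case (Suc N)
    have "(\<Prod>n<Suc N. 1 + cc (1 / u) * fps_X ^ (2 * n)) * (1 + cc (1 / u) * fps_X ^ (2 * Suc N)) =
      cc (1 + 1 / u) * (\<Prod>n\<in>{1..N}. 1 - cc (- (1 / u)) * fps_X ^ (2 * n)) * (1 + cc (1 / u) * fps_X ^ (2 * Suc N))"
      by (simp only: prod.lessThan_Suc Suc.IH)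
    then show ?case by (simp add: mult_ac flip: fps_const_neg)
  qed
  have eq: "?P N * (1 + cc (1 / u) * fps_X ^ (2 * N)) =
    cc (1 + 1 / u) * (qfac N * (\<Prod>n\<in>{1..N}. 1 - cc (- u) * fps_X ^ (2 * n)) * (\<Prod>n\<in>{1..N}. 1 - cc (- (1 / u)) * fps_X ^ (2 * n)))" for N
  proof -
    have "(\<Prod>n<N. 1 + cc u * fps_X ^ (2 * n + 1 + 1)) = (\<Prod>n\<in>{1..N}. 1 - cc (- u) * fps_X ^ (2 * n))"
      unfolding prod_lessThan_shift[symmetric] by (simp flip: fps_const_neg)
    then show ?thesis using sh[of N] by (simp add: prod.distrib mult_ac)
  qed
  have c1: "fconv (\<lambda>N. 1 + cc (1 / u) * fps_X ^ (2 * N)) 1"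
    unfolding fconv_def
  proof
    fix k
    show "\<forall>\<^sub>F N in sequentially. (1 + cc (1 / u) * fps_X ^ (2 * N)) $ k = 1 $ k"
      using eventually_gt_at_top[of k] by eventually_elim auto
  qed
  have "fconv (\<lambda>N. cc (1 + 1 / u) * (qfac N * (\<Prod>n\<in>{1..N}. 1 - cc (- u) * fps_X ^ (2 * n)) * (\<Prod>n\<in>{1..N}. 1 - cc (- (1 / u)) * fps_X ^ (2 * n))))
    (cc (1 + 1 / u) * (qprod_even 1 * qprod_even (- u) * qprod_even (- (1 / u))))"
    by (intro fconv_mult fconv_qfac fconv_qprod_even fconv_const)
  moreover have "gsum (jexp (int 1)) (\<lambda>k. u powi k) = theta2 u"
    by (simp add: theta2_def jexp_def[abs_def])
  moreover have "fconv (\<lambda>N. ?P N * (1 + cc (1 / u) * fps_X ^ (2 * N))) (gsum (jexp (int 1)) (\<lambda>k. u powi k) * 1)"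
    by (intro fconv_mult c1 jacobi_triple_product[OF u]) simp
  ultimately show ?thesis
    using fconv_unique unfolding eq by fastforce
qed

section \<open>Theta identities\<close>

text \<open>This simproc turns equations between power series in \<open>fps_X\<close> into equations between
  polynomials, where the rewrite rules for power series no longer apply.\<close>
declare [[simproc del: poly_fps_eq]]

lemma qprod_eq_qprod_odd_qprod_even: "qprod a = qprod_odd a * qprod_even a"
proof -
  have "qprod a = iprod (\<lambda>n. (1 - cc a * fps_X ^ (2 * n - 1)) * (1 - cc a * fps_X ^ (2 * n)))"
    unfolding qprod_def by (rule iprod_even_odd[OF near1_L near1_mult[OF near1_M near1_qprod_even]])
  then show ?thesis
    unfolding qprod_odd_def qprod_even_def iprod_mult[OF near1_M near1_qprod_even] .
qed

lemma qprod_mult_qprod_uminus: "qprod a * qprod (- a) = qprod_even (a ^ 2)"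
proof -
  have "(1 - cc a * fps_X ^ n) * (1 - cc (- a) * fps_X ^ n) = 1 - cc (a ^ 2) * fps_X ^ (2 * n)" for n
  proof -
    have "(1 - c * x) * (1 - (- c) * x) = 1 - (c * c) * (x * x)" for c x :: "complex fps"
      by (simp add: algebra_simps)
    then show ?thesis
      by (simp only: mult_2 power_add power2_eq_square fps_const_mult[symmetric] fps_const_neg[symmetric])
  qed
  then show ?thesis
    unfolding qprod_def qprod_even_def iprod_mult[OF near1_L near1_L] by (simp only:)
qed

lemma qprod_even_neq_0 [simp]: "qprod_even a \<noteq> 0"
  using qprod_even_nth_0[of a] by (metis fps_zero_nth zero_neq_one)

lemma qprod_neq_0 [simp]: "qprod a \<noteq> 0"
  using qprod_nth_0[of a] by (metis fps_zero_nth zero_neq_one)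

text \<open>Euler's theorem on partitions into distinct and into odd parts, from evaluating
  \<open>qprod 1 * qprod (- 1)\<close> and \<open>qprod 1\<close> through
  \<open>qprod_even 1\<close>.\<close>

lemma euler_odd_distinct: "qprod (- 1) * qprod_odd 1 = 1"
proof -
  have "(qprod (- 1) * qprod_odd 1) * qprod_even 1 = 1 * qprod_even 1"
    using qprod_mult_qprod_uminus[of 1] qprod_eq_qprod_odd_qprod_even[of 1] by (simp add: mult_ac)
  then show ?thesis by (subst (asm) mult_cancel_right) simp
qed

lemma qprod_even_eq_compose: "qprod_even a = qprod a oo fps_X ^ 2"
  by (simp add: qprod_def qprod_even_def iprod_compose[OF near1_L] fps_compose_sub_distrib
      fps_compose_mult_distrib fps_X_power_compose flip: power_mult)

lemma fps_const_prod: "fps_const (\<Prod>i\<in>S. f i) = (\<Prod>i\<in>S. fps_const (f i))"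
  for f :: "'i \<Rightarrow> 'a::comm_ring_1"
  by (induction S rule: infinite_finite_induct) (simp_all flip: fps_const_mult)

text \<open>As polynomials in X, both sides have degree at most p and agree at the p + 1 points
  consisting of 0 and the inverses of the z^k. The series y is substituted only at the end, which is
  allowed as it has no constant term.\<close>

lemma prod_linear_factors_of_unity:
  fixes z :: complex
  assumes z: "z ^ p = 1" "inj_on (\<lambda>k. z ^ k) {..<p}" and p: "p > 0" and y: "y $ 0 = 0"
  shows "(\<Prod>k<p. 1 - cc (z ^ k) * y) = 1 - y ^ p"
proof -
  define P Q where "P = (\<Prod>k<p. [:1, - (z ^ k):])" and "Q = 1 - Polynomial.monom (1::complex) p"
  have z0: "z \<noteq> 0" using z(1) p by (auto simp: power_0_left)
  have deg: "Polynomial.degree (P - Q) \<le> p"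
  proof (rule degree_diff_le)
    have "Polynomial.degree P \<le> (\<Sum>k<p. Polynomial.degree [:1, - (z ^ k):])"
      unfolding P_def using degree_prod_sum_le[of "{..<p}" "\<lambda>k. [:1, - (z ^ k):]"] by (simp add: o_def)
    also have "\<dots> \<le> (\<Sum>k<p. 1)" by (intro sum_mono) simp
    finally show "Polynomial.degree P \<le> p" by simp
    show "Polynomial.degree Q \<le> p" unfolding Q_def
      by (intro degree_diff_le) (auto simp: degree_monom_le)
  qed
  have "P - Q = 0"
  proof (rule ccontr)
    assume nz: "P - Q \<noteq> 0"
    define R where "R = insert 0 ((\<lambda>k. inverse (z ^ k)) ` {..<p})"
    have "R \<subseteq> {x. poly (P - Q) x = 0}"
    proof
      fix x assume "x \<in> R"
      then consider "x = 0" | k where "k < p" "x = inverse (z ^ k)" by (auto simp: R_def)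
      then show "x \<in> {x. poly (P - Q) x = 0}"
      proof cases
        case 1
        then show ?thesis using p by (simp add: P_def Q_def poly_prod poly_monom power_0_left)
      next
        case 2
        have "poly P x = 0" using 2 z0 unfolding P_def poly_prod by (intro prod_zero bexI[of _ k]) auto
        moreover have "x ^ p = 1" using 2 z(1) by (simp add: power_inverse power_mult[symmetric] mult.commute[of k])
          (simp add: power_mult)
        ultimately show ?thesis by (simp add: Q_def poly_monom)
      qed
    qed
    then have "card R \<le> card {x. poly (P - Q) x = 0}" by (intro card_mono poly_roots_finite nz)
    also have "\<dots> \<le> p" using card_poly_roots_bound[OF nz] deg by simp
    finally have "card R \<le> p" .
    moreover have "card R = Suc p"
    proof -
      have "inj_on (\<lambda>k. inverse (z ^ k)) {..<p}" using z(2) by (auto simp: inj_on_def)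
      moreover have "0 \<notin> (\<lambda>k. inverse (z ^ k)) ` {..<p}" using z0 by auto
      ultimately show ?thesis by (simp add: R_def card_image)
    qed
    ultimately show False by simp
  qed
  then have "P = Q" by simp
  then have "fps_of_poly P = fps_of_poly Q" by simp
  moreover have "fps_of_poly P = (\<Prod>k<p. 1 - cc (z ^ k) * fps_X)"
    unfolding P_def fps_of_poly_prod
    by (intro prod.cong) (auto simp: fps_of_poly_pCons mult.commute simp flip: fps_const_neg)
  moreover have "fps_of_poly Q = 1 - fps_X ^ p"
    by (simp add: Q_def fps_of_poly_diff fps_of_poly_monom')
  ultimately have "(\<Prod>k<p. 1 - cc (z ^ k) * fps_X) oo y = (1 - fps_X ^ p) oo y" by simp
  then show ?thesis
    using y by (simp add: fps_compose_prod_distrib fps_compose_sub_distrib fps_compose_mult_distrib fps_X_power_compose)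
qed

text \<open>The source of every passage from q to q^p: the product over the roots of unity acts
  factor by factor and turns each 1 - a X^e into 1 - a^p X^(p e).\<close>

lemma prod_unity_iprod:
  fixes z :: complex
  assumes z: "z ^ p = 1" "inj_on (\<lambda>k. z ^ k) {..<p}" and p: "p > 0"
    and e: "\<And>n. n \<ge> 1 \<Longrightarrow> e n \<ge> n"
  shows "(\<Prod>k<p. iprod (\<lambda>n. 1 - cc (z ^ k * a) * fps_X ^ e n)) =
    iprod (\<lambda>n. 1 - cc (a ^ p) * fps_X ^ e n) oo fps_X ^ p"
proof -
  have "(\<Prod>k<p. iprod (\<lambda>n. 1 - cc (z ^ k * a) * fps_X ^ e n)) = iprod (\<lambda>n. \<Prod>k<p. 1 - cc (z ^ k * a) * fps_X ^ e n)"
    by (rule iprod_prod) (rule near1_monom[OF e])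
  also have "\<dots> = iprod (\<lambda>n. (1 - cc (a ^ p) * fps_X ^ e n) oo fps_X ^ p)"
    unfolding iprod_def
  proof (intro arg_cong[of _ _ Abs_fps] ext arg_cong[of _ _ "\<lambda>f. f $ _"] prod.cong refl)
    fix k n assume "n \<in> {1..k::nat}"
    then have "e n > 0" using e[of n] by auto
    then have "(cc a * fps_X ^ e n) $ 0 = 0" by simp
    have "(\<Prod>k<p. 1 - cc (z ^ k * a) * fps_X ^ e n) = (\<Prod>k<p. 1 - cc (z ^ k) * (cc a * fps_X ^ e n))"
      by (simp only: fps_const_mult[symmetric] mult.assoc)
    also have "\<dots> = 1 - (cc a * fps_X ^ e n) ^ p"
      by (rule prod_linear_factors_of_unity[OF z p]) fact
    also have "\<dots> = (1 - cc (a ^ p) * fps_X ^ e n) oo fps_X ^ p"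
      using p by (simp add: fps_compose_sub_distrib fps_compose_mult_distrib fps_X_power_compose power_mult_distrib
          mult.commute flip: power_mult)
    finally show "(\<Prod>k<p. 1 - cc (z ^ k * a) * fps_X ^ e n) = (1 - cc (a ^ p) * fps_X ^ e n) oo fps_X ^ p" .
  qed
  also have "\<dots> = iprod (\<lambda>n. 1 - cc (a ^ p) * fps_X ^ e n) oo fps_X ^ p"
    by (rule iprod_compose[symmetric, OF near1_monom[OF e] p])
  finally show ?thesis .
qed

lemma prod_unity_qprod_even:
  assumes z: "z ^ p = 1" "inj_on (\<lambda>k. z ^ k) {..<p}" and p: "p > 0"
  shows "(\<Prod>k<p. qprod_even (z ^ k * a)) = qprod_even (a ^ p) oo fps_X ^ p"
  unfolding qprod_even_def by (rule prod_unity_iprod[OF z p]) simp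

lemma prod_unity_qprod_odd:
  assumes z: "z ^ p = 1" "inj_on (\<lambda>k. z ^ k) {..<p}" and p: "p > 0"
  shows "(\<Prod>k<p. qprod_odd (z ^ k * a)) = qprod_odd (a ^ p) oo fps_X ^ p"
  unfolding qprod_odd_def by (rule prod_unity_iprod[OF z p]) simp

lemma inj_on_inverse_power:
  fixes z :: complex
  assumes "inj_on (\<lambda>k. z ^ k) {..<p}"
  shows "inj_on (\<lambda>k. inverse z ^ k) {..<p}"
  using assms by (auto simp: inj_on_def power_inverse)

context
  fixes z :: complex and p :: nat
  assumes z: "z ^ p = 1" "inj_on (\<lambda>k. z ^ k) {..<p}" and p: "odd p"
begin

lemma p_pos: "p > 0" using p by (cases p) auto

lemma z_neq_0: "z \<noteq> 0" using z(1) p_pos by (auto simp: power_0_left)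

lemma zi: "inverse z ^ p = 1" using z(1) by (simp add: power_inverse)

text \<open>Both z and 1/z run through all p-th roots of unity, and the sign survives because (-1)^p
  = -1 for odd p; so the product reproduces the theta constant at X^p.\<close>

lemma prod_theta3_unity:
  "(\<Prod>k<p. theta3 (z ^ k)) * (qprod_even 1 oo fps_X ^ p) = (theta3 1 oo fps_X ^ p) * qprod_even 1 ^ p"
proof -
  have "(\<Prod>k<p. theta3 (z ^ k)) = (\<Prod>k<p. qprod_even 1 * qprod_odd (z ^ k * (- 1)) * qprod_odd (inverse z ^ k * (- 1)))"
    by (intro prod.cong) (auto simp: theta3_product z_neq_0 power_inverse field_simps)
  also have "\<dots> = qprod_even 1 ^ p * (qprod_odd (- 1) oo fps_X ^ p) * (qprod_odd (- 1) oo fps_X ^ p)"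
    unfolding prod.distrib prod_unity_qprod_odd[OF z p_pos] prod_unity_qprod_odd[OF zi inj_on_inverse_power[OF z(2)] p_pos]
    using p by simp
  finally show ?thesis
    using p_pos by (simp add: theta3_product fps_compose_mult_distrib mult_ac)
qed

lemma prod_theta2_unity:
  "(\<Prod>k<p. theta2 (z ^ k)) * (qprod_even 1 oo fps_X ^ p) * 2 = cc (\<Prod>k<p. 1 + 1 / z ^ k) * (theta2 1 oo fps_X ^ p) * qprod_even 1 ^ p"
proof -
  have "(\<Prod>k<p. theta2 (z ^ k)) = (\<Prod>k<p. cc (1 + 1 / z ^ k) * (qprod_even 1 * qprod_even (z ^ k * (- 1)) * qprod_even (inverse z ^ k * (- 1))))"
    by (intro prod.cong) (auto simp: theta2_product z_neq_0 power_inverse divide_inverse)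
  also have "\<dots> = cc (\<Prod>k<p. 1 + 1 / z ^ k) * (qprod_even 1 ^ p * (qprod_even (- 1) oo fps_X ^ p) * (qprod_even (- 1) oo fps_X ^ p))"
    unfolding prod.distrib prod_unity_qprod_even[OF z p_pos] prod_unity_qprod_even[OF zi inj_on_inverse_power[OF z(2)] p_pos]
    using p by (simp add: fps_const_prod)
  finally show ?thesis
    using p_pos by (simp add: theta2_product fps_compose_mult_distrib mult_ac numeral_fps_const)
qed

text \<open>The index 0 is left out because \<open>theta2 (- 1) = 0\<close>. The products then lack
  one factor \<open>qprod_even 1\<close> for z^k and one for its inverse, which accounts for the
  square on the left.\<close>

lemma prod_S1_unity:
  "(\<Prod>k\<in>{1..<p}. theta2 (- (z ^ k))) * qprod_even 1 ^ 2 =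
     cc (\<Prod>k\<in>{1..<p}. 1 - 1 / z ^ k) * (qprod_even 1 oo fps_X ^ p) ^ 2 * qprod_even 1 ^ (p - 1)"
proof -
  have "{..<p} = insert 0 {1..<p}" using p_pos by auto
  then have split: "(\<Prod>k<p. f k) = f 0 * (\<Prod>k\<in>{1..<p}. f k)" for f :: "nat \<Rightarrow> complex fps" by simp
  have 1: "(\<Prod>k\<in>{1..<p}. qprod_even (z ^ k)) * qprod_even 1 = qprod_even 1 oo fps_X ^ p"
    using prod_unity_qprod_even[OF z p_pos, of 1] split[of "\<lambda>k. qprod_even (z ^ k)"] by (simp add: mult.commute)
  have 2: "(\<Prod>k\<in>{1..<p}. qprod_even (inverse z ^ k)) * qprod_even 1 = qprod_even 1 oo fps_X ^ p"
    using prod_unity_qprod_even[OF zi inj_on_inverse_power[OF z(2)] p_pos, of 1] split[of "\<lambda>k. qprod_even (inverse z ^ k)"] by (simp add: mult.commute)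
  have "(\<Prod>k\<in>{1..<p}. theta2 (- (z ^ k))) = (\<Prod>k\<in>{1..<p}. cc (1 - 1 / z ^ k) * (qprod_even 1 * qprod_even (z ^ k) * qprod_even (inverse z ^ k)))"
    by (intro prod.cong) (auto simp: theta2_product z_neq_0 power_inverse divide_inverse)
  also have "\<dots> = cc (\<Prod>k\<in>{1..<p}. 1 - 1 / z ^ k) * (qprod_even 1 ^ (p - 1) * (\<Prod>k\<in>{1..<p}. qprod_even (z ^ k)) * (\<Prod>k\<in>{1..<p}. qprod_even (inverse z ^ k)))"
    by (simp add: prod.distrib fps_const_prod)
  finally have "(\<Prod>k\<in>{1..<p}. theta2 (- (z ^ k))) * qprod_even 1 ^ 2 = cc (\<Prod>k\<in>{1..<p}. 1 - 1 / z ^ k) * qprod_even 1 ^ (p - 1) *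
    (((\<Prod>k\<in>{1..<p}. qprod_even (z ^ k)) * qprod_even 1) * ((\<Prod>k\<in>{1..<p}. qprod_even (inverse z ^ k)) * qprod_even 1))"
    by (simp add: power2_eq_square mult_ac)
  then show ?thesis unfolding 1 2 by (simp add: power2_eq_square mult_ac)
qed

end

text \<open>Jacobi's theta_2 theta_3 theta_4 = 2 eta^3, stripped of the fractional power of
  X.\<close>

lemma S_constants_product: "theta2 1 * theta3 1 * theta3 (- 1) = 2 * qprod_even 1 ^ 3"
proof -
  have e: "qprod_even (- 1) * qprod_odd (- 1) * qprod_odd 1 = 1"
    using euler_odd_distinct qprod_eq_qprod_odd_qprod_even[of "- 1"] by (simp add: mult_ac)
  have "theta2 1 * theta3 1 * theta3 (- 1) = 2 * qprod_even 1 ^ 3 * (qprod_even (- 1) * qprod_odd (- 1) * qprod_odd 1) ^ 2"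
    by (simp add: theta2_product theta3_product numeral_fps_const power2_eq_square power3_eq_cube mult_ac)
  then show ?thesis by (simp add: e)
qed

text \<open>The duplication formula of theta_1 read off from the products: 1 - a^2 X^(2n) splits as
  (1 - a X^n)(1 + a X^n), and the factors are then sorted by the parity of n.\<close>

lemma theta2_duplication:
  assumes u: "u \<noteq> 0"
  shows "theta2 (- (u ^ 2)) * qprod_even 1 ^ 3 = theta2 (- u) * theta2 u * theta3 u * theta3 (- u)"
proof -
  have c: "cc (1 - 1 / u ^ 2) = cc (1 - 1 / u) * cc (1 + 1 / u)"
    using u by (simp add: field_simps power2_eq_square)
  have d: "qprod_even (a ^ 2) = qprod_even a * qprod_even (- a) * (qprod_odd a * qprod_odd (- a))" for a
    using qprod_mult_qprod_uminus[of a] qprod_eq_qprod_odd_qprod_even[of a] qprod_eq_qprod_odd_qprod_even[of "- a"] by (simp add: mult_ac)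
  have "theta2 (- (u ^ 2)) = cc (1 - 1 / u ^ 2) * (qprod_even 1 * qprod_even (u ^ 2) * qprod_even ((1 / u) ^ 2))"
    using u by (simp add: theta2_product power_one_over)
  also have "\<dots> * qprod_even 1 ^ 3 = cc (1 - 1 / u) * cc (1 + 1 / u) * (qprod_even 1 ^ 4 * 
     (qprod_even u * qprod_even (- u) * (qprod_odd u * qprod_odd (- u))) * (qprod_even (1 / u) * qprod_even (- (1 / u)) * (qprod_odd (1 / u) * qprod_odd (- (1 / u)))))"
    unfolding c d by (simp add: power_numeral_reduce mult_ac)
  also have "\<dots> = theta2 (- u) * theta2 u * theta3 u * theta3 (- u)"
    using u by (simp add: theta2_product theta3_product power_numeral_reduce mult_ac)
  finally show ?thesis .
qed

text \<open>By the two product formulas, every square involved is a bilinear expression in four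
  theta series A, B, a, b at X^2, so each relation is a polynomial identity. The first two yield
  cn^2 and dn^2, the third the denominator in the duplication of sn^2, and the fourth is Jacobi's
  quartic relation.\<close>

lemma S_quadric_relations:
  assumes u: "u \<noteq> 0"
  shows "theta2 1 ^ 2 * theta3 (- u) ^ 2 + cc u * theta2 (- u) ^ 2 * theta3 1 ^ 2 = theta3 (- 1) ^ 2 * cc u * theta2 u ^ 2"
    and "theta3 1 ^ 2 * theta3 (- u) ^ 2 + fps_X * cc u * theta2 1 ^ 2 * theta2 (- u) ^ 2 = theta3 (- 1) ^ 2 * theta3 u ^ 2"
    and "theta3 (- (u ^ 2)) * theta3 (- 1) ^ 3 = theta3 (- u) ^ 4 - fps_X * cc u ^ 2 * theta2 (- u) ^ 4"
    and "theta3 1 ^ 4 - fps_X * theta2 1 ^ 4 = theta3 (- 1) ^ 4"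
proof -
  define A B a b where "A = theta3 (u ^ 2) oo fps_X ^ 2" and "B = theta2 (u ^ 2) oo fps_X ^ 2"
    and "a = theta3 1 oo fps_X ^ 2" and "b = theta2 1 oo fps_X ^ 2"
  define U V where "U = cc u" and "V = cc (1 / u)"
  have UV: "U * V = 1" using u by (simp add: U_def V_def)
  note defs = A_def B_def a_def b_def U_def V_def
  have 1: "theta3 u ^ 2 = A * a + fps_X * U * B * b"
    using theta3_theta3[OF u u] u by (simp add: defs power2_eq_square)
  have 2: "theta3 (- u) ^ 2 = A * a - fps_X * U * B * b"
    using theta3_theta3[of "- u" "- u"] u by (simp add: defs power2_eq_square flip: fps_const_neg)
  have 3: "theta2 u ^ 2 = B * a + V * A * b"
    using theta2_theta2[OF u u] u by (simp add: defs power2_eq_square)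
  have 4: "theta2 (- u) ^ 2 = B * a - V * A * b"
    using theta2_theta2[of "- u" "- u"] u by (simp add: defs power2_eq_square flip: fps_const_neg)
  have 5: "theta3 (- (u ^ 2)) * theta3 (- 1) = A ^ 2 - fps_X * U ^ 2 * B ^ 2"
    using theta3_theta3[of "- (u ^ 2)" "- 1"] u by (simp add: defs power2_eq_square mult_ac flip: fps_const_neg fps_const_mult)
  have 6: "theta3 1 ^ 2 = a ^ 2 + fps_X * b ^ 2"
    using theta3_theta3[of 1 1] by (simp add: defs power2_eq_square)
  have 7: "theta3 (- 1) ^ 2 = a ^ 2 - fps_X * b ^ 2"
    using theta3_theta3[of "- 1" "- 1"] by (simp add: defs power2_eq_square flip: fps_const_neg)
  have 8: "theta2 1 ^ 2 = 2 * (a * b)"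
    using theta2_theta2[of 1 1] by (simp add: defs power2_eq_square mult.commute)
  have UVx: "U * (V * x) = x" for x using UV by (simp flip: mult.assoc)
  have 9: "U * theta2 u ^ 2 = U * B * a + A * b" "U * theta2 (- u) ^ 2 = U * B * a - A * b"
    unfolding 3 4 by (simp_all add: algebra_simps UVx)
  have "theta2 1 ^ 2 * theta3 (- u) ^ 2 + (U * theta2 (- u) ^ 2) * theta3 1 ^ 2 = theta3 (- 1) ^ 2 * (U * theta2 u ^ 2)"
    unfolding 2 9 6 7 8 by (simp add: algebra_simps power2_eq_square)
  then show "theta2 1 ^ 2 * theta3 (- u) ^ 2 + cc u * theta2 (- u) ^ 2 * theta3 1 ^ 2 = theta3 (- 1) ^ 2 * cc u * theta2 u ^ 2"
    by (simp add: U_def mult.assoc)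
  have "theta3 1 ^ 2 * theta3 (- u) ^ 2 + fps_X * theta2 1 ^ 2 * (U * theta2 (- u) ^ 2) = theta3 (- 1) ^ 2 * theta3 u ^ 2"
    unfolding 1 2 9 6 7 8 by (simp add: algebra_simps power2_eq_square)
  then show "theta3 1 ^ 2 * theta3 (- u) ^ 2 + fps_X * cc u * theta2 1 ^ 2 * theta2 (- u) ^ 2 = theta3 (- 1) ^ 2 * theta3 u ^ 2"
    by (simp add: U_def mult_ac)
  have "theta3 (- (u ^ 2)) * theta3 (- 1) ^ 3 = (theta3 (- (u ^ 2)) * theta3 (- 1)) * theta3 (- 1) ^ 2"
    by (simp add: power2_eq_square power3_eq_cube)
  also have "\<dots> = (theta3 (- u) ^ 2) ^ 2 - fps_X * (U * theta2 (- u) ^ 2) ^ 2"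
    unfolding 2 9 5 7 by (simp add: algebra_simps power2_eq_square)
  finally show "theta3 (- (u ^ 2)) * theta3 (- 1) ^ 3 = theta3 (- u) ^ 4 - fps_X * cc u ^ 2 * theta2 (- u) ^ 4"
    by (simp add: U_def power_mult_distrib mult.assoc)
  have "(theta3 1 ^ 2) ^ 2 - fps_X * (theta2 1 ^ 2) ^ 2 = (theta3 (- 1) ^ 2) ^ 2"
    unfolding 6 7 8 by (simp add: algebra_simps power2_eq_square)
  then show "theta3 1 ^ 4 - fps_X * theta2 1 ^ 4 = theta3 (- 1) ^ 4" by simp
qed

section \<open>Algebraic dependence over finitely generated rings\<close>

text \<open>\<open>ring_gen {}\<close> is the image of the integers. Keeping complex constants out
  of the base is what later allows the descent to rational coefficients.\<close>

inductive_set ring_gen :: "'a::comm_ring_1 set \<Rightarrow> 'a set" for T where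
  gen: "x \<in> T \<Longrightarrow> x \<in> ring_gen T"
| one: "1 \<in> ring_gen T"
| diff: "x \<in> ring_gen T \<Longrightarrow> y \<in> ring_gen T \<Longrightarrow> x - y \<in> ring_gen T"
| mult: "x \<in> ring_gen T \<Longrightarrow> y \<in> ring_gen T \<Longrightarrow> x * y \<in> ring_gen T"

lemma base_ring_ring_gen [simp]: "base_ring (ring_gen T)"
  unfolding base_ring_def by (auto intro: ring_gen.intros)

lemma ring_gen_subset: "base_ring A \<Longrightarrow> T \<subseteq> A \<Longrightarrow> ring_gen T \<subseteq> A"
proof
  fix x assume "base_ring A" "T \<subseteq> A" "x \<in> ring_gen T"
  from this(3) show "x \<in> A"
    by induction (use \<open>base_ring A\<close> \<open>T \<subseteq> A\<close> in \<open>auto simp: base_ring_def\<close>)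
qed

lemma ring_gen_mono: "T \<subseteq> T' \<Longrightarrow> ring_gen T \<subseteq> ring_gen T'"
  by (rule ring_gen_subset) (auto intro: ring_gen.gen)

definition ring_morph :: "('a::comm_ring_1 \<Rightarrow> 'b::comm_ring_1) \<Rightarrow> bool" where
  "ring_morph \<phi> \<longleftrightarrow> \<phi> 1 = 1 \<and> (\<forall>x y. \<phi> (x + y) = \<phi> x + \<phi> y) \<and> (\<forall>x y. \<phi> (x * y) = \<phi> x * \<phi> y)"

lemma ring_morphI:
  "\<phi> 1 = 1 \<Longrightarrow> (\<And>x y. \<phi> (x + y) = \<phi> x + \<phi> y) \<Longrightarrow> (\<And>x y. \<phi> (x * y) = \<phi> x * \<phi> y) \<Longrightarrow> ring_morph \<phi>"
  by (simp add: ring_morph_def)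

context
  fixes \<phi> :: "'a::comm_ring_1 \<Rightarrow> 'b::comm_ring_1"
  assumes \<phi>: "ring_morph \<phi>"
begin

lemma morph_1: "\<phi> 1 = 1" and morph_add: "\<phi> (x + y) = \<phi> x + \<phi> y" and morph_mult: "\<phi> (x * y) = \<phi> x * \<phi> y"
  using \<phi> by (simp_all add: ring_morph_def)

lemma morph_0: "\<phi> 0 = 0"
  using morph_add[of 0 0] by simp

lemma morph_uminus: "\<phi> (- x) = - \<phi> x"
  using morph_add[of x "- x"] morph_0 by (simp add: eq_neg_iff_add_eq_0 add.commute)

lemma morph_diff: "\<phi> (x - y) = \<phi> x - \<phi> y"
  using morph_add[of x "- y"] by (simp add: morph_uminus)

lemma morph_power: "\<phi> (x ^ n) = \<phi> x ^ n"
  by (induction n) (auto simp: morph_1 morph_mult)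

lemma morph_sum: "\<phi> (sum f S) = (\<Sum>i\<in>S. \<phi> (f i))"
  by (induction S rule: infinite_finite_induct) (auto simp: morph_0 morph_add)

lemma morph_prod: "\<phi> (prod f S) = (\<Prod>i\<in>S. \<phi> (f i))"
  by (induction S rule: infinite_finite_induct) (auto simp: morph_1 morph_mult)

lemma morph_poly: "\<phi> (poly P x) = poly (map_poly \<phi> P) (\<phi> x)"
  by (induction P) (auto simp: map_poly_pCons morph_0 morph_add morph_mult)

lemma morph_ring_gen: "\<phi> ` ring_gen T = ring_gen (\<phi> ` T)"
proof
  show "\<phi> ` ring_gen T \<subseteq> ring_gen (\<phi> ` T)"
  proof safe
    fix x assume "x \<in> ring_gen T"
    then show "\<phi> x \<in> ring_gen (\<phi> ` T)"
      by induction (auto simp: morph_1 morph_diff morph_mult intro: ring_gen.intros)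
  qed
  have "base_ring (\<phi> ` ring_gen T)"
    unfolding base_ring_def
  proof (intro conjI ballI)
    show "1 \<in> \<phi> ` ring_gen T" using morph_1 ring_gen.one by (metis imageI)
  next
    fix x y assume "x \<in> \<phi> ` ring_gen T" "y \<in> \<phi> ` ring_gen T"
    then show "x - y \<in> \<phi> ` ring_gen T" "x * y \<in> \<phi> ` ring_gen T"
      by (auto simp: morph_diff[symmetric] morph_mult[symmetric] intro: ring_gen.intros)
  qed
  then show "ring_gen (\<phi> ` T) \<subseteq> \<phi> ` ring_gen T"
    by (rule ring_gen_subset) (auto intro: ring_gen.gen)
qed

text \<open>If all coefficients lie in the image, the polynomial itself lifts, so relations move
  both ways: into fraction fields to use field theory, and back from complex series to rational
  ones.\<close>

lemma acl_morph_iff: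
  assumes "inj \<phi>"
  shows "\<phi> x \<in> acl (\<phi> ` A) \<longleftrightarrow> x \<in> acl A"
proof
  assume "x \<in> acl A"
  then obtain P where P: "P \<noteq> 0" "\<forall>i. Polynomial.coeff P i \<in> A" "poly P x = 0"
    unfolding acl_def by blast
  have "\<phi> (Polynomial.lead_coeff P) \<noteq> \<phi> 0" using P(1) assms by (simp add: inj_eq)
  then have "map_poly \<phi> P \<noteq> 0"
    using morph_0 by (metis coeff_0 coeff_map_poly)
  then show "\<phi> x \<in> acl (\<phi> ` A)"
    using P morph_poly[of P x] morph_0 by (auto simp: acl_def coeff_map_poly intro!: exI[of _ "map_poly \<phi> P"])
next
  assume "\<phi> x \<in> acl (\<phi> ` A)"
  then obtain P where P: "P \<noteq> 0" "\<forall>i. Polynomial.coeff P i \<in> \<phi> ` A" "poly P (\<phi> x) = 0"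
    unfolding acl_def by blast
  define Q where "Q = map_poly (inv_into UNIV \<phi>) P"
  have i0: "inv_into UNIV \<phi> 0 = 0" using inv_f_f[OF assms, of 0] by (simp add: morph_0)
  have c: "Polynomial.coeff Q i = inv_into UNIV \<phi> (Polynomial.coeff P i)" for i
    unfolding Q_def using i0 by (simp add: coeff_map_poly)
  have cA: "Polynomial.coeff Q i \<in> A" "\<phi> (Polynomial.coeff Q i) = Polynomial.coeff P i" for i
    using P(2) c assms by (metis imageE inv_f_f)+
  have "map_poly \<phi> Q = P"
    by (rule poly_eqI) (simp add: coeff_map_poly morph_0 cA)
  then have "\<phi> (poly Q x) = \<phi> 0" "Q \<noteq> 0" using P morph_poly[of Q x] by (auto simp: morph_0)
  then have "poly Q x = 0" using assms by (simp add: inj_eq)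
  then show "x \<in> acl A" using \<open>Q \<noteq> 0\<close> cA unfolding acl_def by blast
qed

lemma acl_ring_gen_morph_iff:
  assumes "inj \<phi>"
  shows "\<phi> x \<in> acl (ring_gen (\<phi> ` T)) \<longleftrightarrow> x \<in> acl (ring_gen T)"
  using acl_morph_iff[OF assms] morph_ring_gen by metis

end

lemma ring_morph_to_fract: "ring_morph to_fract"
  by (simp add: ring_morph_def)

lemma inj_to_fract: "inj to_fract"
  by (simp add: inj_def)

lemma to_fract_power: "to_fract (x ^ n) = to_fract x ^ n"
  by (rule morph_power[OF ring_morph_to_fract])

lemma acl_ring_gen_fract: "to_fract x \<in> acl (ring_gen (to_fract ` T)) \<longleftrightarrow> x \<in> acl (ring_gen T)"
  by (rule acl_ring_gen_morph_iff[OF ring_morph_to_fract inj_to_fract])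

lemma base_ring_acl: "base_ring (A :: 'a::field set) \<Longrightarrow> base_ring (acl A)"
  unfolding base_ring_def[of "acl A"] by (auto intro: acl_1 acl_diff acl_mult)

lemma acl_trans_field:
  fixes T :: "'a::field set"
  assumes "x \<in> acl (ring_gen T)" "T \<subseteq> acl (ring_gen T')"
  shows "x \<in> acl (ring_gen T')"
proof (rule acl_acl)
  have "ring_gen T \<subseteq> acl (ring_gen T')"
    using assms(2) by (intro ring_gen_subset base_ring_acl) simp
  then show "x \<in> acl (acl (ring_gen T'))" using assms(1) acl_mono by blast
qed simp

lemma acl_trans:
  fixes T :: "'a::idom set"
  assumes "x \<in> acl (ring_gen T)" "T \<subseteq> acl (ring_gen T')"
  shows "x \<in> acl (ring_gen T')"
proof -
  have "to_fract ` T \<subseteq> acl (ring_gen (to_fract ` T'))"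
    using assms(2) acl_ring_gen_fract by blast
  then show ?thesis using acl_trans_field acl_ring_gen_fract assms(1) by metis
qed

lemma base_ring_sum: "base_ring A \<Longrightarrow> (\<And>i. i \<in> S \<Longrightarrow> f i \<in> A) \<Longrightarrow> sum f S \<in> A"
  by (induction S rule: infinite_finite_induct) (auto intro: base_ring_0 base_ring_add)

lemma base_ring_power: "base_ring A \<Longrightarrow> x \<in> A \<Longrightarrow> x ^ n \<in> A"
  by (induction n) (auto intro: base_ring_mult simp: base_ring_def)

lemma ring_gen_single:
  assumes "x \<in> ring_gen {t}"
  shows "\<exists>C. (\<forall>i. Polynomial.coeff C i \<in> ring_gen {}) \<and> x = poly C t"
  using assms
proof induction
  case (gen x)
  then show ?case
    by (intro exI[of _ "[:0, 1:]"]) (auto simp: coeff_pCons base_ring_0 ring_gen.one split: nat.splits)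
next
  case one
  then show ?case
    by (intro exI[of _ 1]) (auto simp: base_ring_0 ring_gen.one)
next
  case (diff x y)
  then obtain C D where "\<forall>i. Polynomial.coeff C i \<in> ring_gen {}" "x = poly C t" "\<forall>i. Polynomial.coeff D i \<in> ring_gen {}" "y = poly D t"
    by blast
  then show ?case by (intro exI[of _ "C - D"]) (auto intro: ring_gen.diff)
next
  case (mult x y)
  then obtain C D where "\<forall>i. Polynomial.coeff C i \<in> ring_gen {}" "x = poly C t" "\<forall>i. Polynomial.coeff D i \<in> ring_gen {}" "y = poly D t"
    by blast
  then show ?case
    by (intro exI[of _ "C * D"]) (auto simp: coeff_mult intro!: base_ring_sum ring_gen.mult)
qed

text \<open>The relation for x is regrouped by powers of t, with coefficients D_j(x). Since the
  leading coefficient of P is not 0, some D_j is a nonzero polynomial over the prime ring, and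
  D_j(x) cannot vanish because x is transcendental.\<close>

lemma acl_exchange:
  fixes x t :: "'a::idom"
  assumes "x \<in> acl (ring_gen {t})" "x \<notin> acl (ring_gen {})"
  shows "t \<in> acl (ring_gen {x})"
proof -
  obtain P where P: "P \<noteq> 0" "\<forall>i. Polynomial.coeff P i \<in> ring_gen {t}" "poly P x = 0"
    using assms(1) unfolding acl_def by blast
  have "\<forall>i. \<exists>C. (\<forall>j. Polynomial.coeff C j \<in> ring_gen {}) \<and> Polynomial.coeff P i = poly C t"
    using P(2) ring_gen_single by blast
  then obtain C where C: "\<And>i j. Polynomial.coeff (C i) j \<in> ring_gen {}" "\<And>i. Polynomial.coeff P i = poly (C i) t"
    by metis
  define n where "n = Polynomial.degree P"
  define m where "m = (\<Sum>i\<le>n. Polynomial.degree (C i))"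
  have dm: "Polynomial.degree (C i) \<le> m" if "i \<le> n" for i
    unfolding m_def using that by (intro member_le_sum) auto
  define D where "D j = (\<Sum>i\<le>n. Polynomial.monom (Polynomial.coeff (C i) j) i)" for j
  define R where "R = (\<Sum>j\<le>m. Polynomial.monom (poly (D j) x) j)"
  have cD: "Polynomial.coeff (D j) i = (if i \<le> n then Polynomial.coeff (C i) j else 0)" for i j
    by (simp add: D_def coeff_sum)
  have cR: "Polynomial.coeff R j = (if j \<le> m then poly (D j) x else 0)" for j
    by (simp add: R_def coeff_sum)
  have "poly R t = (\<Sum>j\<le>m. \<Sum>i\<le>n. Polynomial.coeff (C i) j * x ^ i * t ^ j)"
    by (simp add: R_def D_def poly_sum poly_monom sum_distrib_right)
  also have "\<dots> = (\<Sum>i\<le>n. \<Sum>j\<le>m. Polynomial.coeff (C i) j * x ^ i * t ^ j)"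
    by (rule sum.swap)
  also have "\<dots> = (\<Sum>i\<le>n. poly (C i) t * x ^ i)"
  proof (rule sum.cong[OF refl])
    fix i assume "i \<in> {..n}"
    then have "poly (C i) t = (\<Sum>j\<le>m. Polynomial.coeff (C i) j * t ^ j)"
      unfolding poly_altdef using dm by (intro sum.mono_neutral_left) (auto simp: coeff_eq_0)
    then show "(\<Sum>j\<le>m. Polynomial.coeff (C i) j * x ^ i * t ^ j) = poly (C i) t * x ^ i"
      by (simp add: sum_distrib_left mult_ac)
  qed
  also have "\<dots> = poly P x" by (simp add: poly_altdef n_def C(2))
  finally have root: "poly R t = 0" using P(3) by simp
  have "poly (C n) t \<noteq> 0" using P(1) C(2)[of n] leading_coeff_neq_0[of P] by (metis n_def)
  then have "C n \<noteq> 0" by auto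
  then obtain j where j: "Polynomial.coeff (C n) j \<noteq> 0" "j \<le> m"
    using dm[of n] by (metis leading_coeff_neq_0 order_refl)
  then have "D j \<noteq> 0" using cD[of j n] by auto
  moreover have "\<forall>i. Polynomial.coeff (D j) i \<in> ring_gen {}"
    using C(1) by (auto simp: cD base_ring_0)
  ultimately have "poly (D j) x \<noteq> 0" using assms(2) unfolding acl_def by blast
  then have "R \<noteq> 0" using cR[of j] j(2) by auto
  moreover have "Polynomial.coeff R j \<in> ring_gen {x}" for j
  proof -
    have "Polynomial.coeff (D j) i \<in> ring_gen {x}" for i
      using C(1) ring_gen_mono[of "{}" "{x}"] by (auto simp: cD base_ring_0)
    then have "poly (D j) x \<in> ring_gen {x}"
      unfolding poly_altdef by (auto intro!: base_ring_sum ring_gen.mult base_ring_power intro: ring_gen.gen)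
    then show ?thesis by (simp add: cR base_ring_0)
  qed
  ultimately show ?thesis using root unfolding acl_def by blast
qed

section \<open>The duplication map\<close>

abbreviation fr :: "complex fps \<Rightarrow> complex fps fract" where "fr \<equiv> to_fract"

text \<open>The modular function lambda = theta_2^4 / theta_3^4; the factor X is the fourth power of
  the X^(1/4) omitted from \<open>theta2\<close>.\<close>

definition lam :: "complex fps" where
  "lam = fps_X * theta2 1 ^ 4 * inverse (theta3 1) ^ 4"

text \<open>Formed in the fraction field because negative powers of X occur among the normalised
  theta functions and because closure under division holds there.\<close>

definition lam_closure :: "complex fps fract set" where
  "lam_closure = acl (ring_gen {fr lam})"

lemma lam_closure_base: "base_ring (ring_gen {fr lam})" by simp

lemmas lam_closure_add = acl_add[OF lam_closure_base, folded lam_closure_def]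
lemmas lam_closure_mult = acl_mult[OF lam_closure_base, folded lam_closure_def]
lemmas lam_closure_diff = acl_diff[OF lam_closure_base, folded lam_closure_def]
lemmas lam_closure_uminus = acl_uminus[OF lam_closure_base, folded lam_closure_def]
lemmas lam_closure_divide = acl_divide[OF lam_closure_base, folded lam_closure_def]
lemmas lam_closure_power = acl_power[OF lam_closure_base, folded lam_closure_def]
lemmas lam_closure_1 = acl_1[OF lam_closure_base, folded lam_closure_def]
lemmas lam_closure_0 = acl_0[OF lam_closure_base, folded lam_closure_def]
lemmas lam_closure_numeral = acl_numeral[OF lam_closure_base, folded lam_closure_def]
lemmas lam_closure_prod = acl_prod[OF lam_closure_base, folded lam_closure_def]
lemmas lam_closure_nth_root = acl_nth_root[OF lam_closure_base, folded lam_closure_def]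
lemmas lam_closure_root_of = acl_root_of[OF lam_closure_base, folded lam_closure_def]

lemma lam_closure_lam: "fr lam \<in> lam_closure"
  unfolding lam_closure_def by (rule base_subset_acl[OF lam_closure_base]) (rule ring_gen.gen, simp)

lemmas lam_closure_intros = lam_closure_add lam_closure_mult lam_closure_diff lam_closure_uminus lam_closure_divide lam_closure_power lam_closure_1 lam_closure_0 lam_closure_numeral lam_closure_lam

lemma root_of_unity_in_lam_closure: "u ^ n = 1 \<Longrightarrow> n > 0 \<Longrightarrow> fr (cc u) \<in> lam_closure"
proof (rule lam_closure_nth_root)
  assume "u ^ n = 1"
  then have "fr (cc u) ^ n = fr (cc 1)" by (metis fps_const_power to_fract_power)
  then show "fr (cc u) ^ n \<in> lam_closure" using lam_closure_1 by simp
qed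

lemma theta3_nth_0 [simp]: "u \<noteq> 0 \<Longrightarrow> theta3 u $ 0 = 1"
  by (simp add: theta3_product)

lemma theta2_nth_0 [simp]: "u \<noteq> 0 \<Longrightarrow> theta2 u $ 0 = 1 + 1 / u"
  by (simp add: theta2_product)

lemma theta3_neq_0 [simp]: "u \<noteq> 0 \<Longrightarrow> theta3 u \<noteq> 0"
  using theta3_nth_0[of u] by (metis fps_zero_nth zero_neq_one)

lemma theta2_neq_0: "u \<noteq> 0 \<Longrightarrow> u \<noteq> - 1 \<Longrightarrow> theta2 u \<noteq> 0"
  by (simp add: theta2_product add_eq_0_iff) (metis divide_eq_minus_1_iff minus_minus nonzero_eq_divide_eq)

lemma theta2_1_neq_0 [simp]: "theta2 1 \<noteq> 0"
  by (rule theta2_neq_0) auto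

abbreviation "s1 u \<equiv> fr (theta2 (- u))"
abbreviation "s2 u \<equiv> fr (theta2 u)"
abbreviation "s3 u \<equiv> fr (theta3 u)"
abbreviation "s4 u \<equiv> fr (theta3 (- u))"
abbreviation "xx \<equiv> fr fps_X"
abbreviation "cu u \<equiv> fr (cc u)"

lemma lam_eq: "fr lam = xx * s2 1 ^ 4 / s3 1 ^ 4"
proof -
  have "inverse (theta3 1) * theta3 1 = 1" by (rule inverse_mult_eq_1) simp
  then have "lam * theta3 1 ^ 4 = fps_X * theta2 1 ^ 4"
    by (simp add: lam_def mult.assoc flip: power_mult_distrib)
  then have "fr lam * s3 1 ^ 4 = xx * s2 1 ^ 4" by (metis to_fract_mult to_fract_power)
  then show ?thesis by (simp add: field_simps)
qed

text \<open>Jacobi's \<open>sn\<^sup>2\<close> as a quotient of theta functions; \<open>lam\<close> is the modulus \<open>k\<^sup>2\<close>.\<close>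
definition sn2 :: "complex \<Rightarrow> complex fps fract" where
  "sn2 u = - cu u * s1 u ^ 2 * s3 1 ^ 2 / (s2 1 ^ 2 * s4 u ^ 2)"

lemma cu_neq_0 [simp]: "cu u = 0 \<longleftrightarrow> u = 0"
  by simp

lemma one_minus_lam: "1 - fr lam = s4 1 ^ 4 / s3 1 ^ 4"
proof -
  have "s3 1 ^ 4 - xx * s2 1 ^ 4 = s4 1 ^ 4"
    using arg_cong[OF S_quadric_relations(4)[of 1], of fr] by (simp add: to_fract_power)
  then have "s4 1 ^ 4 / s3 1 ^ 4 = (s3 1 ^ 4 - xx * s2 1 ^ 4) / s3 1 ^ 4" by simp
  then show ?thesis by (simp add: lam_eq diff_divide_distrib)
qed

lemma lam_neq: "fr lam \<noteq> 0" "1 - fr lam \<noteq> 0"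
  unfolding one_minus_lam unfolding lam_eq by simp_all

lemma cu_power: "cu (u ^ n) = cu u ^ n"
  by (metis fps_const_power to_fract_power)

text \<open>The function cn^2 as a theta quotient.\<close>

lemma one_minus_sn2:
  assumes "u \<noteq> 0"
  shows "1 - sn2 u = s4 1 ^ 2 * cu u * s2 u ^ 2 / (s2 1 ^ 2 * s4 u ^ 2)"
proof -
  have "s2 1 ^ 2 * s4 u ^ 2 + cu u * s1 u ^ 2 * s3 1 ^ 2 = s4 1 ^ 2 * cu u * s2 u ^ 2"
    using arg_cong[OF S_quadric_relations(1)[OF assms], of fr] by (simp add: to_fract_power)
  then have "s4 1 ^ 2 * cu u * s2 u ^ 2 / (s2 1 ^ 2 * s4 u ^ 2) = (s2 1 ^ 2 * s4 u ^ 2 + cu u * s1 u ^ 2 * s3 1 ^ 2) / (s2 1 ^ 2 * s4 u ^ 2)"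
    by simp
  also have "\<dots> = 1 - sn2 u"
    using assms by (simp add: sn2_def add_divide_distrib)
  finally show ?thesis by simp
qed

lemma lam_sn2: "u \<noteq> 0 \<Longrightarrow> fr lam * sn2 u = - (xx * cu u * s2 1 ^ 2 * s1 u ^ 2) / (s3 1 ^ 2 * s4 u ^ 2)"
  unfolding lam_eq sn2_def by (simp add: field_simps power2_eq_square power4_eq_xxxx)

text \<open>The function dn^2 as a theta quotient.\<close>

lemma one_minus_lam_sn2:
  assumes "u \<noteq> 0"
  shows "1 - fr lam * sn2 u = s4 1 ^ 2 * s3 u ^ 2 / (s3 1 ^ 2 * s4 u ^ 2)"
proof -
  have "s3 1 ^ 2 * s4 u ^ 2 + xx * cu u * s2 1 ^ 2 * s1 u ^ 2 = s4 1 ^ 2 * s3 u ^ 2"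
    using arg_cong[OF S_quadric_relations(2)[OF assms], of fr] by (simp add: to_fract_power)
  then have "s4 1 ^ 2 * s3 u ^ 2 / (s3 1 ^ 2 * s4 u ^ 2) = (s3 1 ^ 2 * s4 u ^ 2 + xx * cu u * s2 1 ^ 2 * s1 u ^ 2) / (s3 1 ^ 2 * s4 u ^ 2)"
    by simp
  also have "\<dots> = 1 - fr lam * sn2 u"
    using assms by (simp add: lam_sn2 add_divide_distrib)
  finally show ?thesis by simp
qed

lemma one_minus_lam_sn2_sq:
  assumes "u \<noteq> 0"
  shows "1 - fr lam * sn2 u ^ 2 = s4 (u ^ 2) * s4 1 ^ 3 / s4 u ^ 4"
proof -
  have "s4 (u ^ 2) * s4 1 ^ 3 = s4 u ^ 4 - xx * cu u ^ 2 * s1 u ^ 4"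
    using arg_cong[OF S_quadric_relations(3)[OF assms], of fr] by (simp add: to_fract_power cu_power)
  moreover have "fr lam * sn2 u ^ 2 = xx * cu u ^ 2 * s1 u ^ 4 / s4 u ^ 4"
    using assms unfolding lam_eq sn2_def by (simp add: field_simps power2_eq_square power4_eq_xxxx)
  ultimately show ?thesis using assms by (simp add: diff_divide_distrib)
qed

lemma s1_duplication: "u \<noteq> 0 \<Longrightarrow> s1 (u ^ 2) * fr (qprod_even 1) ^ 3 = s1 u * s2 u * s3 u * s4 u"
  using arg_cong[OF theta2_duplication[of u], of fr] by (simp add: to_fract_power)

lemma s_constants: "s2 1 * s3 1 * s4 1 = 2 * fr (qprod_even 1) ^ 3"
proof -
  have "fr 2 = 2" by (metis one_add_one to_fract_1 to_fract_add)
  then show ?thesis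
    using arg_cong[OF S_constants_product, of fr] by (simp add: to_fract_power)
qed

lemma fract_numeral_neq_0 [simp]: "(numeral n :: complex fps fract) \<noteq> 0"
proof -
  have *: "fr (of_nat m) = of_nat m" for m by (induction m) auto
  have "fr (of_nat (numeral n)) \<noteq> 0" by (simp del: of_nat_numeral)
  then show ?thesis unfolding * by simp
qed

text \<open>The square of sn(2z) = 2 sn cn dn / (1 - k^2 sn^4). All four expressions are replaced by
  theta quotients, and the duplication of theta_1 settles the rest.\<close>

lemma sn2_duplication:
  assumes "u \<noteq> 0"
  shows "sn2 (u ^ 2) * (1 - fr lam * sn2 u ^ 2) ^ 2 = 4 * sn2 u * (1 - sn2 u) * (1 - fr lam * sn2 u)"
proof -
  have E: "2 * fr (qprod_even 1) ^ 3 \<noteq> 0" by simp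
  have "s1 (u ^ 2) * (2 * fr (qprod_even 1) ^ 3) = 2 * (s1 u * s2 u * s3 u * s4 u)"
    using s1_duplication[OF assms] by simp
  then have d: "s1 (u ^ 2) = 2 * (s1 u * s2 u * s3 u * s4 u) / (s2 1 * s3 1 * s4 1)"
    using E by (simp add: s_constants eq_divide_eq)
  have c: "cu (u ^ 2) = cu u ^ 2" by (rule cu_power)
  have nz: "s2 1 \<noteq> 0" "s3 1 \<noteq> 0" "s4 1 \<noteq> 0" "s4 u \<noteq> 0" "s4 (u ^ 2) \<noteq> 0" "cu u \<noteq> 0"
    using assms by auto
  have gen: "- (U ^ 2) * (2 * (a1 * a2 * a3 * a4) / (b2 * b3 * b4)) ^ 2 * b3 ^ 2 / (b2 ^ 2 * d4 ^ 2) * (d4 * b4 ^ 3 / a4 ^ 4) ^ 2 =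
    4 * (- U * a1 ^ 2 * b3 ^ 2 / (b2 ^ 2 * a4 ^ 2)) * (b4 ^ 2 * U * a2 ^ 2 / (b2 ^ 2 * a4 ^ 2)) * (b4 ^ 2 * a3 ^ 2 / (b3 ^ 2 * a4 ^ 2))"
    if "b2 \<noteq> 0" "b3 \<noteq> 0" "b4 \<noteq> 0" "a4 \<noteq> 0" "d4 \<noteq> 0" for U a1 a2 a3 a4 b2 b3 b4 d4 :: "complex fps fract"
    using that by (simp add: field_simps power2_eq_square power3_eq_cube power4_eq_xxxx)
  show ?thesis
    unfolding one_minus_sn2[OF assms] one_minus_lam_sn2[OF assms] one_minus_lam_sn2_sq[OF assms]
    unfolding sn2_def c d by (rule gen[OF nz(1-5)])
qed

text \<open>Numerator and denominator of the \<open>m\<close>-fold iterate of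
  \<open>w \<mapsto> 4 w (1 - w) (1 - lam w) / (1 - lam w\<^sup>2)\<^sup>2\<close>, the duplication map of \<open>sn\<^sup>2\<close>.\<close>
fun dup_num dup_den :: "nat \<Rightarrow> complex fps fract poly" where
  "dup_num 0 = [:0, 1:]"
| "dup_den 0 = 1"
| "dup_num (Suc m) = 4 * dup_num m * dup_den m * (dup_den m - dup_num m) * (dup_den m - [:fr lam:] * dup_num m)"
| "dup_den (Suc m) = (dup_den m ^ 2 - [:fr lam:] * dup_num m ^ 2) ^ 2"

text \<open>No denominator vanishes along the orbit, since 1 - lam sn^4 is a quotient of values of
  theta_4, which have constant term 1.\<close>

lemma dup_iterate:
  assumes "u \<noteq> 0"
  shows "poly (dup_den m) (sn2 u) \<noteq> 0 \<and>
    sn2 (u ^ (2 ^ m)) * poly (dup_den m) (sn2 u) = poly (dup_num m) (sn2 u)"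
proof (induction m)
  case 0
  then show ?case by simp
next
  case (Suc m)
  let ?G = "poly (dup_den m) (sn2 u)" and ?F = "poly (dup_num m) (sn2 u)"
  let ?v = "u ^ (2 ^ m)"
  have v: "?v \<noteq> 0" using assms by simp
  have F: "?F = sn2 ?v * ?G" and G: "?G \<noteq> 0" using Suc by auto
  have G': "poly (dup_den (Suc m)) (sn2 u) = ?G ^ 4 * (1 - fr lam * sn2 ?v ^ 2) ^ 2"
    by (simp add: F algebra_simps power2_eq_square power4_eq_xxxx)
  have F': "poly (dup_num (Suc m)) (sn2 u) = ?G ^ 4 * (4 * sn2 ?v * (1 - sn2 ?v) * (1 - fr lam * sn2 ?v))"
    by (simp add: F algebra_simps power2_eq_square power4_eq_xxxx)
  have "1 - fr lam * sn2 ?v ^ 2 \<noteq> 0"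
    unfolding one_minus_lam_sn2_sq[OF v] using assms by simp
  then have "poly (dup_den (Suc m)) (sn2 u) \<noteq> 0" unfolding G' using G by simp
  moreover have "u ^ 2 ^ Suc m = ?v ^ 2" by (simp add: power_mult[symmetric] mult.commute)
  ultimately show ?case
    unfolding G' F' using sn2_duplication[OF v] by (simp add: mult_ac)
qed

lemma coeffs_in_K_mult: "\<forall>i. Polynomial.coeff P i \<in> lam_closure \<Longrightarrow> \<forall>i. Polynomial.coeff Q i \<in> lam_closure \<Longrightarrow> \<forall>i. Polynomial.coeff (P * Q) i \<in> lam_closure"
  unfolding coeff_mult by (intro allI base_ring_sum) (auto simp: lam_closure_def intro!: base_ring_acl acl_mult)

lemma coeffs_in_K_diff: "\<forall>i. Polynomial.coeff P i \<in> lam_closure \<Longrightarrow> \<forall>i. Polynomial.coeff Q i \<in> lam_closure \<Longrightarrow> \<forall>i. Polynomial.coeff (P - Q) i \<in> lam_closure"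
  by (auto intro: lam_closure_diff)

lemma coeffs_in_K_const: "a \<in> lam_closure \<Longrightarrow> \<forall>i. Polynomial.coeff [:a:] i \<in> lam_closure"
  by (auto simp: coeff_pCons lam_closure_0 split: nat.splits)

lemma coeffs_in_K_X: "\<forall>i. Polynomial.coeff [:0, 1:] i \<in> lam_closure"
  by (auto simp: coeff_pCons lam_closure_0 lam_closure_1 split: nat.splits)

lemma dup_coeffs: "(\<forall>i. Polynomial.coeff (dup_num m) i \<in> lam_closure) \<and> (\<forall>i. Polynomial.coeff (dup_den m) i \<in> lam_closure)"
proof (induction m)
  case 0
  show ?case using coeffs_in_K_X coeffs_in_K_const[OF lam_closure_1] by (simp add: one_pCons)
next
  case (Suc m)
  have "(4 :: complex fps fract poly) = [:4:]" by (simp add: numeral_poly)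
  then have "\<forall>i. Polynomial.coeff (4 :: complex fps fract poly) i \<in> lam_closure"
    using coeffs_in_K_const[OF lam_closure_numeral] by metis
  then show ?case using Suc coeffs_in_K_const[OF lam_closure_lam]
    unfolding dup_num.simps dup_den.simps power2_eq_square
    by (intro conjI coeffs_in_K_mult coeffs_in_K_diff) blast+
qed

text \<open>Near w = 0 the duplication map is 4 w + O(w^2), so its m-th iterate is 4^m w +
  O(w^2).\<close>

lemma dup_low_coeffs:
  "Polynomial.coeff (dup_num m) 0 = 0 \<and> Polynomial.coeff (dup_num m) 1 = 4 ^ m \<and> Polynomial.coeff (dup_den m) 0 = 1"
proof (induction m)
  case (Suc m)
  have c1: "Polynomial.coeff (P * Q) 1 = Polynomial.coeff P 1 * Polynomial.coeff Q 0"
    if "Polynomial.coeff P 0 = 0" for P Q :: "complex fps fract poly"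
    using that by (simp add: coeff_mult)
  have n4: "Polynomial.coeff (4 :: complex fps fract poly) 0 = 4" "Polynomial.coeff (4 :: complex fps fract poly) 1 = 0"
    by (simp_all add: numeral_poly)
  have "dup_num (Suc m) = dup_num m * (4 * dup_den m * (dup_den m - dup_num m) * (dup_den m - [:fr lam:] * dup_num m))"
    by (simp add: mult_ac)
  then have "Polynomial.coeff (dup_num (Suc m)) 1 = 4 ^ Suc m"
    using Suc by (simp only: c1) (simp add: coeff_mult_0 n4)
  then show ?case using Suc by (simp add: coeff_mult_0 coeff_0_power n4)
qed auto

text \<open>A return of u under repeated squaring makes sn^2 a fixed point of an iterate of the
  duplication map. The resulting polynomial has linear coefficient 4^m - 1, hence is not zero as m >
  0.\<close>

lemma sn2_in_K:
  assumes "u \<noteq> 0" "m > 0" "u ^ (2 ^ m) = u"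
  shows "sn2 u \<in> lam_closure"
proof (rule lam_closure_root_of)
  let ?Q = "dup_num m - [:0, 1:] * dup_den m"
  have "Polynomial.coeff ?Q 1 = 4 ^ m - 1"
    using dup_low_coeffs[of m] by (simp add: coeff_pCons)
  moreover have "(4 :: complex fps fract) ^ m - 1 \<noteq> 0"
  proof -
    have *: "fr (of_nat k) = of_nat k" for k by (induction k) auto
    have "(4::nat) ^ m \<noteq> 1" using assms(2) by simp
    then have "(of_nat (4 ^ m) :: complex fps) \<noteq> of_nat 1" by (metis of_nat_eq_iff)
    then have "fr (of_nat (4 ^ m)) \<noteq> fr (of_nat 1)" by (metis to_fract_eq_iff)
    then show ?thesis unfolding * by simp
  qed
  ultimately show "?Q \<noteq> 0" by (metis coeff_0)
  show "Polynomial.coeff ?Q i \<in> lam_closure" for i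
    using coeffs_in_K_diff[OF _ coeffs_in_K_mult[OF coeffs_in_K_X]] dup_coeffs[of m] by blast
  show "poly ?Q (sn2 u) = 0"
    using dup_iterate[OF assms(1), of m] assms(3) by simp
qed

section \<open>Theta values at roots of unity\<close>

abbreviation "e0 \<equiv> fr (qprod_even 1)"

text \<open>Twelfth powers of the theta functions divided by \<open>\<eta>\<close>; the power of \<open>X\<close> accounts for
  the fractional leading exponents.\<close>
definition "H1 u = xx ^ 2 * (s1 u / e0) ^ 12"
definition "H2 u = xx ^ 2 * (s2 u / e0) ^ 12"
definition "H3 u = (s3 u / e0) ^ 12 / xx"
definition "H4 u = (s4 u / e0) ^ 12 / xx"

text \<open>The quotients H1/H4, H2/H4 and H3/H4 in terms of sn^2, cn^2, dn^2 and lambda. Sixth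
  powers suffice since these functions are already quadratic in the theta functions.\<close>

definition "r1 u = sn2 u ^ 6 * fr lam ^ 3 / cu u ^ 6"
definition "r2 u = (1 - sn2 u) ^ 6 * fr lam ^ 3 / ((1 - fr lam) ^ 3 * cu u ^ 6)"
definition "r3 u = (1 - fr lam * sn2 u) ^ 6 / (1 - fr lam) ^ 3"

lemma H1_ratio: "u \<noteq> 0 \<Longrightarrow> H1 u = r1 u * H4 u"
  and H2_ratio: "u \<noteq> 0 \<Longrightarrow> H2 u = r2 u * H4 u"
  and H3_ratio: "u \<noteq> 0 \<Longrightarrow> H3 u = r3 u * H4 u"
proof -
  assume u: "u \<noteq> 0"
  have nz: "xx \<noteq> 0" "cu u \<noteq> 0" "s2 1 \<noteq> 0" "s3 1 \<noteq> 0" "s4 1 \<noteq> 0" "s4 u \<noteq> 0" "e0 \<noteq> 0"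
    using u by auto
  have "x ^ 2 * (a1 / e) ^ 12 = (- U * a1 ^ 2 * b3 ^ 2 / (b2 ^ 2 * a4 ^ 2)) ^ 6 * (x * b2 ^ 4 / b3 ^ 4) ^ 3 / U ^ 6 * ((a4 / e) ^ 12 / x)"
    if "x \<noteq> 0" "U \<noteq> 0" "b2 \<noteq> 0" "b3 \<noteq> 0" "a4 \<noteq> 0" "e \<noteq> 0" for x U a1 b2 b3 a4 e :: "complex fps fract"
    using that by (simp add: power_divide power_mult_distrib field_simps flip: power_mult)
      (simp add: power2_eq_square power3_eq_cube)?
  from this[OF nz(1-4,6-7)] show "H1 u = r1 u * H4 u"
    unfolding H1_def H4_def r1_def sn2_def lam_eq by blast
  have "x ^ 2 * (a2 / e) ^ 12 = (b4 ^ 2 * U * a2 ^ 2 / (b2 ^ 2 * a4 ^ 2)) ^ 6 * (x * b2 ^ 4 / b3 ^ 4) ^ 3 / ((b4 ^ 4 / b3 ^ 4) ^ 3 * U ^ 6) * ((a4 / e) ^ 12 / x)"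
    if "x \<noteq> 0" "U \<noteq> 0" "b2 \<noteq> 0" "b3 \<noteq> 0" "b4 \<noteq> 0" "a4 \<noteq> 0" "e \<noteq> 0" for x U a2 b2 b3 b4 a4 e :: "complex fps fract"
    using that by (simp add: power_divide power_mult_distrib field_simps flip: power_mult)
      (simp add: power2_eq_square power3_eq_cube)?
  from this[OF nz] show "H2 u = r2 u * H4 u"
    unfolding H2_def H4_def r2_def one_minus_sn2[OF u] one_minus_lam unfolding lam_eq by blast
  have "(a3 / e) ^ 12 / x = (b4 ^ 2 * a3 ^ 2 / (b3 ^ 2 * a4 ^ 2)) ^ 6 / (b4 ^ 4 / b3 ^ 4) ^ 3 * ((a4 / e) ^ 12 / x)"
    if "x \<noteq> 0" "b3 \<noteq> 0" "b4 \<noteq> 0" "a4 \<noteq> 0" "e \<noteq> 0" for x a3 b3 b4 a4 e :: "complex fps fract"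
    using that by (simp add: power_divide power_mult_distrib field_simps flip: power_mult)
      (simp add: power2_eq_square power3_eq_cube)?
  from this[OF nz(1,4-7)] show "H3 u = r3 u * H4 u"
    unfolding H3_def H4_def r3_def one_minus_lam_sn2[OF u] one_minus_lam by blast
qed

text \<open>The powers of X balance: 2 + 2 - 1 - 1 = 2.\<close>

lemma H1_duplication: "u \<noteq> 0 \<Longrightarrow> H1 (u ^ 2) = H1 u * H2 u * H3 u * H4 u"
proof -
  assume u: "u \<noteq> 0"
  have "s1 (u ^ 2) = s1 u * s2 u * s3 u * s4 u / e0 ^ 3"
    using s1_duplication[OF u] by (simp add: field_simps)
  then have "s1 (u ^ 2) / e0 = (s1 u / e0) * (s2 u / e0) * (s3 u / e0) * (s4 u / e0)"
    by (simp add: power3_eq_cube)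
  then show ?thesis
    unfolding H1_def H2_def H3_def H4_def
    by (simp only: power_mult_distrib) (simp add: power2_eq_square)
qed

lemma H_neq_0: "u \<noteq> 0 \<Longrightarrow> H3 u \<noteq> 0" "u \<noteq> 0 \<Longrightarrow> H4 u \<noteq> 0" 
  "u \<noteq> 0 \<Longrightarrow> u \<noteq> - 1 \<Longrightarrow> H2 u \<noteq> 0" "u \<noteq> 0 \<Longrightarrow> u \<noteq> 1 \<Longrightarrow> H1 u \<noteq> 0"
  using theta2_neq_0[of u] theta2_neq_0[of "- u"] by (auto simp: H1_def H2_def H3_def H4_def)

lemma r_in_K:
  assumes "u ^ n = 1" "n > 0" "sn2 u \<in> lam_closure"
  shows "r1 u \<in> lam_closure" "r2 u \<in> lam_closure" "r3 u \<in> lam_closure"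
  unfolding r1_def r2_def r3_def
  by (intro lam_closure_intros assms(3) root_of_unity_in_lam_closure[OF assms(1,2)])+

text \<open>Expressing H1, H2, H3 through H4 turns duplication into H4(v^2) = c H4(v)^4 with
  algebraic c. After a full cycle H4(u)^(4^m - 1) is algebraic. Dividing by r1 requires theta_1 to
  be nonzero along the orbit, so the orbit must avoid 1; being closed under squaring, it then avoids
  -1 too.\<close>

lemma H4_in_K:
  assumes u: "u ^ n = 1" "n > 0" and m: "m > 0" "u ^ (2 ^ m) = u" and ne: "\<And>i. u ^ (2 ^ i) \<noteq> 1"
  shows "H4 u \<in> lam_closure"
proof -
  have u0: "u \<noteq> 0" using u by (auto simp: power_0_left)
  define v where "v i = u ^ (2 ^ i)" for i :: nat
  have v0: "v i \<noteq> 0" for i using u0 by (simp add: v_def)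
  have vS: "v (Suc i) = v i ^ 2" for i by (simp add: v_def power_mult[symmetric] mult.commute)
  have v1: "v i \<noteq> 1" "v i \<noteq> - 1" for i
    using ne[of i] ne[of "Suc i"] vS[of i] by (auto simp: v_def)
  have vn: "v i ^ n = 1" for i
    using u(1) unfolding v_def by (metis power_commutes power_mult mult.commute power_one)
  have "v i ^ (2 ^ m) = v i" for i
    using m(2) unfolding v_def by (metis power_mult mult.commute)
  then have sK: "sn2 (v i) \<in> lam_closure" for i by (rule sn2_in_K[OF v0 m(1)])
  note rK = r_in_K[OF vn u(2) sK]
  have rnz: "r1 (v i) \<noteq> 0" "r2 (v i) \<noteq> 0" "r3 (v i) \<noteq> 0" for i
    using H_neq_0[of "v i"] v0[of i] v1[of i] H1_ratio[OF v0] H2_ratio[OF v0] H3_ratio[OF v0]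
    by (metis mult_zero_left)+
  have step: "H4 (v (Suc i)) = (r1 (v i) * r2 (v i) * r3 (v i) / r1 (v (Suc i))) * H4 (v i) ^ 4" for i
  proof -
    have "r1 (v (Suc i)) * H4 (v (Suc i)) = r1 (v i) * r2 (v i) * r3 (v i) * H4 (v i) ^ 4"
      using H1_duplication[OF v0, of i] H1_ratio[OF v0] H2_ratio[OF v0] H3_ratio[OF v0]
      by (simp add: vS[symmetric] power4_eq_xxxx mult_ac)
    then show ?thesis using rnz by (simp add: field_simps)
  qed
  have "\<exists>C. C \<in> lam_closure \<and> C \<noteq> 0 \<and> H4 (v i) = C * H4 u ^ (4 ^ i)" for i
  proof (induction i)
    case 0
    then show ?case using lam_closure_1 by (intro exI[of _ 1]) (simp add: v_def)
  next
    case (Suc i)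
    then obtain C where C: "C \<in> lam_closure" "C \<noteq> 0" "H4 (v i) = C * H4 u ^ (4 ^ i)" by blast
    have "H4 (v (Suc i)) = (r1 (v i) * r2 (v i) * r3 (v i) / r1 (v (Suc i)) * C ^ 4) * H4 u ^ (4 ^ Suc i)"
      unfolding step C(3) by (simp add: power_mult_distrib flip: power_mult) (simp add: mult.commute)
    moreover have "r1 (v i) * r2 (v i) * r3 (v i) / r1 (v (Suc i)) * C ^ 4 \<in> lam_closure"
      by (intro lam_closure_intros rK C)
    moreover have "r1 (v i) * r2 (v i) * r3 (v i) / r1 (v (Suc i)) * C ^ 4 \<noteq> 0" using rnz C(2) by simp
    ultimately show ?case by blast
  qed
  then obtain C where C: "C \<in> lam_closure" "C \<noteq> 0" "H4 (v m) = C * H4 u ^ (4 ^ m)" by blast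
  have "4 ^ m = Suc (4 ^ m - 1)" by simp
  then have "H4 u = C * (H4 u * H4 u ^ (4 ^ m - 1))" using C(3) m(2) by (metis power_Suc v_def)
  then have "H4 u ^ (4 ^ m - 1) = 1 / C" using H_neq_0(2)[OF u0] C(2) by (simp add: field_simps)
  then have "H4 u ^ (4 ^ m - 1) \<in> lam_closure" using lam_closure_divide[OF lam_closure_1 C(1)] by simp
  moreover have "4 ^ m - 1 > (0::nat)" using one_less_power[of "4::nat" m] m(1) by simp
  ultimately show ?thesis by (rule lam_closure_nth_root)
qed

lemma sn2_1 [simp]: "sn2 1 = 0"
proof -
  have "theta2 (- 1) = 0" by (simp add: theta2_product)
  then show ?thesis by (simp add: sn2_def)
qed

text \<open>At u = 1 the cycle argument fails because theta_1 vanishes. Instead H2 H3 H4 = 2^12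
  there, and the ratios leave an equation for H4^3.\<close>

lemma H4_1_in_K: "H4 1 \<in> lam_closure"
proof (rule lam_closure_nth_root)
  have "H2 1 * H3 1 * H4 1 = ((s2 1 * s3 1 * s4 1) / e0 ^ 3) ^ 12"
    unfolding H2_def H3_def H4_def by (simp add: power_mult_distrib power_divide power2_eq_square field_simps flip: power_mult)
  also have "\<dots> = 2 ^ 12" unfolding s_constants by simp
  finally have "r2 1 * r3 1 * H4 1 ^ 3 = 2 ^ 12"
    using H2_ratio[of 1] H3_ratio[of 1] by (simp add: power3_eq_cube mult_ac)
  then have "H4 1 ^ 3 = 2 ^ 12 / (r2 1 * r3 1)"
    using lam_neq by (simp add: field_simps r2_def r3_def)
  moreover have "2 ^ 12 / (r2 1 * r3 1) \<in> lam_closure"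
    by (intro lam_closure_intros r_in_K[of 1 1]) (auto simp: lam_closure_0)
  ultimately show "H4 1 ^ 3 \<in> lam_closure" by simp
qed simp

lemma H23_1_in_K: "H2 1 \<in> lam_closure" "H3 1 \<in> lam_closure"
  using H2_ratio[of 1] H3_ratio[of 1] r_in_K[of 1 1] H4_1_in_K lam_closure_0 by (auto intro: lam_closure_mult)

section \<open>Eta quotients and the modular equation\<close>

definition eta_quot :: "nat \<Rightarrow> complex fps" where
  "eta_quot p = fps_X ^ (p - 1) * ((qprod 1 oo fps_X ^ p) * inverse (qprod 1)) ^ 24"

lemma eta_quot_eq: "eta_quot p * qprod 1 ^ 24 = fps_X ^ (p - 1) * (qprod 1 oo fps_X ^ p) ^ 24"
proof -
  have "inverse (qprod 1) * qprod 1 = 1" by (rule inverse_mult_eq_1) simp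
  then show ?thesis
    unfolding eta_quot_def mult.assoc power_mult_distrib[symmetric] by simp
qed

lemma compose_X_power_X_power:
  fixes f :: "'a::comm_ring_1 fps"
  assumes "a > 0" "b > 0"
  shows "(f oo fps_X ^ a) oo fps_X ^ b = f oo fps_X ^ (a * b)"
  using assms by (auto simp: fps_eq_iff compose_X_power_nth dvd_div_iff_mult div_mult2_eq mult.commute dest: dvd_mult_left dvd_mult_right)

text \<open>Theta functions use the nome X, with q = X^2, so Delta(q^p)/Delta(q) appears among them
  as \<open>eta_quot p\<close> at X^2.\<close>

lemma eta_quot_compose_2:
  assumes "p > 0"
  shows "fr (eta_quot p oo fps_X ^ 2) = xx ^ (2 * (p - 1)) * (fr (qprod_even 1 oo fps_X ^ p) / e0) ^ 24"
proof -
  have "(eta_quot p * qprod 1 ^ 24) oo fps_X ^ 2 = (fps_X ^ (p - 1) * (qprod 1 oo fps_X ^ p) ^ 24) oo fps_X ^ 2"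
    by (simp only: eta_quot_eq)
  then have "(eta_quot p oo fps_X ^ 2) * qprod_even 1 ^ 24 = fps_X ^ (2 * (p - 1)) * (qprod_even 1 oo fps_X ^ p) ^ 24"
    using assms by (simp add: qprod_even_eq_compose fps_compose_mult_distrib compose_X_power_X_power mult.commute
        fps_X_power_compose flip: fps_compose_power power_mult)
  from arg_cong[OF this, of fr] show ?thesis
    by (simp add: to_fract_power power_divide field_simps)
qed

lemma acl_of_K:
  assumes "fr x \<in> lam_closure" shows "x \<in> acl (ring_gen {lam})"
  using assms acl_ring_gen_fract[of x "{lam}"] by (simp add: lam_closure_def)

lemma poly_map_fps_const: "poly (map_poly fps_const Q) f = fps_of_poly Q oo f"
  if "f $ 0 = 0" for f :: "'a::idom fps"
proof (induction Q)
  case (pCons a Q)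
  then show ?case using that
    by (simp add: map_poly_pCons fps_of_poly_pCons fps_compose_add_distrib fps_compose_mult_distrib mult.commute)
qed auto

text \<open>The prime ring consists of constant series, and substituting a nonzero series without
  constant term into polynomials over constants is injective. This supplies the transcendence needed
  for the exchange property.\<close>

lemma fps_not_acl_prime_ring:
  fixes f :: "'a::idom fps"
  assumes "f $ 0 = 0" "f \<noteq> 0"
  shows "f \<notin> acl (ring_gen {})"
proof
  assume "f \<in> acl (ring_gen {})"
  then obtain P where P: "P \<noteq> 0" "\<forall>i. Polynomial.coeff P i \<in> ring_gen {}" "poly P f = 0"
    unfolding acl_def by blast
  have "ring_gen {} \<subseteq> range (fps_const :: 'a \<Rightarrow> _)"
  proof (rule ring_gen_subset)
    have "1 \<in> range (fps_const :: 'a \<Rightarrow> _)" by (rule range_eqI[of _ _ 1]) simp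
    then show "base_ring (range (fps_const :: 'a \<Rightarrow> _))"
      by (auto simp: base_ring_def)
  qed simp
  then have c: "Polynomial.coeff P i = fps_const (Polynomial.coeff P i $ 0)" for i
    using P(2) by (metis (no_types, lifting) fps_nth_fps_const imageE subsetD)
  define Q where "Q = map_poly (\<lambda>c. c $ 0) P"
  have "P = map_poly fps_const Q"
    by (rule poly_eqI) (simp add: Q_def coeff_map_poly c[symmetric])
  then have "fps_of_poly Q oo f = 0" "Q \<noteq> 0" using P poly_map_fps_const[OF assms(1)] by auto
  then have "fps_of_poly Q = fps_of_poly 0" "Q \<noteq> 0" using assms by (simp_all add: fps_compose_eq_0_iff)
  then show False unfolding fps_of_poly_eq_iff by blast
qed

lemma eta_quot_0: "p \<ge> 2 \<Longrightarrow> eta_quot p $ 0 = 0"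
  by (simp add: eta_quot_def)

lemma eta_quot_neq_0: "p > 0 \<Longrightarrow> eta_quot p \<noteq> 0"
proof
  assume "p > 0" "eta_quot p = 0"
  then have "fps_X ^ (p - 1) * (qprod 1 oo fps_X ^ p) ^ 24 = 0" using eta_quot_eq[of p] by simp
  then have "(qprod 1 oo fps_X ^ p) $ 0 = 0" by simp
  then show False using \<open>p > 0\<close> by (simp add: compose_X_power_nth)
qed

lemma ring_morph_compose_X_power: "p > 0 \<Longrightarrow> ring_morph (\<lambda>f. (f :: 'a::idom fps) oo fps_X ^ p)"
  by (rule ring_morphI) (auto simp: fps_compose_add_distrib fps_compose_mult_distrib)

lemma inj_compose_X_power: "p > 0 \<Longrightarrow> inj (\<lambda>f. (f :: 'a::comm_ring_1 fps) oo fps_X ^ p)"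
proof (rule injI, rule fps_ext)
  fix f g :: "'a fps" and n assume p: "p > 0" and "f oo fps_X ^ p = g oo fps_X ^ p"
  then have "(f oo fps_X ^ p) $ (p * n) = (g oo fps_X ^ p) $ (p * n)" by simp
  then show "f $ n = g $ n" using p by (simp add: compose_X_power_nth)
qed

lemma acl_compose_X_power_iff:
  fixes f g :: "'a::idom fps"
  assumes "p > 0"
  shows "f oo fps_X ^ p \<in> acl (ring_gen {g oo fps_X ^ p}) \<longleftrightarrow> f \<in> acl (ring_gen {g})"
  using acl_ring_gen_morph_iff[OF ring_morph_compose_X_power inj_compose_X_power, OF assms assms, of f "{g}"] by simp

lemma primitive_root:
  assumes "p > 0"
  obtains z :: complex where "z ^ p = 1" "inj_on (\<lambda>k. z ^ k) {..<p}"
proof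
  let ?z = "cis (2 * pi / p)"
  have pw: "?z ^ k = cis (2 * pi * real k / real p)" for k
    by (simp add: DeMoivre mult_ac)
  show "?z ^ p = 1" unfolding pw using assms by simp
  show "inj_on (\<lambda>k. ?z ^ k) {..<p}"
    unfolding pw using bij_betw_roots_unity[OF assms] by (simp add: bij_betw_def)
qed

lemma primitive_root_eq_1_iff:
  fixes z :: complex
  assumes z: "z ^ p = 1" "inj_on (\<lambda>k. z ^ k) {..<p}" and "p > 0"
  shows "z ^ j = 1 \<longleftrightarrow> p dvd j"
proof -
  have "z ^ j = z ^ (p * (j div p) + j mod p)" by simp
  also have "\<dots> = z ^ (j mod p)" unfolding power_add power_mult z(1) by simp
  finally have "z ^ j = 1 \<longleftrightarrow> z ^ (j mod p) = z ^ 0" by simp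
  also have "\<dots> \<longleftrightarrow> j mod p = 0"
    using inj_on_eq_iff[OF z(2), of "j mod p" 0] \<open>p > 0\<close> by simp
  finally show ?thesis by (simp add: dvd_eq_mod_eq_0)
qed

context
  fixes z :: complex and p :: nat
  assumes z: "z ^ p = 1" "inj_on (\<lambda>k. z ^ k) {..<p}" and p: "odd p" "Factorial_Ring.prime p"
begin

lemma unity_power_power: "(z ^ k) ^ p = 1"
proof -
  have "(z ^ k) ^ p = (z ^ p) ^ k" by (simp only: power_mult[symmetric] mult.commute)
  then show ?thesis by (simp only: z(1) power_one)
qed

lemma H4_unity_in_K: "H4 (z ^ k) \<in> lam_closure" and r_unity_in_K: "r1 (z ^ k) \<in> lam_closure" "r2 (z ^ k) \<in> lam_closure" "r3 (z ^ k) \<in> lam_closure"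
proof -
  have p0: "p > 0" using p(2) by (rule prime_gt_0_nat)
  have "\<not> p dvd 2"
  proof
    assume "p dvd 2"
    then have "p = 2" using dvd_imp_le[of p 2] prime_ge_2_nat[OF p(2)] by simp
    then show False using p(1) by simp
  qed
  \<comment> \<open>Fermat's theorem provides the return exponent m = p - 1: the power 2^(p-1) fixes
    every p-th root of unity.\<close>
  then have "[2 ^ (p - 1) = 1] (mod p)" using fermat_theorem[OF p(2)] by blast
  then have "p dvd 2 ^ (p - 1) - 1" by (simp add: cong_altdef_nat)
  then obtain c where "2 ^ (p - 1) - 1 = p * c" by blast
  then have c: "2 ^ (p - 1) = p * c + 1" by (metis add.commute le_add_diff_inverse one_le_numeral one_le_power)
  have fx: "(z ^ k) ^ (2 ^ (p - 1)) = z ^ k"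
    unfolding c by (simp add: power_add power_mult[symmetric])
      (metis mult.commute mult.assoc power_mult power_one z(1) mult_1)
  note un = unity_power_power[of k]
  have p1: "p - 1 > 0" using prime_gt_1_nat[OF p(2)] by simp
  have zk: "z ^ k \<noteq> 0" using z(1) p0 by (auto simp: power_0_left)
  note sn = sn2_in_K[OF zk p1 fx]
  show "r1 (z ^ k) \<in> lam_closure" "r2 (z ^ k) \<in> lam_closure" "r3 (z ^ k) \<in> lam_closure"
    by (rule r_in_K[OF un p0 sn])+
  show "H4 (z ^ k) \<in> lam_closure"
  proof (cases "p dvd k")
    case True
    then have "z ^ k = 1" using primitive_root_eq_1_iff[OF z p0] by blast
    then show ?thesis using H4_1_in_K by simp
  next
    case False
    have "(z ^ k) ^ (2 ^ i) \<noteq> 1" for i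
    proof
      assume "(z ^ k) ^ (2 ^ i) = 1"
      then have "p dvd k * 2 ^ i" using primitive_root_eq_1_iff[OF z p0] by (metis power_mult)
      then have "p dvd 2 ^ i" using False p(2) by (simp add: prime_dvd_mult_iff)
      then show False using \<open>\<not> p dvd 2\<close> prime_dvd_power[OF p(2)] by blast
    qed
    then show ?thesis by (rule H4_in_K[OF un p0 p1 fx])
  qed
qed

lemma H_unity_in_K: "H1 (z ^ k) \<in> lam_closure" "H2 (z ^ k) \<in> lam_closure" "H3 (z ^ k) \<in> lam_closure"
proof -
  have zk: "z ^ k \<noteq> 0" using z(1) prime_gt_0_nat[OF p(2)] by (auto simp: power_0_left)
  show "H1 (z ^ k) \<in> lam_closure" "H2 (z ^ k) \<in> lam_closure" "H3 (z ^ k) \<in> lam_closure"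
    unfolding H1_ratio[OF zk] H2_ratio[OF zk] H3_ratio[OF zk]
    by (intro lam_closure_mult H4_unity_in_K r_unity_in_K)+
qed

lemma prod_const_in_K:
  assumes "finite S" "\<And>k. k \<in> S \<Longrightarrow> c k = 1 + 1 / z ^ k \<or> c k = 1 - 1 / z ^ k"
  shows "cu (\<Prod>k\<in>S. c k) \<in> lam_closure"
proof -
  have p0: "p > 0" using p(2) by (rule prime_gt_0_nat)
  have "cu (c k) \<in> lam_closure" if "k \<in> S" for k
  proof -
    have "(1 / z ^ k) ^ p = 1" using unity_power_power[of k] by (simp add: power_divide)
    then have "cu (1 / z ^ k) \<in> lam_closure" by (rule root_of_unity_in_lam_closure[OF _ p0])
    moreover have "cu (1 + 1 / z ^ k) = 1 + cu (1 / z ^ k)" "cu (1 - 1 / z ^ k) = 1 - cu (1 / z ^ k)"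
      by (simp_all flip: fps_const_add fps_const_sub)
    ultimately have "cu (1 + 1 / z ^ k) \<in> lam_closure" "cu (1 - 1 / z ^ k) \<in> lam_closure"
      using lam_closure_add[OF lam_closure_1] lam_closure_diff[OF lam_closure_1] by (simp_all only:)
    then show ?thesis using assms(2)[OF that] by (elim disjE) (simp_all only:)
  qed
  then show ?thesis
    unfolding fps_const_prod morph_prod[OF ring_morph_to_fract] by (rule lam_closure_prod)
qed

text \<open>The product of theta_1/eta over the nontrivial roots of unity is a nonzero constant
  times the square of eta(q^p)/eta(q); its twelfth power gives the quotient of Delta.\<close>

lemma eta_quot_in_K: "fr (eta_quot p oo fps_X ^ 2) \<in> lam_closure"
proof -
  have p0: "p > 0" using p(2) by (rule prime_gt_0_nat)
  define C where "C = cu (\<Prod>k\<in>{1..<p}. 1 - 1 / z ^ k)"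
  have C: "C \<in> lam_closure" unfolding C_def by (rule prod_const_in_K) auto
  have C0: "C \<noteq> 0"
  proof -
    have "1 - 1 / z ^ k \<noteq> 0" if "k \<in> {1..<p}" for k
    proof -
      have "z ^ k \<noteq> 1" using that primitive_root_eq_1_iff[OF z p0, of k] by (auto dest: dvd_imp_le)
      moreover have "z \<noteq> 0" using z(1) p0 by (auto simp: power_0_left)
      ultimately show ?thesis by (auto simp: divide_eq_eq)
    qed
    then have "(\<Prod>k\<in>{1..<p}. 1 - 1 / z ^ k) \<noteq> 0"
      by (simp only: prod_zero_iff finite_atLeastLessThan) blast
    then show ?thesis unfolding C_def by (simp only: cu_neq_0 not_False_eq_True)
  qed
  let ?P = "\<Prod>k\<in>{1..<p}. s1 (z ^ k)"
  have "?P * e0 ^ 2 = C * fr (qprod_even 1 oo fps_X ^ p) ^ 2 * e0 ^ (p - 1)"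
    using arg_cong[OF prod_S1_unity[OF z p(1)], of fr]
    by (simp only: to_fract_mult to_fract_power morph_prod[OF ring_morph_to_fract] C_def)
  then have P: "?P / e0 ^ (p - 1) = C * (fr (qprod_even 1 oo fps_X ^ p) / e0) ^ 2"
    by (simp add: field_simps)
  have "(\<Prod>k\<in>{1..<p}. H1 (z ^ k)) = (xx ^ 2) ^ (p - 1) * (?P / e0 ^ (p - 1)) ^ 12"
    unfolding H1_def by (simp add: prod.distrib prod_dividef prod_power_distrib[symmetric])
  also have "\<dots> = xx ^ (2 * (p - 1)) * (C * (fr (qprod_even 1 oo fps_X ^ p) / e0) ^ 2) ^ 12"
    unfolding P by (simp only: power_mult)
  also have "\<dots> = C ^ 12 * fr (eta_quot p oo fps_X ^ 2)"
    unfolding eta_quot_compose_2[OF p0] by (simp add: power_mult_distrib flip: power_mult)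
  finally have "fr (eta_quot p oo fps_X ^ 2) = (\<Prod>k\<in>{1..<p}. H1 (z ^ k)) / C ^ 12"
    using C0 by (simp add: field_simps)
  also have "\<dots> \<in> lam_closure" by (intro lam_closure_intros C lam_closure_prod H_unity_in_K)
  finally show ?thesis .
qed

text \<open>Over all roots of unity the products of H2 and H3 give theta constants at X^p, and their
  quotient is lambda(X^p)^3 up to a constant. That constant is not 0 because -1 is not a p-th root
  of unity for odd p.\<close>

lemma lam_compose_in_K: "fr (lam oo fps_X ^ p) \<in> lam_closure"
proof (rule lam_closure_nth_root)
  have p0: "p > 0" using p(2) by (rule prime_gt_0_nat)
  define C where "C = cu (\<Prod>k<p. 1 + 1 / z ^ k)"
  have C: "C \<in> lam_closure" unfolding C_def by (rule prod_const_in_K) auto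
  have z0: "z \<noteq> 0" using z(1) p0 by (auto simp: power_0_left)
  have C0: "C \<noteq> 0"
  proof -
    have "1 + 1 / z ^ k \<noteq> 0" if "k < p" for k
    proof
      assume "1 + 1 / z ^ k = 0"
      then have "z ^ k = - 1" using z0 by (simp add: field_simps add_eq_0_iff)
      then have "(z ^ k) ^ p = - 1" using p(1) by simp
      moreover have "(z ^ k) ^ p = 1" by (rule unity_power_power)
      ultimately show False by simp
    qed
    then have "(\<Prod>k<p. 1 + 1 / z ^ k) \<noteq> 0"
      by (simp only: prod_zero_iff finite_lessThan) blast
    then show ?thesis unfolding C_def by (simp only: cu_neq_0 not_False_eq_True)
  qed
  let ?P2 = "\<Prod>k<p. s2 (z ^ k)" and ?P3 = "\<Prod>k<p. s3 (z ^ k)"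
  let ?E = "fr (qprod_even 1 oo fps_X ^ p)" and ?T2 = "fr (theta2 1 oo fps_X ^ p)" and ?T3 = "fr (theta3 1 oo fps_X ^ p)"
  have E0: "?E \<noteq> 0" "?T3 \<noteq> 0"
    using inj_eq[OF inj_compose_X_power[OF p0], of _ "0 :: complex fps"] by auto
  have two: "fr 2 = 2" by (metis one_add_one to_fract_1 to_fract_add)
  have "?P2 * ?E * 2 = C * ?T2 * e0 ^ p"
    using arg_cong[OF prod_theta2_unity[OF z p(1)], of fr]
    by (simp only: to_fract_mult to_fract_power morph_prod[OF ring_morph_to_fract] C_def two)
  then have P2: "?P2 / e0 ^ p = C / 2 * (?T2 / ?E)"
    using E0 by (simp add: field_simps)
  have "?P3 * ?E = ?T3 * e0 ^ p"
    using arg_cong[OF prod_theta3_unity[OF z p(1)], of fr]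
    by (simp only: to_fract_mult to_fract_power morph_prod[OF ring_morph_to_fract])
  then have P3: "?P3 / e0 ^ p = ?T3 / ?E"
    using E0 by (simp add: field_simps)
  have h2: "(\<Prod>k<p. H2 (z ^ k)) = (xx ^ p) ^ 2 * (?P2 / e0 ^ p) ^ 12"
    unfolding H2_def by (simp add: prod.distrib prod_dividef prod_power_distrib[symmetric] mult.commute flip: power_mult)
  have h3: "(\<Prod>k<p. H3 (z ^ k)) = (?P3 / e0 ^ p) ^ 12 / xx ^ p"
    unfolding H3_def by (simp add: prod.distrib prod_dividef prod_power_distrib[symmetric])
  have "lam * theta3 1 ^ 4 = fps_X * theta2 1 ^ 4"
  proof -
    have "fr (lam * theta3 1 ^ 4) = fr (fps_X * theta2 1 ^ 4)" by (simp add: lam_eq to_fract_power)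
    then show ?thesis by (simp only: to_fract_eq_iff)
  qed
  then have "(lam * theta3 1 ^ 4) oo fps_X ^ p = (fps_X * theta2 1 ^ 4) oo fps_X ^ p" by simp
  then have "(lam oo fps_X ^ p) * (theta3 1 oo fps_X ^ p) ^ 4 = fps_X ^ p * (theta2 1 oo fps_X ^ p) ^ 4"
    using p0 by (simp add: fps_compose_mult_distrib flip: fps_compose_power)
  then have lp: "fr (lam oo fps_X ^ p) = xx ^ p * ?T2 ^ 4 / ?T3 ^ 4"
    using E0 arg_cong[of _ _ fr] by (metis nonzero_mult_div_cancel_right power_not_zero to_fract_mult to_fract_power)
  have gen: "(x * t2 ^ 4 / t3 ^ 4) ^ 3 = (x ^ 2 * (c / 2 * (t2 / e)) ^ 12) / ((t3 / e) ^ 12 / x) * (2 / c) ^ 12"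
    if "x \<noteq> 0" "t3 \<noteq> 0" "e \<noteq> 0" "c \<noteq> 0" for x t2 t3 e c :: "complex fps fract"
  proof -
    have "(c / 2 * (t2 / e)) ^ 12 * (2 / c) ^ 12 = (t2 / e) ^ 12"
      using that by (simp flip: power_mult_distrib)
    then have "(x ^ 2 * (c / 2 * (t2 / e)) ^ 12) / ((t3 / e) ^ 12 / x) * (2 / c) ^ 12 = x ^ 2 * (t2 / e) ^ 12 / ((t3 / e) ^ 12 / x)"
      by (metis (no_types, lifting) mult.assoc times_divide_eq_left)
    also have "\<dots> = x ^ 3 * t2 ^ 12 / t3 ^ 12"
      using that by (simp add: power_divide field_simps) (simp add: power2_eq_square power3_eq_cube)?
    finally show ?thesis by (simp add: power_divide power_mult_distrib flip: power_mult)
  qed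
  have "fr (lam oo fps_X ^ p) ^ 3 = (\<Prod>k<p. H2 (z ^ k)) / (\<Prod>k<p. H3 (z ^ k)) * (2 / C) ^ 12"
    unfolding lp h2 h3 P2 P3 by (rule gen) (use E0 C0 in auto)
  also have "\<dots> \<in> lam_closure" by (intro lam_closure_intros C lam_closure_prod H_unity_in_K)
  finally show "fr (lam oo fps_X ^ p) ^ 3 \<in> lam_closure" .
qed simp

text \<open>With f the eta quotient at X^2: f(X^p) depends on lambda(X^p), this on lambda, and
  lambda on f by exchange. All series left are in X^2, so X^2 can be replaced by X.\<close>

lemma modular_equation_odd: "eta_quot p oo fps_X ^ p \<in> acl (ring_gen {eta_quot p})"
proof -
  have p2: "p \<ge> 2" "p > 0" using prime_ge_2_nat[OF p(2)] by auto
  let ?f = "eta_quot p oo fps_X ^ 2"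
  have f: "?f \<in> acl (ring_gen {lam})" by (rule acl_of_K[OF eta_quot_in_K])
  have "?f \<notin> acl (ring_gen {})"
  proof (rule fps_not_acl_prime_ring)
    show "?f $ 0 = 0" using eta_quot_0[OF p2(1)] by simp
    show "?f \<noteq> 0" using eta_quot_neq_0[OF p2(2)] inj_eq[OF inj_compose_X_power[of 2], of "eta_quot p" 0] by simp
  qed
  then have l: "lam \<in> acl (ring_gen {?f})" by (rule acl_exchange[OF f])
  have "?f oo fps_X ^ p \<in> acl (ring_gen {lam oo fps_X ^ p})"
    using f acl_compose_X_power_iff[OF p2(2)] by blast
  then have "?f oo fps_X ^ p \<in> acl (ring_gen {lam})"
    by (rule acl_trans) (use acl_of_K[OF lam_compose_in_K] in auto)
  then have "?f oo fps_X ^ p \<in> acl (ring_gen {?f})"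
    by (rule acl_trans) (use l in auto)
  moreover have "?f oo fps_X ^ p = (eta_quot p oo fps_X ^ p) oo fps_X ^ 2"
    using p2 by (simp add: compose_X_power_X_power mult.commute)
  ultimately show ?thesis
    using acl_compose_X_power_iff[of 2 "eta_quot p oo fps_X ^ p" "eta_quot p"] by simp
qed

end

text \<open>Theta constants suffice: the two quotients of Delta are 1/H4(1) and H2(1)/2^12, both
  algebraic over lambda in the same nome.\<close>

lemma modular_equation_2: "eta_quot 2 oo fps_X ^ 2 \<in> acl (ring_gen {eta_quot 2})"
proof -
  have "theta3 (- 1) = qprod_even 1 * qprod_odd 1 ^ 2" by (simp add: theta3_product power2_eq_square)
  then have a: "s4 1 / e0 = (fr (qprod 1) / e0) ^ 2"
    by (simp add: qprod_eq_qprod_odd_qprod_even[of 1] to_fract_power)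
  have "eta_quot 2 * qprod 1 ^ 24 = fps_X * qprod_even 1 ^ 24"
    using eta_quot_eq[of 2] by (simp add: qprod_even_eq_compose)
  then have "fr (eta_quot 2) * fr (qprod 1) ^ 24 = xx * e0 ^ 24" by (metis to_fract_mult to_fract_power)
  then have "fr (eta_quot 2) = xx * e0 ^ 24 / fr (qprod 1) ^ 24" by (simp add: field_simps)
  then have "fr (eta_quot 2) = 1 / H4 1"
    unfolding H4_def a by (simp add: power_divide flip: power_mult)
  then have f: "eta_quot 2 \<in> acl (ring_gen {lam})"
    using lam_closure_divide[OF lam_closure_1 H4_1_in_K] by (intro acl_of_K) simp
  have "(qprod 1 * qprod (- 1)) oo fps_X ^ 2 = qprod_even 1 oo fps_X ^ 2" using qprod_mult_qprod_uminus[of 1] by simp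
  then have b: "qprod_even 1 * qprod_even (- 1) = qprod_even 1 oo fps_X ^ 2"
    by (simp add: qprod_even_eq_compose fps_compose_mult_distrib)
  have two: "fr 2 = 2" by (metis one_add_one to_fract_1 to_fract_add)
  have "theta2 1 * qprod_even 1 = 2 * (qprod_even 1 oo fps_X ^ 2) ^ 2"
    unfolding b[symmetric] by (simp add: theta2_product power2_eq_square numeral_fps_const mult_ac)
  then have "s2 1 * e0 = 2 * fr (qprod_even 1 oo fps_X ^ 2) ^ 2" by (metis two to_fract_mult to_fract_power)
  then have c: "s2 1 / e0 = 2 * (fr (qprod_even 1 oo fps_X ^ 2) / e0) ^ 2"
    by (simp add: field_simps power2_eq_square)
  have "H2 1 = 2 ^ 12 * fr (eta_quot 2 oo fps_X ^ 2)"
    unfolding H2_def c eta_quot_compose_2[of 2, simplified] by (simp add: power_mult_distrib flip: power_mult)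
  then have "fr (eta_quot 2 oo fps_X ^ 2) = H2 1 / 2 ^ 12" by (simp add: field_simps)
  then have g: "eta_quot 2 oo fps_X ^ 2 \<in> acl (ring_gen {lam})"
    by (intro acl_of_K) (simp only: lam_closure_divide lam_closure_power lam_closure_numeral H23_1_in_K)
  have "lam \<in> acl (ring_gen {eta_quot 2})"
    by (rule acl_exchange[OF f fps_not_acl_prime_ring[OF eta_quot_0 eta_quot_neq_0]]) auto
  then show ?thesis by (intro acl_trans[OF g]) auto
qed

theorem modular_equation:
  assumes "Factorial_Ring.prime p"
  shows "eta_quot p oo fps_X ^ p \<in> acl (ring_gen {eta_quot p})"
proof (cases "p = 2")
  case False
  then have "odd p" using assms by (metis primes_dvd_imp_eq two_is_prime_nat)
  moreover obtain z :: complex where "z ^ p = 1" "inj_on (\<lambda>k. z ^ k) {..<p}"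
    using primitive_root prime_gt_0_nat[OF assms] by blast
  ultimately show ?thesis using modular_equation_odd assms by blast
qed (simp add: modular_equation_2)

section \<open>The generating series\<close>

definition fmap :: "('a \<Rightarrow> 'b) \<Rightarrow> 'a fps \<Rightarrow> 'b fps" where
  "fmap \<phi> F = Abs_fps (\<lambda>n. \<phi> (F $ n))"

lemma fmap_nth [simp]: "fmap \<phi> F $ n = \<phi> (F $ n)"
  by (simp add: fmap_def)

lemma ring_morph_fmap:
  assumes "ring_morph \<phi>"
  shows "ring_morph (fmap \<phi>)"
proof (rule ring_morphI)
  show "fmap \<phi> 1 = 1"
    by (rule fps_ext) (simp add: morph_0[OF assms] morph_1[OF assms])
qed (auto simp: fps_eq_iff fps_mult_nth morph_add[OF assms] morph_sum[OF assms] morph_mult[OF assms])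

lemma inj_fmap: "inj \<phi> \<Longrightarrow> inj (fmap \<phi>)"
  by (auto simp: inj_def fps_eq_iff)

lemma fmap_X: "ring_morph \<phi> \<Longrightarrow> fmap \<phi> fps_X = fps_X"
  by (rule fps_ext) (simp add: morph_0 morph_1 fps_X_def)

lemma fmap_const: "ring_morph \<phi> \<Longrightarrow> fmap \<phi> (fps_const a) = fps_const (\<phi> a)"
  by (rule fps_ext) (simp add: morph_0)

lemma fmap_compose_X_power: "ring_morph \<phi> \<Longrightarrow> p > 0 \<Longrightarrow> fmap \<phi> (f oo fps_X ^ p) = fmap \<phi> f oo fps_X ^ p"
  by (rule fps_ext) (simp add: compose_X_power_nth morph_0)

lemma ring_morph_fps_const: "ring_morph (fps_const :: 'a::comm_ring_1 \<Rightarrow> _)"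
  by (rule ring_morphI) (simp_all)

lemma inj_fps_const: "inj (fps_const :: 'a::comm_ring_1 \<Rightarrow> _)"
  by (rule injI) (metis fps_nth_fps_const)

definition ratc :: "rat \<Rightarrow> complex" where "ratc = of_rat"

lemma ring_morph_ratc: "ring_morph ratc"
  by (rule ring_morphI) (simp_all add: ratc_def of_rat_add of_rat_mult)

lemma inj_ratc: "inj ratc"
  by (simp add: inj_def ratc_def)

lemmas cpx_morph = ring_morph_fmap[OF ring_morph_ratc]

lemma cpx_eta_prod: "fmap ratc eta_prod = qprod 1"
proof (rule fps_ext)
  fix k
  have "fmap ratc (\<Prod>n\<in>{1..k}. 1 - fps_X ^ n) = (\<Prod>n\<in>{1..k}. 1 - cc 1 * fps_X ^ n)"
    by (simp add: morph_prod[OF cpx_morph] morph_diff[OF cpx_morph] morph_1[OF cpx_morph]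
        morph_power[OF cpx_morph] fmap_X[OF ring_morph_ratc])
  then have "fmap ratc (\<Prod>n\<in>{1..k}. 1 - fps_X ^ n) $ k = (\<Prod>n\<in>{1..k}. 1 - cc 1 * fps_X ^ n) $ k" by simp
  then show "fmap ratc eta_prod $ k = qprod 1 $ k"
    by (simp add: eta_prod_def qprod_def iprod_def)
qed

lemma eta_prod_nth_0 [simp]: "eta_prod $ 0 = 1"
  by (simp add: eta_prod_def)

section \<open>Existence and uniqueness of d_p\<close>

definition int_coeffs :: "rat fps \<Rightarrow> bool" where
  "int_coeffs f \<longleftrightarrow> (\<forall>n. f $ n \<in> \<int>)"

lemma int_coeffs_mult: "int_coeffs f \<Longrightarrow> int_coeffs g \<Longrightarrow> int_coeffs (f * g)"
  by (auto simp: int_coeffs_def fps_mult_nth)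

lemma int_coeffs_X: "int_coeffs fps_X"
  by (simp add: int_coeffs_def fps_X_def)

lemma int_coeffs_1: "int_coeffs 1"
  by (simp add: int_coeffs_def)

lemma int_coeffs_diff: "int_coeffs f \<Longrightarrow> int_coeffs g \<Longrightarrow> int_coeffs (f - g)"
  by (simp add: int_coeffs_def)

lemma int_coeffs_power: "int_coeffs f \<Longrightarrow> int_coeffs (f ^ n)"
  by (induction n) (auto intro: int_coeffs_1 int_coeffs_mult)

lemma int_coeffs_prod: "(\<And>i. i \<in> S \<Longrightarrow> int_coeffs (f i)) \<Longrightarrow> int_coeffs (prod f S)"
  by (induction S rule: infinite_finite_induct) (auto intro: int_coeffs_1 int_coeffs_mult)

lemma int_coeffs_inverse:
  assumes "int_coeffs f" "f $ 0 = 1"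
  shows "int_coeffs (inverse f)"
  unfolding int_coeffs_def
proof
  fix n
  show "inverse f $ n \<in> \<int>"
  proof (induction n rule: less_induct)
    case (less n)
    show ?case
    proof (cases n)
      case 0
      then show ?thesis using assms by simp
    next
      case (Suc m)
      have "(f * inverse f) $ n = 0" using inverse_mult_eq_1'[of f] assms Suc by simp
      then have "(\<Sum>i=0..n. f $ i * inverse f $ (n - i)) = 0" by (simp add: fps_mult_nth)
      then have "inverse f $ n = - (\<Sum>i=1..n. f $ i * inverse f $ (n - i))"
        using assms(2) by (simp add: sum.atLeast_Suc_atMost eq_neg_iff_add_eq_0)
      moreover have "(\<Sum>i=1..n. f $ i * inverse f $ (n - i)) \<in> \<int>"
        using assms(1) less.IH by (intro Ints_sum Ints_mult) (auto simp: int_coeffs_def)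
      ultimately show ?thesis by simp
    qed
  qed
qed

lemma int_coeffs_compose_X_power: "int_coeffs f \<Longrightarrow> p > 0 \<Longrightarrow> int_coeffs (f oo fps_X ^ p)"
  by (simp add: int_coeffs_def compose_X_power_nth)

lemma int_coeffs_eta_prod: "int_coeffs eta_prod"
proof -
  have "int_coeffs (\<Prod>n\<in>{1..k}. 1 - fps_X ^ n)" for k
    by (intro int_coeffs_prod int_coeffs_diff int_coeffs_1 int_coeffs_power int_coeffs_X)
  then show ?thesis unfolding eta_prod_def int_coeffs_def by simp
qed

text \<open>After division by X both series have constant term 1. The cofactor of a - b in a^n - b^n
  then has constant term n, which is nonzero in characteristic 0.\<close>

lemma fps_power_inject_normalized:
  fixes f g :: "'a::field_char_0 fps"
  assumes "f ^ n = g ^ n" "n > 0" "f $ 0 = 0" "g $ 0 = 0" "f $ 1 = 1" "g $ 1 = 1"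
  shows "f = g"
proof -
  define a b where "a = fps_shift 1 f" and "b = fps_shift 1 g"
  have f: "f = fps_X * a" and g: "g = fps_X * b"
    using assms(3,4) by (auto simp: a_def b_def fps_eq_iff)
  have ab: "a $ 0 = 1" "b $ 0 = 1" using assms(5,6) by (simp_all add: a_def b_def)
  have "a ^ n = b ^ n" using assms(1) by (simp add: f g power_mult_distrib)
  define c where "c = (\<Sum>i<n. b ^ (n - Suc i) * a ^ i)"
  have "(a - b) * c = 0"
    using power_diff_sumr2[of a n b] \<open>a ^ n = b ^ n\<close> by (simp add: c_def)
  moreover have "c $ 0 \<noteq> 0"
    using ab assms(2) by (simp add: c_def fps_sum_nth fps_power_zeroth)
  then have "c \<noteq> 0" by auto
  ultimately have "a = b" by simp
  then show ?thesis by (simp add: f g)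
qed

text \<open>For each admissible p, p - 1 divides 24, so X times the power 24/(p-1) of the quotient
  of eta products is an explicit root. It is integral because that quotient is, which makes the
  description in \<open>dp\<close> satisfiable.\<close>

lemma dp_properties:
  assumes p: "p \<in> {2, 3, 5, 7, 13}"
  shows "dp p $ 0 = 0" "dp p $ 1 = 1" "dp p ^ (p - 1) * Delta = Delta oo fps_X ^ p"
proof -
  define e where "e = 24 div (p - 1)"
  have e: "e * (p - 1) = 24" and p0: "p > 0" "p - 1 > 0" using p by (auto simp: e_def)
  let ?Q = "\<lambda>d. d $ 0 = 0 \<and> d $ 1 = 1 \<and> (\<forall>n. d $ n \<in> \<int>) \<and> d ^ (p - 1) * Delta = Delta oo fps_X ^ p"
  define c where "c = (eta_prod oo fps_X ^ p) * inverse eta_prod"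
  have c0: "c $ 0 = 1" using p0 by (simp add: c_def)
  have "int_coeffs c"
    unfolding c_def using p0
    by (intro int_coeffs_mult int_coeffs_compose_X_power int_coeffs_inverse int_coeffs_eta_prod) auto
  then have int: "int_coeffs (fps_X * c ^ e)"
    by (intro int_coeffs_mult int_coeffs_X int_coeffs_power)
  have "inverse eta_prod * eta_prod = 1" by (rule inverse_mult_eq_1) simp
  then have ce: "c * eta_prod = eta_prod oo fps_X ^ p" by (simp add: c_def mult.assoc)
  have "(fps_X * c ^ e) ^ (p - 1) * Delta = fps_X ^ (p - 1) * fps_X * (c * eta_prod) ^ 24"
  proof -
    have "(c ^ e) ^ (p - 1) = c ^ 24" by (simp only: power_mult[symmetric] e)
    then show ?thesis by (simp only: Delta_def power_mult_distrib mult_ac)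
  qed
  also have "fps_X ^ (p - 1) * fps_X = (fps_X :: rat fps) ^ p"
    using p0 by (metis power_minus_mult)
  also have "fps_X ^ p * (c * eta_prod) ^ 24 = Delta oo fps_X ^ p"
    using p0 by (simp add: ce Delta_def fps_compose_mult_distrib flip: fps_compose_power)
  finally have ex: "?Q (fps_X * c ^ e)"
    using int c0 by (auto simp: int_coeffs_def fps_power_zeroth)
  have D0: "Delta \<noteq> 0"
  proof -
    have "eta_prod \<noteq> 0" using eta_prod_nth_0 by (metis fps_zero_nth zero_neq_one)
    then show ?thesis by (simp add: Delta_def)
  qed
  have "?Q (dp p)"
    unfolding dp_def
  proof (rule theI[of ?Q, OF ex])
    fix d assume d: "?Q d"
    then have "d ^ (p - 1) * Delta = (fps_X * c ^ e) ^ (p - 1) * Delta" using ex by metis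
    then have "d ^ (p - 1) = (fps_X * c ^ e) ^ (p - 1)" using D0 by simp
    then show "d = fps_X * c ^ e"
      by (rule fps_power_inject_normalized[OF _ p0(2)]) (use d ex in auto)
  qed
  then show "dp p $ 0 = 0" "dp p $ 1 = 1" "dp p ^ (p - 1) * Delta = Delta oo fps_X ^ p" by auto
qed

lemma cpx_dp_power:
  assumes p: "p \<in> {2, 3, 5, 7, 13}"
  shows "fmap ratc (dp p) ^ (p - 1) = eta_quot p"
proof -
  have p0: "p > 0" using p by auto
  let ?D = "fmap ratc (dp p)"
  have D: "fmap ratc Delta = fps_X * qprod 1 ^ 24"
    by (simp add: Delta_def morph_mult[OF cpx_morph] morph_power[OF cpx_morph] fmap_X[OF ring_morph_ratc] cpx_eta_prod)
  have "fmap ratc (dp p ^ (p - 1) * Delta) = fmap ratc (Delta oo fps_X ^ p)"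
    by (simp only: dp_properties(3)[OF p])
  then have "?D ^ (p - 1) * (fps_X * qprod 1 ^ 24) = (fps_X * qprod 1 ^ 24) oo fps_X ^ p"
    by (simp only: morph_mult[OF cpx_morph] morph_power[OF cpx_morph] D fmap_compose_X_power[OF ring_morph_ratc p0])
  also have "\<dots> = fps_X ^ p * (qprod 1 oo fps_X ^ p) ^ 24"
    using p0 by (simp add: fps_compose_mult_distrib flip: fps_compose_power)
  also have "\<dots> = fps_X ^ (p - 1) * fps_X * (qprod 1 oo fps_X ^ p) ^ 24"
    using power_minus_mult[OF p0, of "fps_X :: complex fps"] by simp
  also have "\<dots> = eta_quot p * (fps_X * qprod 1 ^ 24)"
    using eta_quot_eq[of p] by (simp add: mult_ac)
  finally show ?thesis by simp
qed

section \<open>The matrix of U and the logarithmic differential equation\<close>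

lemma Mmat_series:
  assumes p: "p \<in> {2, 3, 5, 7, 13}" and j: "j \<ge> 1"
  shows "Abs_fps (\<lambda>i. if 1 \<le> i \<and> 1 \<le> j then Mmat p i j else 0) oo dp p = Uop p (dp p ^ j)"
proof -
  note d = dp_properties(1,2)[OF p]
  let ?Q = "\<lambda>g. g $ 0 = 0 \<and> g oo dp p = Uop p (dp p ^ j)"
  \<comment> \<open>Since d = q + O(q^2) is invertible under composition, this is the only
    candidate. It has no constant term because j \<ge> 1, so nothing is lost by setting the entry i
    = 0 to zero.\<close>
  define g where "g = Uop p (dp p ^ j) oo fps_inv (dp p)"
  have "g oo dp p = Uop p (dp p ^ j) oo (fps_inv (dp p) oo dp p)"
    unfolding g_def using d by (intro fps_compose_assoc[symmetric]) (auto simp: fps_inv_def)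
  also have "fps_inv (dp p) oo dp p = fps_X" using d by (intro fps_inv) auto
  finally have gc: "g oo dp p = Uop p (dp p ^ j)" by simp
  have g0: "g $ 0 = 0" using d j by (simp add: g_def Uop_def)
  have "(THE g. ?Q g) = g"
  proof (rule the_equality)
    show "?Q g" using g0 gc by blast
    fix h assume h: "?Q h"
    have "(h - g) oo dp p = 0" using h gc by (simp add: fps_compose_sub_distrib)
    moreover have "dp p \<noteq> 0" using d(2) by auto
    ultimately have "h - g = 0" using fps_compose_eq_0_iff[of "dp p" "h - g"] d by auto
    then show "h = g" by simp
  qed
  then have "Mmat p i j = g $ i" for i by (simp add: Mmat_def)
  then have "Abs_fps (\<lambda>i. if 1 \<le> i \<and> 1 \<le> j then Mmat p i j else 0) = g"
    using g0 j by (auto simp: fps_eq_iff not_le less_Suc_eq)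
  then show ?thesis using gc by simp
qed

lemma Mgen_nth_0: "Mgen p $ 0 = 0"
  by (auto simp: Mgen_def fps_eq_iff)

lemma Mgen_nth_compose: "p \<in> {2, 3, 5, 7, 13} \<Longrightarrow> j \<ge> 1 \<Longrightarrow> Mgen p $ j oo dp p = Uop p (dp p ^ j)"
  using Mmat_series[of p j] by (simp add: Mgen_def)

text \<open>Coefficients in y of the solution of y dI/dy = c M I with I = 1 at y = 0. Solving the
  equation first yields I over the rational numbers; its algebraicity is then tested after
  embedding.\<close>

fun euler_sol :: "'a::{field_char_0} \<Rightarrow> (nat \<Rightarrow> 'a fps) \<Rightarrow> nat \<Rightarrow> 'a fps" where
  "euler_sol c M n = (if n = 0 then 1 else fps_const (c / of_nat n) * (\<Sum>j\<in>{1..n}. M j * euler_sol c M (n - j)))"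

declare euler_sol.simps [simp del]

lemma euler_sol_0: "euler_sol c M 0 = 1"
  by (simp add: euler_sol.simps)

lemma euler_sol_step: "of_nat n * euler_sol c M n = fps_const c * (\<Sum>j\<in>{1..n}. M j * euler_sol c M (n - j))"
proof (cases "n = 0")
  case False
  have "(of_nat n :: 'a fps) = fps_const (of_nat n)" by (simp add: fps_of_nat)
  then have "of_nat n * euler_sol c M n = (fps_const (of_nat n) * fps_const (c / of_nat n)) * (\<Sum>j\<in>{1..n}. M j * euler_sol c M (n - j))"
    using False by (subst euler_sol.simps) (simp add: mult.assoc)
  then show ?thesis using False by simp
qed simp

lemma X_times_deriv_nth: "(fps_X * fps_deriv F) $ n = of_nat n * F $ n" for F :: "'a::comm_ring_1 fps"
  by (cases n) auto

lemma euler_sol_equation: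
  assumes "M $ 0 = 0"
  shows "fps_X * fps_deriv (Abs_fps (euler_sol c (fps_nth M))) = fps_const (fps_const c) * (M * Abs_fps (euler_sol c (fps_nth M)))"
proof (rule fps_ext)
  fix n
  have "(M * Abs_fps (euler_sol c (fps_nth M))) $ n = (\<Sum>j\<in>{1..n}. M $ j * euler_sol c (fps_nth M) (n - j))"
    using assms by (simp add: fps_mult_nth sum.atLeast_Suc_atMost)
  then show "(fps_X * fps_deriv (Abs_fps (euler_sol c (fps_nth M)))) $ n =
     (fps_const (fps_const c) * (M * Abs_fps (euler_sol c (fps_nth M)))) $ n"
    unfolding X_times_deriv_nth by (simp add: euler_sol_step)
qed

lemma X_times_deriv_mult: "fps_X * fps_deriv (f * g) = (fps_X * fps_deriv f) * g + f * (fps_X * fps_deriv g)"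
  for f :: "'a::comm_ring_1 fps"
  by (simp add: algebra_simps)

lemma X_times_deriv_prod:
  fixes f :: "'i \<Rightarrow> 'a::comm_ring_1 fps"
  assumes "finite S" "\<And>k. k \<in> S \<Longrightarrow> fps_X * fps_deriv (f k) = L k * f k"
  shows "fps_X * fps_deriv (\<Prod>k\<in>S. f k) = (\<Sum>k\<in>S. L k) * (\<Prod>k\<in>S. f k)"
  using assms
proof (induction S rule: finite_induct)
  case (insert x S)
  have "fps_X * fps_deriv (\<Prod>k\<in>insert x S. f k) = (fps_X * fps_deriv (f x)) * (\<Prod>k\<in>S. f k) + f x * (fps_X * fps_deriv (\<Prod>k\<in>S. f k))"
    unfolding prod.insert[OF insert.hyps] by (rule X_times_deriv_mult)
  also have "\<dots> = (L x * f x) * (\<Prod>k\<in>S. f k) + f x * ((\<Sum>k\<in>S. L k) * (\<Prod>k\<in>S. f k))"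
    using insert by simp
  finally show ?case using insert.hyps by (simp add: algebra_simps)
qed simp

text \<open>The power sums \<open>t\<^sup>j\<close>, \<open>j \<ge> 1\<close>, are minus the logarithmic derivative of \<open>1 - t y\<close>.\<close>
lemma X_times_deriv_linear:
  fixes t :: "'a::comm_ring_1"
  shows "fps_X * fps_deriv (1 - fps_const t * fps_X) = - Abs_fps (\<lambda>j. if j = 0 then 0 else t ^ j) * (1 - fps_const t * fps_X)"
proof -
  let ?G = "Abs_fps (\<lambda>j. if j = 0 then 0 else t ^ j)"
  have "?G * (1 - fps_const t * fps_X) = fps_const t * fps_X"
  proof (rule fps_ext)
    fix n
    have "(?G * (1 - fps_const t * fps_X)) $ n = ?G $ n - t * (fps_X * ?G) $ n"
      by (simp add: algebra_simps)
    then show "(?G * (1 - fps_const t * fps_X)) $ n = (fps_const t * fps_X) $ n"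
      by (cases n) (auto simp: fps_X_nth)
  qed
  moreover have "fps_X * fps_deriv (1 - fps_const t * fps_X) = - (fps_const t * fps_X)"
    by (simp add: mult.commute flip: fps_const_neg)
  ultimately show ?thesis by (simp only: mult_minus_left)
qed

text \<open>With c a root of unity and X = q^(1/p), this is the substitution that permutes the
  conjugates of d.\<close>

lemma ring_morph_scale: "ring_morph (\<lambda>f. f oo (fps_const c * fps_X))"
  for c :: "'a::idom"
  by (rule ring_morphI) (simp_all add: fps_compose_add_distrib fps_compose_mult_distrib)

lemma inj_scale: "c \<noteq> 0 \<Longrightarrow> inj (\<lambda>f. f oo (fps_const c * fps_X))"
  for c :: "'a::field"
  by (auto simp: inj_def fps_eq_iff)

lemma poly_map_poly_morph:
  assumes \<phi>: "ring_morph \<phi>"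
  shows "ring_morph (\<lambda>P. poly (map_poly \<phi> P) x)"
proof (rule ring_morphI)
  note z = morph_0[OF \<phi>]
  show "poly (map_poly \<phi> 1) x = 1" by (simp add: morph_1[OF \<phi>] z)
  have "map_poly \<phi> (P + Q) = map_poly \<phi> P + map_poly \<phi> Q" for P Q
    by (rule poly_eqI) (simp add: coeff_map_poly z morph_add[OF \<phi>])
  then show "poly (map_poly \<phi> (P + Q)) x = poly (map_poly \<phi> P) x + poly (map_poly \<phi> Q) x" for P Q
    by simp
  have "map_poly \<phi> (P * Q) = map_poly \<phi> P * map_poly \<phi> Q" for P Q
    by (rule poly_eqI) (simp add: coeff_map_poly z coeff_mult morph_sum[OF \<phi>] morph_mult[OF \<phi>])
  then show "poly (map_poly \<phi> (P * Q)) x = poly (map_poly \<phi> P) x * poly (map_poly \<phi> Q) x" for P Q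
    by simp
qed

lemma ring_morph_eval_xy: "ring_morph eval_xy"
proof -
  have "ring_morph (\<lambda>a :: rat poly. fps_const (fps_of_poly a))"
    by (rule ring_morphI) (simp_all add: fps_of_poly_add fps_of_poly_mult)
  from poly_map_poly_morph[OF this] show ?thesis
    unfolding eval_xy_def[abs_def] .
qed

text \<open>The ring generated by x and y lies in the image of the rational polynomials under
  \<open>eval_xy\<close>, so a relation can be lifted coefficient by coefficient.\<close>

lemma algebraic_xyI:
  assumes "J \<in> acl (ring_gen {fps_const fps_X, fps_X})"
  shows "algebraic_xy J"
proof -
  note m = ring_morph_eval_xy
  have "base_ring (range eval_xy)"
    unfolding base_ring_def
    by (auto simp: morph_1[OF m, symmetric] morph_diff[OF m, symmetric] morph_mult[OF m, symmetric] simp del: morph_1)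
  moreover have "fps_X = eval_xy [:0, 1:]" "fps_const fps_X = eval_xy [:[:0, 1:]:]"
    by (simp_all add: eval_xy_def map_poly_pCons fps_of_poly_pCons)
  then have "{fps_const fps_X, fps_X} \<subseteq> range eval_xy" by blast
  ultimately have sub: "ring_gen {fps_const fps_X, fps_X} \<subseteq> range eval_xy"
    by (rule ring_gen_subset)
  obtain P where P: "P \<noteq> 0" "\<forall>i. Polynomial.coeff P i \<in> ring_gen {fps_const fps_X, fps_X}" "poly P J = 0"
    using assms unfolding acl_def by blast
  \<comment> \<open>\<open>map_poly\<close> acts on coefficients only if 0 goes to 0, which an
    arbitrary choice of preimages need not respect.\<close>
  define lift where "lift c = (if c = 0 then 0 else inv_into UNIV eval_xy c)" for c
  define Q where "Q = map_poly lift P"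
  have cQ: "eval_xy (Polynomial.coeff Q i) = Polynomial.coeff P i" for i
  proof -
    have "Polynomial.coeff P i \<in> range eval_xy" using P(2) sub by blast
    then show ?thesis by (auto simp: Q_def coeff_map_poly lift_def morph_0[OF m] f_inv_into_f)
  qed
  have QP: "map_poly eval_xy Q = P"
    by (rule poly_eqI) (simp add: coeff_map_poly morph_0[OF m] cQ)
  then have "Q \<noteq> 0" using P(1) by auto
  then show ?thesis unfolding algebraic_xy_def using QP P(3) by blast
qed

section \<open>The conjugates of d_p and the descent to Q[[x]][[y]]\<close>

lemma sum_unity_powers:
  fixes z :: complex
  assumes z: "z ^ p = 1" "inj_on (\<lambda>k. z ^ k) {..<p}" and "p > 0"
  shows "(\<Sum>k<p. (z ^ k) ^ n) = (if p dvd n then of_nat p else 0)"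
proof -
  have sw: "(z ^ k) ^ n = (z ^ n) ^ k" for k by (simp only: power_mult[symmetric] mult.commute)
  show ?thesis
  proof (cases "p dvd n")
    case True
    then have "z ^ n = 1" using primitive_root_eq_1_iff[OF assms] by blast
    then show ?thesis using True by (simp only: sw) simp
  next
    case False
    then have n1: "z ^ n \<noteq> 1" using primitive_root_eq_1_iff[OF assms] by blast
    have "(z ^ n) ^ p = 1" using sw[of p] z(1) by simp
    then show ?thesis using False geometric_sum[OF n1, of p] by (simp only: sw) simp
  qed
qed

context
  fixes p :: nat and z :: complex
  assumes p: "p \<in> {2, 3, 5, 7, 13}"
    and z: "z ^ p = 1" "inj_on (\<lambda>k. z ^ k) {..<p}"
begin

text \<open>From here on X stands for q^(1/p). The conjugates t_k are \<open>conj_dp k\<close>,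
  while \<open>pull\<close> sets x = d(q) = d(X^p), embedding Q[[x]] into C[[X]] so that M and the
  t_k can be compared.\<close>

definition "Dc = fmap ratc (dp p)"
definition "conj_dp k = Dc oo (cc (z ^ k) * fps_X)"
definition "pull g = (fmap ratc (g oo dp p)) oo fps_X ^ p" for g

lemma p_gt_1: "p > 0" "p \<ge> 2" "p - 1 > 0" using p by auto

lemma prime_p: "Factorial_Ring.prime p"
  using p by (auto simp: prime_nat_numeral_eq)

lemma z_nonzero: "z \<noteq> 0" using z(1) p_gt_1 by (auto simp: power_0_left)

lemma ring_morph_pull: "ring_morph pull"
proof (rule ring_morphI)
  note d = dp_properties(1)[OF p]
  show "pull 1 = 1" by (simp add: pull_def morph_1[OF cpx_morph])
  show "pull (x + y) = pull x + pull y" for x y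
    by (simp add: pull_def fps_compose_add_distrib morph_add[OF cpx_morph])
  show "pull (x * y) = pull x * pull y" for x y
    using d p_gt_1 by (simp add: pull_def fps_compose_mult_distrib morph_mult[OF cpx_morph])
qed

lemma inj_pull: "inj pull"
proof (rule injI)
  fix x y assume "pull x = pull y"
  then have "x oo dp p = y oo dp p"
    unfolding pull_def using inj_compose_X_power[OF p_gt_1(1)] inj_fmap[OF inj_ratc] by (metis injD)
  then have "(x - y) oo dp p = 0" by (simp add: fps_compose_sub_distrib)
  moreover have "dp p \<noteq> 0" using dp_properties(2)[OF p] by auto
  ultimately show "x = y" using fps_compose_eq_0_iff[of "dp p" "x - y"] dp_properties(1)[OF p] by auto
qed

lemma pull_X: "pull fps_X = Dc oo fps_X ^ p"
  using dp_properties(1)[OF p] by (simp add: pull_def Dc_def)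

text \<open>Summing over the roots of unity keeps exactly the exponents divisible by p, with weight
  p; this is U as a trace.\<close>

lemma power_sum_conj_dp:
  assumes "j \<ge> 1"
  shows "(\<Sum>k<p. conj_dp k ^ j) = of_nat p * pull (Mgen p $ j)"
proof (rule fps_ext)
  fix n
  have "conj_dp k ^ j = (Dc ^ j) oo (cc (z ^ k) * fps_X)" for k
    by (simp add: conj_dp_def fps_compose_power)
  then have "(\<Sum>k<p. conj_dp k ^ j) $ n = (\<Sum>k<p. (z ^ k) ^ n) * (Dc ^ j) $ n"
    by (simp add: fps_sum_nth sum_distrib_right)
  also have "\<dots> = of_nat p * (if p dvd n then (Dc ^ j) $ n else 0)"
    unfolding sum_unity_powers[OF z p_gt_1(1)] by simp
  also have "\<dots> = of_nat p * pull (Mgen p $ j) $ n"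
  proof -
    have "Dc ^ j = fmap ratc (dp p ^ j)" by (simp add: Dc_def morph_power[OF cpx_morph])
    then show ?thesis
      using p_gt_1 by (simp add: pull_def Mgen_nth_compose[OF p assms] compose_X_power_nth Uop_def)
  qed
  also have "\<dots> = (of_nat p * pull (Mgen p $ j)) $ n"
    by (simp add: fps_of_nat[symmetric])
  finally show "(\<Sum>k<p. conj_dp k ^ j) $ n = (of_nat p * pull (Mgen p $ j)) $ n" .
qed

definition "conj_prod = (\<Prod>k<p. 1 - fps_const (conj_dp k) * fps_X)"

lemma conj_prod_equation:
  "fps_X * fps_deriv conj_prod = - (of_nat p * fmap pull (Mgen p)) * conj_prod"
proof -
  have "(\<Sum>k<p. - Abs_fps (\<lambda>j. if j = 0 then 0 else conj_dp k ^ j)) = - (of_nat p * fmap pull (Mgen p))"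
  proof (rule fps_ext)
    fix j
    have "(of_nat p * fmap pull (Mgen p)) $ j = of_nat p * pull (Mgen p $ j)"
      by (simp add: fps_of_nat[symmetric])
    then show "(\<Sum>k<p. - Abs_fps (\<lambda>j. if j = 0 then 0 else conj_dp k ^ j)) $ j = (- (of_nat p * fmap pull (Mgen p))) $ j"
      using power_sum_conj_dp[of j]
      by (cases "j = 0") (auto simp: fps_sum_nth sum_negf Mgen_nth_0 morph_0[OF ring_morph_pull])
  qed
  moreover have "fps_X * fps_deriv conj_prod = (\<Sum>k<p. - Abs_fps (\<lambda>j. if j = 0 then 0 else conj_dp k ^ j)) * conj_prod"
    unfolding conj_prod_def by (rule X_times_deriv_prod[OF finite_lessThan X_times_deriv_linear])
  ultimately show ?thesis by (simp only:)
qed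

definition "sol = Abs_fps (euler_sol (of_nat p) (fps_nth (Mgen p)))"

lemma sol_equation: "fps_X * fps_deriv sol = fps_const (fps_const (of_nat p)) * (Mgen p * sol)"
  unfolding sol_def by (rule euler_sol_equation[OF Mgen_nth_0])

lemma fmap_X_times_deriv:
  assumes "ring_morph \<phi>"
  shows "fmap \<phi> (fps_X * fps_deriv F) = fps_X * fps_deriv (fmap \<phi> F)"
proof (rule fps_ext)
  fix n
  have "\<phi> (of_nat k) = of_nat k" for k
    by (induction k) (auto simp: morph_0[OF assms] morph_1[OF assms] morph_add[OF assms])
  then show "fmap \<phi> (fps_X * fps_deriv F) $ n = (fps_X * fps_deriv (fmap \<phi> F)) $ n"
    unfolding X_times_deriv_nth fmap_nth by (simp add: morph_mult[OF assms])
qed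

lemma pull_sol_equation: "fps_X * fps_deriv (fmap pull sol) = of_nat p * fmap pull (Mgen p) * fmap pull sol"
proof -
  have "fps_const (fps_const (of_nat p)) = (of_nat p :: rat fps fps)" by (simp add: fps_of_nat)
  moreover have "fmap pull (of_nat k) = of_nat k" for k
    using morph_0[OF ring_morph_fmap[OF ring_morph_pull]] morph_1[OF ring_morph_fmap[OF ring_morph_pull]]
      morph_add[OF ring_morph_fmap[OF ring_morph_pull]]
    by (induction k) auto
  moreover have "fps_X * fps_deriv (fmap pull sol) = fmap pull (fps_const (fps_const (of_nat p)) * (Mgen p * sol))"
    unfolding sol_equation[symmetric] by (rule fmap_X_times_deriv[OF ring_morph_pull, symmetric])
  ultimately show ?thesis
    by (simp only: morph_mult[OF ring_morph_fmap[OF ring_morph_pull]] mult.assoc)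
qed

text \<open>The logarithmic derivatives in y are opposite, so y d/dy kills the product. In
  characteristic 0 only its value at y = 0 remains, which is 1.\<close>

lemma pull_sol_times_conj_prod: "fmap pull sol * conj_prod = 1"
proof (rule fps_ext)
  fix n
  have e: "fps_X * fps_deriv (fmap pull sol * conj_prod) = 0"
    unfolding X_times_deriv_mult pull_sol_equation conj_prod_equation by (simp add: algebra_simps)
  show "(fmap pull sol * conj_prod) $ n = 1 $ n"
  proof (cases "n = 0")
    case True
    have "pull (euler_sol (of_nat p) (fps_nth (Mgen p)) 0) = 1"
      by (simp add: euler_sol_0 morph_1[OF ring_morph_pull])
    moreover have "ring_morph (\<lambda>f :: complex fps fps. f $ 0)" by (rule ring_morphI) simp_all
    then have "conj_prod $ 0 = 1" unfolding conj_prod_def by (subst morph_prod) simp_all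
    ultimately show ?thesis using True by (simp add: sol_def)
  next
    case False
    have "of_nat n * (fmap pull sol * conj_prod) $ n = 0"
      using arg_cong[OF e, of "\<lambda>f. f $ n"] unfolding X_times_deriv_nth by simp
    then show ?thesis using False by (simp only: mult_eq_0_iff of_nat_eq_0_iff) simp
  qed
qed

text \<open>The modular equation puts f(X^p) over f(X), whereas the conjugates need the reverse;
  exchange provides it. Scaling X by z^k then fixes f(X^p) and moves f(X) = d(X)^(p-1) to
  t_k^(p-1).\<close>

lemma conj_dp_algebraic: "conj_dp k ^ (p - 1) \<in> acl (ring_gen {Dc oo fps_X ^ p})"
proof -
  let ?\<sigma> = "\<lambda>f. f oo (cc (z ^ k) * fps_X)" and ?f = "eta_quot p"
  have zk: "z ^ k \<noteq> 0" using z_nonzero by simp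
  have fD: "?f = Dc ^ (p - 1)" using cpx_dp_power[OF p] by (simp add: Dc_def)
  have f: "?f oo fps_X ^ p \<in> acl (ring_gen {?f})" by (rule modular_equation[OF prime_p])
  have "?f oo fps_X ^ p \<notin> acl (ring_gen {})"
  proof (rule fps_not_acl_prime_ring)
    show "(?f oo fps_X ^ p) $ 0 = 0" using eta_quot_0[OF p_gt_1(2)] by simp
    show "?f oo fps_X ^ p \<noteq> 0"
      using eta_quot_neq_0[OF p_gt_1(1)] inj_eq[OF inj_compose_X_power[OF p_gt_1(1)], of ?f 0] by simp
  qed
  then have "?f \<in> acl (ring_gen {?f oo fps_X ^ p})" by (rule acl_exchange[OF f])
  then have "?\<sigma> ?f \<in> acl (ring_gen (?\<sigma> ` {?f oo fps_X ^ p}))"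
    by (rule iffD2[OF acl_ring_gen_morph_iff[OF ring_morph_scale inj_scale[OF zk]]])
  moreover have "?\<sigma> (?f oo fps_X ^ p) = ?f oo fps_X ^ p"
  proof (rule fps_ext)
    fix n
    have "(z ^ k) ^ n = 1" if "p dvd n"
    proof -
      have "z ^ n = 1" using that primitive_root_eq_1_iff[OF z p_gt_1(1)] by blast
      then have "(z ^ n) ^ k = 1" by simp
      then show ?thesis by (simp only: power_mult[symmetric] mult.commute)
    qed
    then show "?\<sigma> (?f oo fps_X ^ p) $ n = (?f oo fps_X ^ p) $ n"
      using p_gt_1(1) by (simp add: compose_X_power_nth)
  qed
  moreover have "?\<sigma> ?f = conj_dp k ^ (p - 1)"
    by (simp add: fD conj_dp_def fps_compose_power)
  ultimately have "conj_dp k ^ (p - 1) \<in> acl (ring_gen {?f oo fps_X ^ p})" by simp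
  moreover have "?f oo fps_X ^ p \<in> ring_gen {Dc oo fps_X ^ p}"
  proof -
    have "?f oo fps_X ^ p = (Dc oo fps_X ^ p) ^ (p - 1)"
      using p_gt_1(1) by (simp add: fD fps_compose_power)
    then show ?thesis by (simp only:) (intro base_ring_power ring_gen.gen; simp)
  qed
  then have "acl (ring_gen {?f oo fps_X ^ p}) \<subseteq> acl (ring_gen {Dc oo fps_X ^ p})"
    by (intro acl_mono ring_gen_subset) auto
  ultimately show ?thesis by blast
qed

text \<open>The conjugates are recovered from their (p-1)-th powers in the fraction field, where the
  product of the 1 - t_k y can also be inverted. The relation has coefficients in the ring generated
  by d(X^p) and y, the images of x and y, so it pulls back along the injective
  \<open>fmap pull\<close>.\<close>

lemma sol_algebraic: "algebraic_xy sol"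
proof (rule algebraic_xyI)
  let ?F = "to_fract :: complex fps fps \<Rightarrow> _"
  let ?x = "fps_const (Dc oo fps_X ^ p) :: complex fps fps"
  let ?A = "ring_gen (?F ` {?x, fps_X})"
  have A: "base_ring ?A" by simp
  have t: "?F (fps_const (conj_dp k)) \<in> acl ?A" for k
  proof (rule acl_nth_root[OF A _ p_gt_1(3)])
    have "fps_const (conj_dp k ^ (p - 1)) \<in> acl (ring_gen (fps_const ` {Dc oo fps_X ^ p}))"
      using conj_dp_algebraic acl_ring_gen_morph_iff[OF ring_morph_fps_const inj_fps_const] by blast
    also have "\<dots> \<subseteq> acl (ring_gen {?x, fps_X})"
      by (intro acl_mono ring_gen_mono) auto
    finally have "?F (fps_const (conj_dp k ^ (p - 1))) \<in> acl ?A"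
      using acl_ring_gen_fract by blast
    then show "?F (fps_const (conj_dp k)) ^ (p - 1) \<in> acl ?A"
      by (simp only: fps_const_power[symmetric] to_fract_power)
  qed
  have y: "?F fps_X \<in> acl ?A" by (intro base_subset_acl[OF A] ring_gen.gen) simp
  have "?F conj_prod \<in> acl ?A"
    unfolding conj_prod_def morph_prod[OF ring_morph_to_fract] to_fract_diff to_fract_mult to_fract_1
    by (intro acl_prod[OF A] acl_diff[OF A] acl_1[OF A] acl_mult[OF A] t y)
  moreover have "?F (fmap pull sol) * ?F conj_prod = 1"
    using pull_sol_times_conj_prod by (metis to_fract_1 to_fract_mult)
  then have "?F (fmap pull sol) = inverse (?F conj_prod)"
    by (metis inverse_unique mult.commute)
  ultimately have "?F (fmap pull sol) \<in> acl ?A" using acl_inverse[OF A] by simp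
  then have "fmap pull sol \<in> acl (ring_gen {?x, fps_X})" using acl_ring_gen_fract by blast
  moreover have "{?x, fps_X} = fmap pull ` {fps_const fps_X, fps_X}"
    by (simp add: fmap_const[OF ring_morph_pull] fmap_X[OF ring_morph_pull] pull_X)
  ultimately show "sol \<in> acl (ring_gen {fps_const fps_X, fps_X})"
    using acl_ring_gen_morph_iff[OF ring_morph_fmap[OF ring_morph_pull] inj_fmap[OF inj_pull]] by metis
qed

lemma sol_solves: "sol \<noteq> 0 \<and> algebraic_xy sol \<and> 
  Mgen p * sol = fps_const (fps_const (1 / of_nat p)) * fps_X * fps_deriv sol"
proof (intro conjI sol_algebraic)
  have "sol $ 0 = 1" by (simp add: sol_def euler_sol_0)
  then show "sol \<noteq> 0" by auto
  have "fps_const (fps_const (1 / of_nat p)) * fps_const (fps_const (of_nat p)) = (1 :: rat fps fps)"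
    using p_gt_1(1) by simp
  then show "Mgen p * sol = fps_const (fps_const (1 / of_nat p)) * fps_X * fps_deriv sol"
    unfolding mult.assoc sol_equation by (simp only: mult.assoc[symmetric]) simp
qed

end

theorem mainTheorem7:
  fixes p :: nat
  assumes "p \<in> {2, 3, 5, 7, 13}"
  shows "\<exists>I :: rat fps fps. I \<noteq> 0 \<and> algebraic_xy I \<and>
           Mgen p * I = fps_const (fps_const (1 / of_nat p)) * fps_X * fps_deriv I"
proof -
  have "p > 0" using assms by auto
  then obtain z :: complex where "z ^ p = 1" "inj_on (\<lambda>k. z ^ k) {..<p}"
    using primitive_root by blast
  from sol_solves[OF assms this] show ?thesis by blast
qed

end
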